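(* Let $b$ be a locally finite graph over $(X,m)$ with an intrinsic metric $d$. Let $n:X\times X\to\mathbb{N}_0$ be symmetric with $n(x,y)\ge1$ if and only if $x\sim y$, and let $b'$ over $(X',m')$ be the refinement of $b$ over $(X,m)$ (with metric $d$) with respect to $n$. If the refinement $b'$ over $(X',m')$ is stochastically complete, then $b$ over $(X,m)$ is stochastically complete.
   Context: $X$ is a countable discrete set and $m:X\to(0,\infty)$ is extended to a measure on all subsets of $X$ by additivity. A graph over $(X,m)$ is a symmetric map $b:X\times X\to[0,\infty)$ with $b(x,x)=0$ and $\sum_{y\in X}b(x,y)<\infty$ for all $x\in X$. Write $x\sim y$ if $b(x,y)>0$. The graph is locally finite if $\{y\in X\mid b(x,y)>0\}$ is finite for each $x\in X$. A (pseudo) metric $d$ on $X$ is intrinsic if $\sum_{y\in X}b(x,y)d(x,y)^2\le m(x)$ for all $x\in X$. Refinement: given a locally finite graph $b$ over $(X,m)$, $d$, and $n$ as in the claim, the refinement with respect to $n$ is the graph $b'$ over $(X',m')$ defined as follows. The vertex set is the disjoint union $X'=X\,\dot\cup\,\bigcup_{x,y\in X}X_{x,y}$, where $X_{x,y}=X_{y,x}$ are finite sets, disjoint for different unordered pairs $\{x,y\}$, with $\sharp X_{x,y}=n(x,y)$ (so $X_{x,y}=\emptyset$ if $x\not\sim y$). The measure is $m'|_X=m$ and $m'(z)=\frac{2b(x,y)d(x,y)^2}{n(x,y)+1}$ for $z\in X_{x,y}$, $x\sim y$. For $x\sim y$ fix an enumeration $X_{x,y}=\{x_1,\dots,x_{n(x,y)}\}$,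 put $x_0=x$, $x_{n(x,y)+1}=y$, and set $b'(x_{i-1},x_i)=b'(x_i,x_{i-1})=b(x,y)(n(x,y)+1)$ for $i=1,\dots,n(x,y)+1$; $b'=0$ otherwise. Stochastic completeness of a graph $b$ over $(X,m)$: let $C_c(X)$ be the finitely supported real functions on $X$ and $Q(f)=\frac12\sum_{x,y\in X}b(x,y)(f(x)-f(y))^2$, with domain $D(Q)$ the closure of $C_c(X)$ with respect to the norm $\|f\|_Q=\sqrt{Q(f)+\|f\|_2^2}$. This is a regular Dirichlet form on $\ell^2(X,m)$; let $L\ge0$ be the associated self-adjoint operator. The Markovian semigroup $e^{-tL}$, $t>0$, extends in the usual way to $\ell^p(X,m)$, $p\in[1,\infty]$ (for $0\le f\in\ell^\infty$, $e^{-tL}f$ is the monotone limit of $e^{-tL}f_k$ for $0\le f_k\in\ell^2(X,m)$ increasing pointwise to $f$). The graph is stochastically complete if $e^{-tL}1=1$ for some (equivalently, all) $t>0$, where $1$ is the constant function. The same definition applies to $b'$ over $(X',m')$. *)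

theory Defs
  imports "HOL-Analysis.Analysis"
begin

text \<open>
  Graphs live on a carrier set \<open>X\<close>; the values of \<open>m\<close>, \<open>b\<close>, \<open>d\<close>, \<open>n\<close> off the carrier are
  irrelevant throughout.
\<close>

definition graph_over :: "'a set \<Rightarrow> ('a \<Rightarrow> real) \<Rightarrow> ('a \<Rightarrow> 'a \<Rightarrow> real) \<Rightarrow> bool" where
  "graph_over X m b \<longleftrightarrow>
     countable X \<and>
     (\<forall>x\<in>X. m x > 0) \<and>
     (\<forall>x\<in>X. \<forall>y\<in>X. b x y \<ge> 0 \<and> b x y = b y x) \<and>
     (\<forall>x\<in>X. b x x = 0) \<and>
     (\<forall>x\<in>X. (\<lambda>y. b x y) summable_on X)"

definition locally_finite :: "'a set \<Rightarrow> ('a \<Rightarrow> 'a \<Rightarrow> real) \<Rightarrow> bool" where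
  "locally_finite X b \<longleftrightarrow> (\<forall>x\<in>X. finite {y \<in> X. b x y > 0})"

definition pseudo_metric_on :: "'a set \<Rightarrow> ('a \<Rightarrow> 'a \<Rightarrow> real) \<Rightarrow> bool" where
  "pseudo_metric_on X d \<longleftrightarrow>
     (\<forall>x\<in>X. \<forall>y\<in>X. d x y \<ge> 0 \<and> d x y = d y x) \<and>
     (\<forall>x\<in>X. d x x = 0) \<and>
     (\<forall>x\<in>X. \<forall>y\<in>X. \<forall>z\<in>X. d x z \<le> d x y + d y z)"

definition intrinsic_metric ::
    "'a set \<Rightarrow> ('a \<Rightarrow> real) \<Rightarrow> ('a \<Rightarrow> 'a \<Rightarrow> real) \<Rightarrow> ('a \<Rightarrow> 'a \<Rightarrow> real) \<Rightarrow> bool" where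
  "intrinsic_metric X m b d \<longleftrightarrow>
     pseudo_metric_on X d \<and>
     (\<forall>x\<in>X. (\<lambda>y. b x y * (d x y)\<^sup>2) summable_on X \<and>
             (\<Sum>\<^sub>\<infinity>y\<in>X. b x y * (d x y)\<^sup>2) \<le> m x)"


subsection \<open>Refinements\<close>

text \<open>
  \<open>\<iota>\<close> embeds \<open>X\<close> into the new vertex set, \<open>S x y\<close> is the set of new vertices on the edge
  \<open>{x, y}\<close>, and \<open>p x y 0, \<dots>, p x y (n x y + 1)\<close> lists the vertices on that edge in the
  order from \<open>x\<close> to \<open>y\<close>. One enumeration is fixed per unordered pair, so \<open>p y x\<close> is \<open>p x y\<close>
  reversed. All three are arbitrary, so this describes every refinement and not
  one particular model of the disjoint union.

  The requirement \<open>m' > 0\<close> is part of \<open>m'\<close> being a measure in the sense of \<open>graph_over\<close>. It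
  amounts to \<open>d x y > 0\<close> for adjacent \<open>x, y\<close>; this always holds when \<open>d\<close> is a metric and
  only restricts pseudo metrics, for which \<open>m'\<close> could otherwise vanish.
\<close>

definition is_refinement ::
    "'a set \<Rightarrow> ('a \<Rightarrow> real) \<Rightarrow> ('a \<Rightarrow> 'a \<Rightarrow> real) \<Rightarrow> ('a \<Rightarrow> 'a \<Rightarrow> real) \<Rightarrow> ('a \<Rightarrow> 'a \<Rightarrow> nat) \<Rightarrow>
     'w set \<Rightarrow> ('w \<Rightarrow> real) \<Rightarrow> ('w \<Rightarrow> 'w \<Rightarrow> real) \<Rightarrow> bool" where
  "is_refinement X m b d n X' m' b' \<longleftrightarrow>
     (\<exists>(\<iota> :: 'a \<Rightarrow> 'w) (S :: 'a \<Rightarrow> 'a \<Rightarrow> 'w set) (p :: 'a \<Rightarrow> 'a \<Rightarrow> nat \<Rightarrow> 'w).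
        inj_on \<iota> X \<and>
        (\<forall>x\<in>X. \<forall>y\<in>X. finite (S x y) \<and> card (S x y) = n x y \<and> S x y = S y x \<and>
                        S x y \<inter> \<iota> ` X = {}) \<and>
        (\<forall>x\<in>X. \<forall>y\<in>X. \<forall>u\<in>X. \<forall>v\<in>X. {x, y} \<noteq> {u, v} \<longrightarrow> S x y \<inter> S u v = {}) \<and>
        X' = \<iota> ` X \<union> (\<Union>x\<in>X. \<Union>y\<in>X. S x y) \<and>
        (\<forall>x\<in>X. m' (\<iota> x) = m x) \<and>
        (\<forall>x\<in>X. \<forall>y\<in>X. b x y > 0 \<longrightarrow>
            (\<forall>z\<in>S x y. m' z = 2 * b x y * (d x y)\<^sup>2 / (real (n x y) + 1))) \<and>
        (\<forall>z\<in>X'. m' z > 0) \<and>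
        (\<forall>x\<in>X. \<forall>y\<in>X. b x y > 0 \<longrightarrow>
            p x y 0 = \<iota> x \<and> p x y (n x y + 1) = \<iota> y \<and>
            bij_betw (p x y) {1..n x y} (S x y) \<and>
            (\<forall>i\<le>n x y + 1. p y x i = p x y (n x y + 1 - i))) \<and>
        (\<forall>x\<in>X. \<forall>y\<in>X. b x y > 0 \<longrightarrow>
            (\<forall>i\<in>{1..n x y + 1}.
               b' (p x y (i - 1)) (p x y i) = b x y * (real (n x y) + 1) \<and>
               b' (p x y i) (p x y (i - 1)) = b x y * (real (n x y) + 1))) \<and>
        (\<forall>z\<in>X'. \<forall>w\<in>X'.
            \<not> (\<exists>x\<in>X. \<exists>y\<in>X. b x y > 0 \<and>
                 (\<exists>i\<in>{1..n x y + 1}. (z = p x y (i - 1) \<and> w = p x y i) \<or>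
                                       (z = p x y i \<and> w = p x y (i - 1))))
            \<longrightarrow> b' z w = 0))"


subsection \<open>The Hilbert space and the Dirichlet form\<close>

text \<open>Functions on \<open>X\<close> are represented by functions on the type that vanish off \<open>X\<close>.\<close>

definition l2 :: "'a set \<Rightarrow> ('a \<Rightarrow> real) \<Rightarrow> ('a \<Rightarrow> real) set" where
  "l2 X m = {f. (\<forall>x. x \<notin> X \<longrightarrow> f x = 0) \<and> (\<lambda>x. m x * (f x)\<^sup>2) summable_on X}"

definition l2_inner :: "'a set \<Rightarrow> ('a \<Rightarrow> real) \<Rightarrow> ('a \<Rightarrow> real) \<Rightarrow> ('a \<Rightarrow> real) \<Rightarrow> real" where
  "l2_inner X m f g = (\<Sum>\<^sub>\<infinity>x\<in>X. m x * f x * g x)"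

definition l2_norm :: "'a set \<Rightarrow> ('a \<Rightarrow> real) \<Rightarrow> ('a \<Rightarrow> real) \<Rightarrow> real" where
  "l2_norm X m f = sqrt (l2_inner X m f f)"

definition C\<^sub>c :: "'a set \<Rightarrow> ('a \<Rightarrow> real) set" where
  "C\<^sub>c X = {f. (\<forall>x. x \<notin> X \<longrightarrow> f x = 0) \<and> finite {x \<in> X. f x \<noteq> 0}}"

definition finite_energy :: "'a set \<Rightarrow> ('a \<Rightarrow> 'a \<Rightarrow> real) \<Rightarrow> ('a \<Rightarrow> real) \<Rightarrow> bool" where
  "finite_energy X b f \<longleftrightarrow> (\<lambda>(x, y). b x y * (f x - f y)\<^sup>2) summable_on (X \<times> X)"

text \<open>The bilinear form with quadratic form \<open>Q(f) = energy X b f f\<close>.\<close>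

definition energy ::
    "'a set \<Rightarrow> ('a \<Rightarrow> 'a \<Rightarrow> real) \<Rightarrow> ('a \<Rightarrow> real) \<Rightarrow> ('a \<Rightarrow> real) \<Rightarrow> real" where
  "energy X b f g = (1 / 2) * (\<Sum>\<^sub>\<infinity>(x, y)\<in>X \<times> X. b x y * (f x - f y) * (g x - g y))"

definition form_norm ::
    "'a set \<Rightarrow> ('a \<Rightarrow> real) \<Rightarrow> ('a \<Rightarrow> 'a \<Rightarrow> real) \<Rightarrow> ('a \<Rightarrow> real) \<Rightarrow> real" where
  "form_norm X m b f = sqrt (energy X b f f + (l2_norm X m f)\<^sup>2)"

definition form_domain ::
    "'a set \<Rightarrow> ('a \<Rightarrow> real) \<Rightarrow> ('a \<Rightarrow> 'a \<Rightarrow> real) \<Rightarrow> ('a \<Rightarrow> real) set" where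
  "form_domain X m b =
     {f \<in> l2 X m. finite_energy X b f \<and>
        (\<exists>\<phi>. (\<forall>k. \<phi> k \<in> C\<^sub>c X) \<and>
             (\<lambda>k::nat. form_norm X m b (\<lambda>x. f x - \<phi> k x)) \<longlonglongrightarrow> 0)}"

text \<open>
  The self-adjoint operator \<open>L\<close> of the closed form, as its graph: \<open>f \<in> D(L)\<close> and \<open>L f = g\<close> iff
  \<open>Q(f, h) = \<langle>g, h\<rangle>\<close> for all \<open>h \<in> D(Q)\<close>.
\<close>

definition form_operator ::
    "'a set \<Rightarrow> ('a \<Rightarrow> real) \<Rightarrow> ('a \<Rightarrow> 'a \<Rightarrow> real) \<Rightarrow> (('a \<Rightarrow> real) \<times> ('a \<Rightarrow> real)) set" where
  "form_operator X m b =
     {(f, g). f \<in> form_domain X m b \<and> g \<in> l2 X m \<and>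
              (\<forall>h\<in>form_domain X m b. energy X b f h = l2_inner X m g h)}"


subsection \<open>The semigroup and stochastic completeness\<close>

definition C0_semigroup ::
    "'a set \<Rightarrow> ('a \<Rightarrow> real) \<Rightarrow> (real \<Rightarrow> ('a \<Rightarrow> real) \<Rightarrow> 'a \<Rightarrow> real) \<Rightarrow> bool" where
  "C0_semigroup X m T \<longleftrightarrow>
     (\<forall>t\<ge>0. \<forall>f\<in>l2 X m. T t f \<in> l2 X m) \<and>
     (\<forall>t\<ge>0. \<forall>f\<in>l2 X m. \<forall>g\<in>l2 X m. \<forall>\<alpha> \<beta>.
         T t (\<lambda>x. \<alpha> * f x + \<beta> * g x) = (\<lambda>x. \<alpha> * T t f x + \<beta> * T t g x)) \<and>
     (\<forall>t\<ge>0. \<exists>C. \<forall>f\<in>l2 X m. l2_norm X m (T t f) \<le> C * l2_norm X m f) \<and>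
     (\<forall>f\<in>l2 X m. T 0 f = f) \<and>
     (\<forall>s\<ge>0. \<forall>t\<ge>0. \<forall>f\<in>l2 X m. T (s + t) f = T s (T t f)) \<and>
     (\<forall>f\<in>l2 X m. ((\<lambda>t. l2_norm X m (\<lambda>x. T t f x - f x)) \<longlongrightarrow> 0) (at_right 0))"

definition generator ::
    "'a set \<Rightarrow> ('a \<Rightarrow> real) \<Rightarrow> (real \<Rightarrow> ('a \<Rightarrow> real) \<Rightarrow> 'a \<Rightarrow> real) \<Rightarrow>
     (('a \<Rightarrow> real) \<times> ('a \<Rightarrow> real)) set" where
  "generator X m T =
     {(f, g). f \<in> l2 X m \<and> g \<in> l2 X m \<and>
        ((\<lambda>t. l2_norm X m (\<lambda>x. (T t f x - f x) / t - g x)) \<longlongrightarrow> 0) (at_right 0)}"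

text \<open>
  \<open>T t = exp (- t L)\<close> on \<open>l2 X m\<close>: the strongly continuous semigroup with generator \<open>- L\<close>. It
  exists since \<open>L\<close> is self-adjoint and nonnegative, and a semigroup is determined by its
  generator (for \<open>t \<ge> 0\<close> and on \<open>l2 X m\<close>; other values of \<open>T\<close> are irrelevant).
\<close>

definition is_heat_semigroup ::
    "'a set \<Rightarrow> ('a \<Rightarrow> real) \<Rightarrow> ('a \<Rightarrow> 'a \<Rightarrow> real) \<Rightarrow>
     (real \<Rightarrow> ('a \<Rightarrow> real) \<Rightarrow> 'a \<Rightarrow> real) \<Rightarrow> bool" where
  "is_heat_semigroup X m b T \<longleftrightarrow>
     C0_semigroup X m T \<and>
     generator X m T = {(f, \<lambda>x. - g x) | f g. (f, g) \<in> form_operator X m b}"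

definition increasing_l2_approx ::
    "'a set \<Rightarrow> ('a \<Rightarrow> real) \<Rightarrow> (nat \<Rightarrow> 'a \<Rightarrow> real) \<Rightarrow> ('a \<Rightarrow> real) \<Rightarrow> bool" where
  "increasing_l2_approx X m \<phi> f \<longleftrightarrow>
     (\<forall>k. \<phi> k \<in> l2 X m) \<and>
     (\<forall>x\<in>X. (\<forall>k. 0 \<le> \<phi> k x) \<and> incseq (\<lambda>k. \<phi> k x) \<and> (\<lambda>k. \<phi> k x) \<longlonglongrightarrow> f x)"

text \<open>
  \<open>u\<close> is the value at the nonnegative bounded function \<open>f\<close> of the extension of \<open>T t\<close> to bounded
  functions. For the (positivity preserving) heat semigroup the limit exists and does not
  depend on the approximating sequence, and approximating sequences exist as \<open>X\<close> is countable.
\<close>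

definition linf_extension_value ::
    "'a set \<Rightarrow> ('a \<Rightarrow> real) \<Rightarrow> (real \<Rightarrow> ('a \<Rightarrow> real) \<Rightarrow> 'a \<Rightarrow> real) \<Rightarrow> real \<Rightarrow>
     ('a \<Rightarrow> real) \<Rightarrow> ('a \<Rightarrow> real) \<Rightarrow> bool" where
  "linf_extension_value X m T t f u \<longleftrightarrow>
     (\<exists>\<phi>. increasing_l2_approx X m \<phi> f \<and> (\<forall>x\<in>X. (\<lambda>k. T t (\<phi> k) x) \<longlonglongrightarrow> u x))"

definition stochastically_complete ::
    "'a set \<Rightarrow> ('a \<Rightarrow> real) \<Rightarrow> ('a \<Rightarrow> 'a \<Rightarrow> real) \<Rightarrow> bool" where
  "stochastically_complete X m b \<longleftrightarrow>
     (\<exists>T. is_heat_semigroup X m b T \<and>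
          (\<exists>t>0. linf_extension_value X m T t (\<lambda>_. 1) (\<lambda>_. 1)))"

end

theory Submission
  imports Defs
begin

text \<open>
  The argument is by contraposition and runs through bounded solutions of an elliptic inequality.
  Let \<open>L\<close> be the Laplacian of a graph, \<open>m x * L u x = (\<Sum>y. b x y * (u x - u y))\<close>. If the heat
  semigroup of \<open>b\<close> loses mass, then \<open>w = 1 - (L + 1)\<^sup>-\<^sup>1 1\<close> is a nonzero function with values in
  \<open>[0, 1]\<close> and \<open>L w = - w\<close> (\<open>not_stochastically_complete_solution\<close>). Conversely, on a
  stochastically complete graph no nonzero function with values in \<open>[0, 1]\<close> satisfies
  \<open>L w \<le> - w\<close>, because the resolvent of \<open>1\<close> would have to stay below \<open>1 - w\<close>
  (\<open>stochastically_complete_no_subsolution\<close>). So it suffices to carry \<open>w\<close> over to the refined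
  graph as a subsolution.

  Linear interpolation along the subdivided edges keeps the Laplacian at the old vertices, but the
  interpolated function is harmonic at the new ones, which is not enough. It is therefore bent
  down along each edge into a parabola. With \<open>N = n x y + 1\<close> segments, conductance \<open>b x y * N\<close> and
  mass \<open>2 * b x y * (d x y)\<^sup>2 / N\<close>, the parabola \<open>\<kappa> * (d x y)\<^sup>2 / N\<^sup>2 * i * (N - i)\<close> gains
  exactly \<open>\<kappa>\<close> at every new vertex. At an old vertex \<open>x\<close> it costs at most
  \<open>\<kappa> / m x * (\<Sum>y. b x y * (d x y)\<^sup>2)\<close>, and this is at most \<open>\<kappa>\<close> because the metric is intrinsic.
  The cost is absolute and not proportional to \<open>w x\<close>, so only the top of \<open>w\<close> is transplanted:
  with \<open>\<kappa> = sup w / 3\<close>, the function \<open>v = w - 2 * \<kappa>\<close> has \<open>L v \<le> - 2 * \<kappa>\<close> where it is positive,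
  the bent interpolant of \<open>v\<close> still has \<open>L \<le> - \<kappa>\<close> there, and its positive part takes values in
  \<open>[0, \<kappa>]\<close> (\<open>interpolant_subsolution\<close>).

  What remains is to tie heat semigroups, which are given here only through their generator, to the
  Laplacian. For a finite set \<open>K\<close> of vertices the heat flow that is absorbed outside \<open>K\<close> is a
  finite linear system; by comparison principles it is positive, bounded by \<open>1\<close>, contracting and
  increasing in \<open>K\<close>. Its limit along an exhaustion is a contraction semigroup \<open>heat\<close>. The Laplace
  transforms of the finite flows are the Galerkin approximations of the weak solution of
  \<open>(L + 1) u = f\<close>, so the Laplace transform of \<open>heat\<close> at one is the resolvent of the Dirichlet form,
  and \<open>heat\<close> is generated by the operator of the form (\<open>heat_is_heat_semigroup\<close>). Any other
  semigroup with this generator coincides with it (\<open>heat_semigroup_unique\<close>). Hence stochastic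
  completeness may be tested on \<open>heat\<close>, where positivity and monotonicity are available.
\<close>

section \<open>Weighted square-summable functions\<close>

text \<open>
  The space \<open>l2\<close> without the requirement that functions vanish off the index set. The index set
  is arbitrary, so that functions of edges can be treated in the same way as functions of vertices.
\<close>

definition sq_summable :: "'i set \<Rightarrow> ('i \<Rightarrow> real) \<Rightarrow> ('i \<Rightarrow> real) \<Rightarrow> bool" where
  "sq_summable A w f \<longleftrightarrow> (\<lambda>x. w x * (f x)\<^sup>2) summable_on A"

locale weighted_set =
  fixes A :: "'i set" and w :: "'i \<Rightarrow> real"
  assumes weight_nonneg: "x \<in> A \<Longrightarrow> 0 \<le> w x"
begin

abbreviation sqs :: "('i \<Rightarrow> real) \<Rightarrow> bool" where "sqs \<equiv> sq_summable A w"
abbreviation nrm :: "('i \<Rightarrow> real) \<Rightarrow> real" where "nrm \<equiv> l2_norm A w"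
abbreviation ip :: "('i \<Rightarrow> real) \<Rightarrow> ('i \<Rightarrow> real) \<Rightarrow> real" where "ip \<equiv> l2_inner A w"

lemma product_summable:
  assumes "sqs f" "sqs g"
  shows "(\<lambda>x. w x * f x * g x) summable_on A"
proof -
  have s: "(\<lambda>x. w x * (f x)\<^sup>2 + w x * (g x)\<^sup>2) summable_on A"
    using assms unfolding sq_summable_def by (rule summable_on_add)
  have "(\<lambda>x. norm (w x * f x * g x)) summable_on A"
  proof (rule Infinite_Sum.abs_summable_on_comparison_test'[OF s])
    fix x assume "x \<in> A"
    then have w: "0 \<le> w x" by (rule weight_nonneg)
    have "\<bar>f x * g x\<bar> \<le> (f x)\<^sup>2 + (g x)\<^sup>2"
      using sum_squares_bound[of "\<bar>f x\<bar>" "\<bar>g x\<bar>"] mult_nonneg_nonneg[OF abs_ge_zero abs_ge_zero, of "f x" "g x"]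
      unfolding abs_mult power2_abs by linarith
    from mult_left_mono[OF this w]
    show "norm (w x * f x * g x) \<le> w x * (f x)\<^sup>2 + w x * (g x)\<^sup>2"
      using w by (simp add: abs_mult algebra_simps)
  qed
  then show ?thesis by (rule Infinite_Sum.abs_summable_summable)
qed

lemma sq_summable_lincomb:
  assumes "sqs f" "sqs g"
  shows "sqs (\<lambda>x. \<alpha> * f x + \<beta> * g x)"
proof -
  have "(\<lambda>x. \<alpha>\<^sup>2 * (w x * (f x)\<^sup>2) + 2 * \<alpha> * \<beta> * (w x * f x * g x) + \<beta>\<^sup>2 * (w x * (g x)\<^sup>2)) summable_on A"
    using assms product_summable[OF assms] unfolding sq_summable_def
    by (intro summable_on_add summable_on_cmult_right) auto
  also have "(\<lambda>x. \<alpha>\<^sup>2 * (w x * (f x)\<^sup>2) + 2 * \<alpha> * \<beta> * (w x * f x * g x) + \<beta>\<^sup>2 * (w x * (g x)\<^sup>2))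
      = (\<lambda>x. w x * (\<alpha> * f x + \<beta> * g x)\<^sup>2)"
    by (auto simp: power2_eq_square algebra_simps)
  finally show ?thesis unfolding sq_summable_def .
qed

lemma sq_summable_diff:
  "sqs f \<Longrightarrow> sqs g \<Longrightarrow> sqs (\<lambda>x. f x - g x)"
  using sq_summable_lincomb[of f g 1 "-1"] by simp

lemma sq_summable_add:
  "sqs f \<Longrightarrow> sqs g \<Longrightarrow> sqs (\<lambda>x. f x + g x)"
  using sq_summable_lincomb[of f g 1 1] by simp

lemma sq_summable_scale: "sqs f \<Longrightarrow> sqs (\<lambda>x. \<alpha> * f x)"
  using sq_summable_lincomb[of f f \<alpha> 0] by simp

lemma sq_summable_finite_support:
  assumes "finite {x \<in> A. f x \<noteq> 0}"
  shows "sqs f"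
proof -
  have "(\<lambda>x. w x * (f x)\<^sup>2) summable_on {x \<in> A. f x \<noteq> 0}"
    using assms by (rule summable_on_finite)
  then show ?thesis unfolding sq_summable_def
    by (subst summable_on_cong_neutral[where T = "{x \<in> A. f x \<noteq> 0}" and g = "\<lambda>x. w x * (f x)\<^sup>2"]) auto
qed

lemma sq_summable_dominated:
  assumes "sqs g" "\<And>x. x \<in> A \<Longrightarrow> \<bar>f x\<bar> \<le> \<bar>g x\<bar>"
  shows "sqs f"
  unfolding sq_summable_def
proof (rule Infinite_Sum.abs_summable_summable,
    rule Infinite_Sum.abs_summable_on_comparison_test'[OF assms(1)[unfolded sq_summable_def]])
  fix x assume x: "x \<in> A"
  then show "norm (w x * (f x)\<^sup>2) \<le> w x * (g x)\<^sup>2"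
    using assms(2)[OF x] weight_nonneg[OF x]
    by (simp add: abs_mult mult_left_mono abs_le_square_iff)
qed

lemma inner_commute: "ip f g = ip g f"
  unfolding l2_inner_def by (rule infsum_cong) simp

lemma inner_lincomb_left:
  assumes "sqs f" "sqs g" "sqs h"
  shows "ip (\<lambda>x. \<alpha> * f x + \<beta> * g x) h = \<alpha> * ip f h + \<beta> * ip g h"
proof -
  note s = product_summable[OF assms(1,3)] product_summable[OF assms(2,3)]
  have "ip (\<lambda>x. \<alpha> * f x + \<beta> * g x) h
      = (\<Sum>\<^sub>\<infinity>x\<in>A. \<alpha> * (w x * f x * h x) + \<beta> * (w x * g x * h x))"
    unfolding l2_inner_def by (rule infsum_cong) (simp add: algebra_simps)
  also have "\<dots> = (\<Sum>\<^sub>\<infinity>x\<in>A. \<alpha> * (w x * f x * h x)) + (\<Sum>\<^sub>\<infinity>x\<in>A. \<beta> * (w x * g x * h x))"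
    using s by (intro infsum_add summable_on_cmult_right) auto
  also have "\<dots> = \<alpha> * ip f h + \<beta> * ip g h"
    unfolding l2_inner_def using s by (simp add: infsum_cmult_right)
  finally show ?thesis .
qed

lemma inner_diff_left:
  assumes "sqs f" "sqs g" "sqs h"
  shows "ip (\<lambda>x. f x - g x) h = ip f h - ip g h"
  using inner_lincomb_left[OF assms, of 1 "-1"] by simp

lemma inner_diff_right:
  assumes "sqs f" "sqs g" "sqs h"
  shows "ip h (\<lambda>x. f x - g x) = ip h f - ip h g"
  using inner_diff_left[OF assms] by (simp add: inner_commute)

lemma inner_self: "ip f f = (\<Sum>\<^sub>\<infinity>x\<in>A. w x * (f x)\<^sup>2)"
  unfolding l2_inner_def by (simp add: power2_eq_square mult.assoc)

lemma inner_self_nonneg: "0 \<le> ip f f"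
  unfolding inner_self by (rule infsum_nonneg) (simp add: weight_nonneg)

lemma norm_nonneg: "0 \<le> nrm f"
  unfolding l2_norm_def using inner_self_nonneg by simp

lemma norm_square: "(nrm f)\<^sup>2 = ip f f"
  unfolding l2_norm_def using inner_self_nonneg by simp

text \<open>
  The quadratic expansion from which the Cauchy-Schwarz inequality and all norm estimates below
  are derived.
\<close>

lemma inner_square_lincomb:
  assumes f: "sqs f" and g: "sqs g"
  shows "ip (\<lambda>x. \<alpha> * f x + \<beta> * g x) (\<lambda>x. \<alpha> * f x + \<beta> * g x)
       = \<alpha>\<^sup>2 * ip f f + 2 * \<alpha> * \<beta> * ip f g + \<beta>\<^sup>2 * ip g g"
  (is "ip ?h ?h = _")
proof -
  have h: "sqs ?h" using assms by (rule sq_summable_lincomb)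
  have "ip ?h ?h = \<alpha> * ip f ?h + \<beta> * ip g ?h"
    by (rule inner_lincomb_left[OF f g h])
  also have "ip f ?h = \<alpha> * ip f f + \<beta> * ip f g"
    using inner_lincomb_left[OF f g f] by (simp add: inner_commute)
  also have "ip g ?h = \<alpha> * ip f g + \<beta> * ip g g"
    using inner_lincomb_left[OF f g g] by (simp add: inner_commute)
  finally show ?thesis by (simp add: power2_eq_square algebra_simps)
qed

lemma Cauchy_Schwarz:
  assumes f: "sqs f" and g: "sqs g"
  shows "\<bar>ip f g\<bar> \<le> nrm f * nrm g"
proof -
  define a c p where "a = ip f f" and "c = ip g g" and "p = ip f g"
  have a: "0 \<le> a" and c: "0 \<le> c" by (simp_all add: a_def c_def inner_self_nonneg)
  have q: "0 \<le> \<alpha>\<^sup>2 * a + 2 * \<alpha> * \<beta> * p + \<beta>\<^sup>2 * c" for \<alpha> \<beta>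
    using inner_self_nonneg[of "\<lambda>x. \<alpha> * f x + \<beta> * g x"] inner_square_lincomb[OF f g, of \<alpha> \<beta>]
    by (simp add: a_def c_def p_def)
  have "p\<^sup>2 \<le> a * c"
  proof (cases "c = 0")
    case True
    have "p = 0"
    proof (rule ccontr)
      assume "p \<noteq> 0"
      have "0 \<le> a + 2 * (- (a + 1) / (2 * p)) * p" using q[of 1 "- (a + 1) / (2 * p)"] True by simp
      also have "\<dots> = - 1" using \<open>p \<noteq> 0\<close> by (simp add: field_simps)
      finally show False by simp
    qed
    then show ?thesis using a c by simp
  next
    case False
    \<comment> \<open>The minimizing combination.\<close>
    with q[of c "- p"] have "0 \<le> c * (a * c - p\<^sup>2)" by (simp add: power2_eq_square algebra_simps)
    with False c show ?thesis by (simp add: zero_le_mult_iff)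
  qed
  then have "\<bar>p\<bar> \<le> sqrt (a * c)" by (metis real_sqrt_abs real_sqrt_le_iff)
  then show ?thesis unfolding l2_norm_def by (simp add: a_def c_def p_def real_sqrt_mult)
qed

lemma norm_scale: "nrm (\<lambda>x. \<alpha> * f x) = \<bar>\<alpha>\<bar> * nrm f"
proof -
  have "ip (\<lambda>x. \<alpha> * f x) (\<lambda>x. \<alpha> * f x) = (\<Sum>\<^sub>\<infinity>x\<in>A. \<alpha>\<^sup>2 * (w x * f x * f x))"
    unfolding l2_inner_def by (rule infsum_cong) (simp add: power2_eq_square)
  also have "\<dots> = \<alpha>\<^sup>2 * ip f f"
    unfolding l2_inner_def by (rule infsum_cmult_right')
  finally show ?thesis unfolding l2_norm_def by (simp add: real_sqrt_mult)
qed

lemma norm_triangle: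
  assumes f: "sqs f" and g: "sqs g"
  shows "nrm (\<lambda>x. f x + g x) \<le> nrm f + nrm g"
proof -
  have "(nrm (\<lambda>x. f x + g x))\<^sup>2
      = (nrm f)\<^sup>2 + 2 * ip f g + (nrm g)\<^sup>2"
    using inner_square_lincomb[OF f g, of 1 1] by (simp add: norm_square)
  also have "\<dots> \<le> (nrm f + nrm g)\<^sup>2"
    using Cauchy_Schwarz[OF f g] by (simp add: power2_eq_square algebra_simps)
  finally show ?thesis by (rule power2_le_imp_le) (simp add: norm_nonneg)
qed

lemma norm_minus_commute: "nrm (\<lambda>x. f x - g x) = nrm (\<lambda>x. g x - f x)"
  using norm_scale[of "-1" "\<lambda>x. f x - g x"] by simp

lemma norm_triangle_diff:
  assumes "sqs f" and "sqs g"
  shows "nrm (\<lambda>x. f x - g x) \<le> nrm f + nrm g"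
  using norm_triangle[OF assms(1) sq_summable_scale[OF assms(2), of "-1"]] norm_scale[of "-1" g]
  by simp

lemma norm_triangle_via:
  assumes "sqs f" "sqs g" "sqs h"
  shows "nrm (\<lambda>x. f x - h x) \<le> nrm (\<lambda>x. f x - g x) + nrm (\<lambda>x. g x - h x)"
  using norm_triangle[OF sq_summable_diff[OF assms(1,2)] sq_summable_diff[OF assms(2,3)]] by simp

lemma norm_reverse_triangle:
  assumes f: "sqs f" and g: "sqs g"
  shows "\<bar>nrm f - nrm g\<bar> \<le> nrm (\<lambda>x. f x - g x)"
  using norm_triangle[OF sq_summable_diff[OF f g] g] norm_triangle[OF sq_summable_diff[OF g f] f]
  by (simp add: norm_minus_commute[of f g])

lemma finite_sum_le_inner:
  assumes "sqs f" "finite F" "F \<subseteq> A"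
  shows "(\<Sum>x\<in>F. w x * (f x)\<^sup>2) \<le> ip f f"
  unfolding inner_self using assms
  by (intro finite_sum_le_infsum) (auto simp: sq_summable_def weight_nonneg)

text \<open>
  On a discrete space every single point has mass, so convergence in norm implies pointwise
  convergence.
\<close>

lemma pointwise_le_norm:
  assumes "sqs f" "x \<in> A" "0 < w x"
  shows "\<bar>f x\<bar> \<le> nrm f / sqrt (w x)"
proof -
  have "w x * (f x)\<^sup>2 \<le> (nrm f)\<^sup>2"
    using finite_sum_le_inner[OF assms(1), of "{x}"] assms(2) by (simp add: norm_square)
  then have "sqrt (w x * (f x)\<^sup>2) \<le> nrm f"
    using norm_nonneg real_le_lsqrt by (simp add: real_sqrt_le_iff norm_square l2_norm_def)
  then show ?thesis using assms(3) by (simp add: real_sqrt_mult pos_le_divide_eq mult.commute)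
qed

lemma sq_summable_finite_bound:
  assumes "\<And>F. finite F \<Longrightarrow> F \<subseteq> A \<Longrightarrow> (\<Sum>x\<in>F. w x * (g x)\<^sup>2) \<le> C"
  shows "sqs g" "ip g g \<le> C"
proof -
  show s: "sqs g" unfolding sq_summable_def
    by (rule nonneg_bdd_above_summable_on)
       (use assms weight_nonneg in \<open>auto intro!: bdd_aboveI[where M = C]\<close>)
  show "ip g g \<le> C"
    unfolding inner_self using s assms by (intro infsum_le_finite_sums) (auto simp: sq_summable_def)
qed

text \<open>
  Limits are taken pointwise throughout; this is the tool that turns uniform norm bounds into norm
  bounds for the limit, and completeness is one of its consequences.
\<close>

lemma Fatou:
  assumes sq: "\<And>k. sqs (g k)"
    and lim: "\<And>x. x \<in> A \<Longrightarrow> (\<lambda>k. g k x) \<longlonglongrightarrow> h x"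
    and bound: "\<forall>\<^sub>F k in sequentially. nrm (g k) \<le> C"
  shows "sqs h" "nrm h \<le> C"
proof -
  have C: "0 \<le> C"
  proof -
    from eventually_happens[OF bound] obtain k where "nrm (g k) \<le> C" by auto
    then show ?thesis using norm_nonneg[of "g k"] by linarith
  qed
  have *: "(\<Sum>x\<in>F. w x * (h x)\<^sup>2) \<le> C\<^sup>2" if F: "finite F" "F \<subseteq> A" for F
  proof (rule tendsto_upperbound[where F = sequentially])
    show "(\<lambda>k. \<Sum>x\<in>F. w x * (g k x)\<^sup>2) \<longlonglongrightarrow> (\<Sum>x\<in>F. w x * (h x)\<^sup>2)"
      using F lim by (intro tendsto_intros) auto
    show "\<forall>\<^sub>F k in sequentially. (\<Sum>x\<in>F. w x * (g k x)\<^sup>2) \<le> C\<^sup>2"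
      using bound
    proof eventually_elim
      case (elim k)
      have "(nrm (g k))\<^sup>2 \<le> C\<^sup>2" using elim norm_nonneg by (intro power_mono)
      then show ?case using finite_sum_le_inner[OF sq F, of k] by (simp add: norm_square)
    qed
  qed simp
  show "sqs h" using * by (rule sq_summable_finite_bound)
  have "(nrm h)\<^sup>2 \<le> C\<^sup>2"
    unfolding norm_square using * by (rule sq_summable_finite_bound)
  then show "nrm h \<le> C" using C by (rule power2_le_imp_le)
qed

lemma inner_finite_support:
  assumes "finite K" "K \<subseteq> A" "\<And>x. x \<in> A - K \<Longrightarrow> f x = 0"
  shows "ip f g = (\<Sum>x\<in>K. w x * f x * g x)"
  unfolding l2_inner_def using assms
  by (subst infsum_cong_neutral[where T = K and g = "\<lambda>x. w x * f x * g x"]) auto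

lemma inner_finite_support_right:
  assumes "finite K" "K \<subseteq> A" "\<And>x. x \<in> A - K \<Longrightarrow> g x = 0"
  shows "ip f g = (\<Sum>x\<in>K. w x * f x * g x)"
  unfolding l2_inner_def using assms
  by (subst infsum_cong_neutral[where T = K and g = "\<lambda>x. w x * f x * g x"]) auto

text \<open>
  The norm of an average of a path is at most the largest norm along the path. The average is
  taken pointwise, and the bound comes out of finite partial sums: with \<open>2 * a * b \<le> a\<^sup>2 + b\<^sup>2\<close>, a finite
  partial sum \<open>S\<close> of the square norm of the average satisfies \<open>2 * S \<le> S + C\<^sup>2\<close>.
\<close>

lemma path_average_bound:
  assumes t: "0 < t"
    and cont: "\<And>x. x \<in> A \<Longrightarrow> continuous_on {0..t} (\<lambda>s. g s x)"
    and bound: "\<And>s. s \<in> {0..t} \<Longrightarrow> sqs (g s) \<and> nrm (g s) \<le> C"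
  defines "G \<equiv> \<lambda>x. integral {0..t} (\<lambda>s. g s x) / t"
  shows "sqs G" "nrm G \<le> C"
proof -
  have C: "0 \<le> C" using bound[of 0] t norm_nonneg[of "g 0"] by auto
  have *: "(\<Sum>x\<in>F. w x * (G x)\<^sup>2) \<le> C\<^sup>2" if F: "finite F" "F \<subseteq> A" for F
  proof -
    define S where "S = (\<Sum>x\<in>F. w x * (G x)\<^sup>2)"
    \<comment> \<open>Integrating \<open>2 * G x * g s x \<le> (G x)\<^sup>2 + (g s x)\<^sup>2\<close> over \<open>s\<close> in \<open>[0, t]\<close>.\<close>
    have "((\<lambda>s. \<Sum>x\<in>F. (2 * w x * G x) * g s x) has_integral (\<Sum>x\<in>F. (2 * w x * G x) * (t * G x))) {0..t}"
    proof (rule has_integral_sum[OF F(1)], rule has_integral_mult_right)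
      fix x assume "x \<in> F"
      then have "(\<lambda>s. g s x) integrable_on {0..t}"
        using F cont by (intro integrable_continuous_interval) auto
      then show "((\<lambda>s. g s x) has_integral t * G x) {0..t}"
        using t by (simp add: G_def has_integral_integral)
    qed
    moreover have "((\<lambda>s. S + C\<^sup>2) has_integral t * (S + C\<^sup>2)) {0..t}"
      using has_integral_const_real[of "S + C\<^sup>2" 0 t] t by simp
    moreover have "(\<Sum>x\<in>F. (2 * w x * G x) * g s x) \<le> S + C\<^sup>2" if s: "s \<in> {0..t}" for s
    proof -
      have "(\<Sum>x\<in>F. (2 * w x * G x) * g s x) \<le> (\<Sum>x\<in>F. w x * (G x)\<^sup>2 + w x * (g s x)\<^sup>2)"
      proof (rule sum_mono)
        fix x assume "x \<in> F"
        then have "0 \<le> w x * (G x - g s x)\<^sup>2" using F weight_nonneg by auto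
        then show "(2 * w x * G x) * g s x \<le> w x * (G x)\<^sup>2 + w x * (g s x)\<^sup>2"
          by (simp add: power2_eq_square algebra_simps)
      qed
      also have "\<dots> = S + (\<Sum>x\<in>F. w x * (g s x)\<^sup>2)" by (simp add: S_def sum.distrib)
      also have "(\<Sum>x\<in>F. w x * (g s x)\<^sup>2) \<le> (nrm (g s))\<^sup>2"
        using finite_sum_le_inner[OF _ F, of "g s"] bound[OF s] by (simp add: norm_square)
      also have "\<dots> \<le> C\<^sup>2" using bound[OF s] norm_nonneg by (intro power_mono) auto
      finally show ?thesis by simp
    qed
    ultimately have "(\<Sum>x\<in>F. (2 * w x * G x) * (t * G x)) \<le> t * (S + C\<^sup>2)"
      by (rule has_integral_le)
    also have "(\<Sum>x\<in>F. (2 * w x * G x) * (t * G x)) = t * (2 * S)"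
      unfolding S_def sum_distrib_left by (intro sum.cong) (auto simp: power2_eq_square)
    finally show ?thesis using t by (simp add: S_def)
  qed
  show "sqs G" using * by (rule sq_summable_finite_bound)
  have "(nrm G)\<^sup>2 \<le> C\<^sup>2" unfolding norm_square using * by (rule sq_summable_finite_bound)
  then show "nrm G \<le> C" using C by (rule power2_le_imp_le)
qed

lemma norm_cong: "(\<And>x. x \<in> A \<Longrightarrow> f x = g x) \<Longrightarrow> nrm f = nrm g"
  unfolding l2_norm_def l2_inner_def by (simp cong: infsum_cong)

lemma l2_mem_iff: "f \<in> l2 A w \<longleftrightarrow> (\<forall>x. x \<notin> A \<longrightarrow> f x = 0) \<and> sqs f"
  by (auto simp: l2_def sq_summable_def)

lemma l2_lincomb: "f \<in> l2 A w \<Longrightarrow> g \<in> l2 A w \<Longrightarrow> (\<lambda>x. \<alpha> * f x + \<beta> * g x) \<in> l2 A w"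
  by (simp add: l2_mem_iff sq_summable_lincomb)

lemma l2_diff: "f \<in> l2 A w \<Longrightarrow> g \<in> l2 A w \<Longrightarrow> (\<lambda>x. f x - g x) \<in> l2 A w"
  by (simp add: l2_mem_iff sq_summable_diff)

text \<open>
  Stated with an explicit rate, as it is needed for the gliding hump below.
\<close>

lemma l2_complete:
  assumes pos: "\<And>x. x \<in> A \<Longrightarrow> 0 < w x"
    and u: "\<And>k. u k \<in> l2 A w"
    and cauchy: "\<And>j k. k \<le> j \<Longrightarrow> nrm (\<lambda>x. u j x - u k x) \<le> \<epsilon> k"
    and \<epsilon>: "\<epsilon> \<longlonglongrightarrow> 0"
  obtains v where "v \<in> l2 A w" "\<And>k. nrm (\<lambda>x. v x - u k x) \<le> \<epsilon> k"
proof -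
  have us: "sqs (u k)" for k using u by (simp add: l2_mem_iff)
  note d = sq_summable_diff[OF us us]
  have conv: "convergent (\<lambda>k. u k x)" if x: "x \<in> A" for x
  proof -
    have "Cauchy (\<lambda>k. u k x)"
    proof (rule metric_CauchyI)
      fix e :: real assume e: "0 < e"
      have sw: "0 < sqrt (w x)" using pos[OF x] by simp
      have "\<forall>\<^sub>F k in sequentially. \<epsilon> k < e / 2 * sqrt (w x)"
        using \<epsilon> e sw by (intro order_tendstoD(2)) auto
      then obtain k where k: "\<epsilon> k < e / 2 * sqrt (w x)" by (auto simp: eventually_sequentially)
      have near: "\<bar>u j x - u k x\<bar> < e / 2" if "k \<le> j" for j
      proof -
        have "\<bar>u j x - u k x\<bar> \<le> nrm (\<lambda>x. u j x - u k x) / sqrt (w x)"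
          by (rule pointwise_le_norm[OF d x pos[OF x]])
        also have "\<dots> \<le> \<epsilon> k / sqrt (w x)" using cauchy[OF that] sw by (intro divide_right_mono) auto
        also have "\<dots> < e / 2" using k sw by (simp add: pos_divide_less_eq)
        finally show ?thesis .
      qed
      have "dist (u i x) (u j x) < e" if "k \<le> i" "k \<le> j" for i j
        using near[OF that(1)] near[OF that(2)] unfolding dist_real_def by linarith
      then show "\<exists>M. \<forall>i\<ge>M. \<forall>j\<ge>M. dist (u i x) (u j x) < e" by blast
    qed
    then show ?thesis by (simp add: Cauchy_convergent_iff)
  qed
  define v where "v x = (if x \<in> A then lim (\<lambda>k. u k x) else 0)" for x
  have v: "(\<lambda>k. u k x) \<longlonglongrightarrow> v x" if "x \<in> A" for x
    using conv[OF that] that by (simp add: v_def convergent_LIMSEQ_iff)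
  have *: "sqs (\<lambda>x. v x - u k x) \<and> nrm (\<lambda>x. v x - u k x) \<le> \<epsilon> k" for k
  proof -
    have l: "(\<lambda>j. u j x - u k x) \<longlonglongrightarrow> v x - u k x" if "x \<in> A" for x
      by (intro tendsto_intros v that)
    have "\<forall>\<^sub>F j in sequentially. nrm (\<lambda>x. u j x - u k x) \<le> \<epsilon> k"
      by (rule eventually_sequentiallyI[of k]) (rule cauchy)
    from Fatou[OF d l this] show ?thesis by blast
  qed
  have "sqs v" using sq_summable_add[OF conjunct1[OF *[of 0]] us[of 0]] by simp
  then have "v \<in> l2 A w" by (simp add: l2_mem_iff v_def)
  then show ?thesis using that * by blast
qed

lemma inner_finite_approx:
  assumes "sqs f" "0 < e"
  obtains F where "finite F" "F \<subseteq> A" "ip f f - e < (\<Sum>x\<in>F. w x * (f x)\<^sup>2)"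
proof -
  have "((\<lambda>F. \<Sum>x\<in>F. w x * (f x)\<^sup>2) \<longlongrightarrow> ip f f) (finite_subsets_at_top A)"
    unfolding inner_self using assms(1) by (intro infsum_tendsto) (simp add: sq_summable_def)
  then have "\<forall>\<^sub>F F in finite_subsets_at_top A. ip f f - e < (\<Sum>x\<in>F. w x * (f x)\<^sup>2)"
    using assms(2) by (intro order_tendstoD(1)) auto
  then show ?thesis using that unfolding eventually_finite_subsets_at_top by blast
qed

text \<open>
  Differentiation of the square norm along a path that is differentiable in norm:
  \<open>v r = v s + (r - s) * q\<close> with difference quotients \<open>q\<close> converging to \<open>u\<close>.
\<close>

lemma norm_square_derivative:
  assumes v: "\<And>r. r \<in> S \<Longrightarrow> sqs (v r)" and s: "s \<in> S" and u: "sqs u"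
    and lim: "((\<lambda>r. nrm (\<lambda>x. (v r x - v s x) / (r - s) - u x)) \<longlongrightarrow> 0) (at s within S)"
  shows "((\<lambda>r. ip (v r) (v r)) has_real_derivative 2 * ip u (v s)) (at s within S)"
  unfolding has_field_derivative_iff
proof (rule Lim_null[THEN iffD2], rule Lim_null_comparison)
  let ?e = "\<lambda>r. nrm (\<lambda>x. (v r x - v s x) / (r - s) - u x)"
  have "((\<lambda>r. 2 * ?e r * nrm (v s) + \<bar>r - s\<bar> * (?e r + nrm u)\<^sup>2)
      \<longlongrightarrow> 2 * 0 * nrm (v s) + \<bar>s - s\<bar> * (0 + nrm u)\<^sup>2) (at s within S)"
    by (intro tendsto_intros lim)
  then show "((\<lambda>r. 2 * ?e r * nrm (v s) + \<bar>r - s\<bar> * (?e r + nrm u)\<^sup>2) \<longlongrightarrow> 0) (at s within S)"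
    by simp
  show "\<forall>\<^sub>F r in at s within S. norm ((ip (v r) (v r) - ip (v s) (v s)) / (r - s) - 2 * ip u (v s))
     \<le> 2 * ?e r * nrm (v s) + \<bar>r - s\<bar> * (?e r + nrm u)\<^sup>2"
    unfolding eventually_at_filter
  proof (rule always_eventually, intro allI impI)
    fix r assume r: "r \<noteq> s" "r \<in> S"
    define q where "q x = (1 / (r - s)) * v r x + (- 1 / (r - s)) * v s x" for x
    have q: "sqs q" unfolding q_def by (intro sq_summable_lincomb v r s)
    have qe: "q = (\<lambda>x. (v r x - v s x) / (r - s))" by (simp add: q_def fun_eq_iff diff_divide_distrib)
    have du: "sqs (\<lambda>x. q x - u x)" by (rule sq_summable_diff[OF q u])
    have vr: "v r = (\<lambda>x. 1 * v s x + (r - s) * q x)" using r by (simp add: qe fun_eq_iff)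
    have "ip (v r) (v r) = ip (v s) (v s) + 2 * (r - s) * ip (v s) q + (r - s)\<^sup>2 * ip q q"
      unfolding vr using inner_square_lincomb[OF v[OF s] q, of 1 "r - s"] by simp
    then have "(ip (v r) (v r) - ip (v s) (v s)) / (r - s) - 2 * ip u (v s)
        = 2 * (ip q (v s) - ip u (v s)) + (r - s) * ip q q"
      using r by (simp add: inner_commute[of "v s" q] power2_eq_square field_simps)
    also have "ip q (v s) - ip u (v s) = ip (\<lambda>x. q x - u x) (v s)"
      by (rule inner_diff_left[OF q u v[OF s], symmetric])
    finally have eq: "(ip (v r) (v r) - ip (v s) (v s)) / (r - s) - 2 * ip u (v s)
        = 2 * ip (\<lambda>x. q x - u x) (v s) + (r - s) * (nrm q)\<^sup>2" by (simp add: norm_square)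
    have 1: "\<bar>ip (\<lambda>x. q x - u x) (v s)\<bar> \<le> nrm (\<lambda>x. q x - u x) * nrm (v s)"
      by (rule Cauchy_Schwarz[OF du v[OF s]])
    have "nrm q \<le> nrm (\<lambda>x. q x - u x) + nrm u"
      using norm_triangle[OF du u] by simp
    then have "(nrm q)\<^sup>2 \<le> (nrm (\<lambda>x. q x - u x) + nrm u)\<^sup>2"
      by (rule power_mono) (rule norm_nonneg)
    then have 2: "\<bar>(r - s) * (nrm q)\<^sup>2\<bar> \<le> \<bar>r - s\<bar> * (nrm (\<lambda>x. q x - u x) + nrm u)\<^sup>2"
      by (simp add: abs_mult mult_left_mono)
    have "norm (2 * ip (\<lambda>x. q x - u x) (v s) + (r - s) * (nrm q)\<^sup>2)
       \<le> 2 * \<bar>ip (\<lambda>x. q x - u x) (v s)\<bar> + \<bar>(r - s) * (nrm q)\<^sup>2\<bar>"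
      unfolding real_norm_def by (rule order_trans[OF abs_triangle_ineq]) (simp add: abs_mult)
    also have "\<dots> \<le> 2 * nrm (\<lambda>x. q x - u x) * nrm (v s) + \<bar>r - s\<bar> * (nrm (\<lambda>x. q x - u x) + nrm u)\<^sup>2"
      using 1 2 by simp
    finally show "norm ((ip (v r) (v r) - ip (v s) (v s)) / (r - s) - 2 * ip u (v s))
     \<le> 2 * ?e r * nrm (v s) + \<bar>r - s\<bar> * (?e r + nrm u)\<^sup>2"
      unfolding eq by (simp add: qe)
  qed
qed

section \<open>Strongly continuous semigroups\<close>

context
  fixes T assumes T: "C0_semigroup A w T"
begin

lemma C0_l2: "0 \<le> t \<Longrightarrow> f \<in> l2 A w \<Longrightarrow> T t f \<in> l2 A w"
  using T by (simp add: C0_semigroup_def)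

lemma C0_sq: "0 \<le> t \<Longrightarrow> f \<in> l2 A w \<Longrightarrow> sqs (T t f)"
  using C0_l2 by (simp add: l2_mem_iff)

lemma C0_lincomb: "0 \<le> t \<Longrightarrow> f \<in> l2 A w \<Longrightarrow> g \<in> l2 A w \<Longrightarrow>
    T t (\<lambda>x. \<alpha> * f x + \<beta> * g x) = (\<lambda>x. \<alpha> * T t f x + \<beta> * T t g x)"
  using T by (simp add: C0_semigroup_def)

lemma C0_diff: "0 \<le> t \<Longrightarrow> f \<in> l2 A w \<Longrightarrow> g \<in> l2 A w \<Longrightarrow> T t (\<lambda>x. f x - g x) = (\<lambda>x. T t f x - T t g x)"
  using C0_lincomb[of t f g 1 "-1"] by simp

lemma C0_scale: "0 \<le> t \<Longrightarrow> f \<in> l2 A w \<Longrightarrow> T t (\<lambda>x. \<alpha> * f x) = (\<lambda>x. \<alpha> * T t f x)"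
  using C0_lincomb[of t f f \<alpha> 0] by simp

lemma C0_0: "f \<in> l2 A w \<Longrightarrow> T 0 f = f"
  using T by (simp add: C0_semigroup_def)

lemma C0_add: "0 \<le> s \<Longrightarrow> 0 \<le> t \<Longrightarrow> f \<in> l2 A w \<Longrightarrow> T (s + t) f = T s (T t f)"
  using T by (simp add: C0_semigroup_def)

lemma C0_continuous: "f \<in> l2 A w \<Longrightarrow> ((\<lambda>t. nrm (\<lambda>x. T t f x - f x)) \<longlongrightarrow> 0) (at_right 0)"
  using T by (simp add: C0_semigroup_def)

lemma C0_bounded:
  assumes "0 \<le> t"
  obtains C where "0 \<le> C" "\<And>f. f \<in> l2 A w \<Longrightarrow> nrm (T t f) \<le> C * nrm f"
proof -
  have "\<forall>t\<ge>0. \<exists>C. \<forall>f\<in>l2 A w. nrm (T t f) \<le> C * nrm f"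
    using T unfolding C0_semigroup_def by (elim conjE)
  with assms obtain C where C: "\<forall>f\<in>l2 A w. nrm (T t f) \<le> C * nrm f" by blast
  have "nrm (T t f) \<le> max C 0 * nrm f" if "f \<in> l2 A w" for f
    using C that mult_right_mono[OF max.cobounded1[of C 0] norm_nonneg[of f]] by fastforce
  then show ?thesis using that[of "max C 0"] by simp
qed

text \<open>
  The operator norm, realized as a supremum over the unit ball. The gliding hump below needs both
  of its properties: the bound, and almost extremal vectors.
\<close>

lemma C0_operator_norm:
  assumes t: "0 \<le> t"
  obtains N where "\<And>f. f \<in> l2 A w \<Longrightarrow> nrm (T t f) \<le> N * nrm f"
    "\<And>c. c < N \<Longrightarrow> \<exists>f\<in>l2 A w. nrm f \<le> 1 \<and> c < nrm (T t f)"
proof -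
  define S where "S = {nrm (T t f) | f. f \<in> l2 A w \<and> nrm f \<le> 1}"
  obtain C where C: "0 \<le> C" "\<And>f. f \<in> l2 A w \<Longrightarrow> nrm (T t f) \<le> C * nrm f"
    using C0_bounded[OF t] by blast
  have z: "(\<lambda>x. 0) \<in> l2 A w" "nrm (\<lambda>x. 0) = 0"
    by (simp_all add: l2_mem_iff sq_summable_def l2_norm_def l2_inner_def)
  then have ne: "S \<noteq> {}" by (auto simp: S_def intro!: exI[of _ "\<lambda>x. 0"])
  have bdd: "bdd_above S"
  proof (rule bdd_aboveI)
    fix s assume "s \<in> S"
    then obtain f where f: "f \<in> l2 A w" "nrm f \<le> 1" "s = nrm (T t f)" by (auto simp: S_def)
    have "C * nrm f \<le> C * 1" using f C by (intro mult_left_mono) auto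
    then show "s \<le> C" using C(2)[OF f(1)] f(3) by simp
  qed
  show ?thesis
  proof (rule that[of "Sup S"])
    fix f assume f: "f \<in> l2 A w"
    show "nrm (T t f) \<le> Sup S * nrm f"
    proof (cases "nrm f = 0")
      case True
      then show ?thesis using C(2)[OF f] by simp
    next
      case False
      then have p: "0 < nrm f" using norm_nonneg[of f] by simp
      let ?a = "1 / nrm f"
      have "(\<lambda>x. ?a * f x) \<in> l2 A w" using l2_lincomb[OF f f, of ?a 0] by simp
      moreover have "nrm (\<lambda>x. ?a * f x) = 1" unfolding norm_scale using p by simp
      ultimately have "nrm (T t (\<lambda>x. ?a * f x)) \<in> S" by (auto simp: S_def)
      then have "nrm (T t (\<lambda>x. ?a * f x)) \<le> Sup S" by (rule cSup_upper[OF _ bdd])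
      then have "?a * nrm (T t f) \<le> Sup S" unfolding C0_scale[OF t f] norm_scale using p by simp
      then show ?thesis using p by (simp add: field_simps)
    qed
  next
    fix c assume "c < Sup S"
    then show "\<exists>f\<in>l2 A w. nrm f \<le> 1 \<and> c < nrm (T t f)"
      unfolding less_cSup_iff[OF ne bdd] by (auto simp: S_def)
  qed
qed

text \<open>
  Uniform boundedness near zero is not part of the definition of a strongly continuous semigroup.
  It is the uniform boundedness principle, proved here by a gliding hump: if the operator norms
  along times \<open>t k\<close> tending to zero grow faster than \<open>3 ^ k\<close>, then a vector is built as a limit of
  steps of length \<open>1 / 3 ^ k\<close>, each of which keeps \<open>T (t k)\<close> large. As every orbit is continuous at
  zero, such a vector does not exist.
\<close>

lemma C0_bounded_near_0:
  assumes pos: "\<And>x. x \<in> A \<Longrightarrow> 0 < w x"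
  obtains \<delta> M where "0 < \<delta>" "\<And>t f. 0 \<le> t \<Longrightarrow> t \<le> \<delta> \<Longrightarrow> f \<in> l2 A w \<Longrightarrow> nrm (T t f) \<le> M * nrm f"
proof (rule ccontr)
  note that_thesis = that
  assume no: "\<not> thesis"
  have neg: "\<exists>t f. 0 \<le> t \<and> t \<le> \<delta> \<and> f \<in> l2 A w \<and> M * nrm f < nrm (T t f)"
    if "0 < \<delta>" for \<delta> M
  proof (rule ccontr)
    assume "\<not> ?thesis"
    then have "nrm (T t f) \<le> M * nrm f" if "0 \<le> t" "t \<le> \<delta>" "f \<in> l2 A w" for t f
      using that by (meson not_le)
    then show False using no that_thesis[OF \<open>0 < \<delta>\<close>, of M] by blast
  qed
  \<comment> \<open>Multiplied by the step length \<open>r (Suc k)\<close> below, this still tends to infinity.\<close>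
  define M where "M k = real (Suc k) * 3 ^ Suc k" for k
  have "\<forall>k. \<exists>t. 0 < t \<and> t \<le> 1 / real (Suc k) \<and> (\<exists>f\<in>l2 A w. M k * nrm f < nrm (T t f))"
  proof
    fix k
    obtain t f where t: "0 \<le> t" "t \<le> 1 / real (Suc k)" and f: "f \<in> l2 A w" "M k * nrm f < nrm (T t f)"
      using neg[of "1 / real (Suc k)" "M k"] by auto
    have "1 * 1 \<le> real (Suc k) * 3 ^ Suc k" by (intro mult_mono) (auto simp del: power_Suc)
    then have "1 * nrm f \<le> M k * nrm f" unfolding M_def by (intro mult_right_mono norm_nonneg) simp
    then have "t \<noteq> 0" using f by (auto simp: C0_0)
    then show "\<exists>t. 0 < t \<and> t \<le> 1 / real (Suc k) \<and> (\<exists>f\<in>l2 A w. M k * nrm f < nrm (T t f))"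
      using t f by (intro exI[of _ t]) auto
  qed
  then obtain t where t: "\<And>k. 0 < t k" "\<And>k. t k \<le> 1 / real (Suc k)"
    and tf: "\<And>k. \<exists>f\<in>l2 A w. M k * nrm f < nrm (T (t k) f)" by metis
  have t0: "0 \<le> t k" for k using t(1)[of k] by simp
  have "\<forall>k. \<exists>N. (\<forall>f\<in>l2 A w. nrm (T (t k) f) \<le> N * nrm f) \<and>
     (\<forall>c<N. \<exists>f\<in>l2 A w. nrm f \<le> 1 \<and> c < nrm (T (t k) f))"
    by (metis C0_operator_norm[OF t0])
  then obtain N where N1: "\<And>k f. f \<in> l2 A w \<Longrightarrow> nrm (T (t k) f) \<le> N k * nrm f"
    and N2: "\<And>k c. c < N k \<Longrightarrow> \<exists>f\<in>l2 A w. nrm f \<le> 1 \<and> c < nrm (T (t k) f)" by metis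
  have NM: "M k < N k" for k
  proof (rule ccontr)
    assume "\<not> M k < N k"
    moreover obtain f where f: "f \<in> l2 A w" "M k * nrm f < nrm (T (t k) f)" using tf by blast
    ultimately have "N k * nrm f \<le> M k * nrm f" by (intro mult_right_mono norm_nonneg) simp
    then show False using N1[OF f(1), of k] f(2) by simp
  qed
  have M0: "0 < M k" for k by (simp add: M_def)
  define r where "r k = (1 / 3 :: real) ^ k" for k
  have rS: "r (Suc k) = r k / 3" and r0: "0 < r k" for k by (simp_all add: r_def)
  \<comment> \<open>One of the two points at distance \<open>r (Suc k)\<close> in opposite directions has a large image,
    since the difference of the two images is large.\<close>
  have step: "\<exists>v. v \<in> l2 A w \<and> nrm (\<lambda>x. v x - u x) \<le> r (Suc k) \<and>
      3 / 4 * r (Suc k) * N k \<le> nrm (T (t k) v)" if u: "u \<in> l2 A w" for u k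
  proof -
    have Npos: "0 < N k" using NM[of k] M0[of k] by linarith
    obtain y where y: "y \<in> l2 A w" "nrm y \<le> 1" "3 / 4 * N k < nrm (T (t k) y)"
      using N2[of "3 / 4 * N k" k] Npos by auto
    let ?a = "r (Suc k)"
    define p where "p x = 1 * u x + ?a * y x" for x
    define q where "q x = 1 * u x + (- ?a) * y x" for x
    have pq: "p \<in> l2 A w" "q \<in> l2 A w" unfolding p_def q_def by (rule l2_lincomb[OF u y(1)])+
    have n: "nrm (\<lambda>x. p x - u x) \<le> ?a" "nrm (\<lambda>x. q x - u x) \<le> ?a"
      using norm_scale[of ?a y] norm_scale[of "- ?a" y] r0[of "Suc k"] y(2)
        mult_left_mono[OF y(2), of ?a] by (simp_all add: p_def q_def)
    have "T (t k) (\<lambda>x. p x - q x) = T (t k) (\<lambda>x. (2 * ?a) * y x)" by (simp add: p_def q_def mult_ac)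
    also have "\<dots> = (\<lambda>x. (2 * ?a) * T (t k) y x)" by (rule C0_scale[OF t0 y(1)])
    finally have "2 * ?a * nrm (T (t k) y) = nrm (\<lambda>x. T (t k) p x - T (t k) q x)"
      using norm_scale[of "2 * ?a" "T (t k) y"] r0[of "Suc k"] C0_diff[OF t0 pq] by simp
    also have "\<dots> \<le> nrm (T (t k) p) + nrm (T (t k) q)"
      by (intro norm_triangle_diff C0_sq t0 pq)
    finally have "2 * (?a * nrm (T (t k) y)) \<le> nrm (T (t k) p) + nrm (T (t k) q)" by simp
    moreover have "3 / 4 * ?a * N k \<le> ?a * nrm (T (t k) y)"
      using mult_left_mono[OF less_imp_le[OF y(3)], of ?a] r0[of "Suc k"] by (simp add: mult_ac)
    ultimately have "3 / 4 * ?a * N k \<le> nrm (T (t k) p) \<or> 3 / 4 * ?a * N k \<le> nrm (T (t k) q)"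
      by linarith
    then show ?thesis using pq n by blast
  qed
  have z: "(\<lambda>x. 0) \<in> l2 A w" by (simp add: l2_mem_iff sq_summable_def)
  have "\<exists>u. \<forall>k. u k \<in> l2 A w \<and> (nrm (\<lambda>x. u (Suc k) x - u k x) \<le> r (Suc k) \<and>
      3 / 4 * r (Suc k) * N k \<le> nrm (T (t k) (u (Suc k))))"
  proof (rule dependent_nat_choice)
    show "\<exists>u. u \<in> l2 A w" using z by blast
  qed (rule step)
  then obtain u where u0: "\<And>k. u k \<in> l2 A w"
    and u1: "\<And>k. nrm (\<lambda>x. u (Suc k) x - u k x) \<le> r (Suc k) \<and>
      3 / 4 * r (Suc k) * N k \<le> nrm (T (t k) (u (Suc k)))"
    by blast
  have us: "sqs (u k)" for k using u0 by (simp add: l2_mem_iff)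
  have cauchy: "nrm (\<lambda>x. u j x - u k x) \<le> r k / 2" if "k \<le> j" for j k
  proof -
    have "nrm (\<lambda>x. u j x - u k x) \<le> (r k - r j) / 2"
      using that
    proof (induction j rule: dec_induct)
      case base
      then show ?case by (simp add: l2_norm_def l2_inner_def)
    next
      case (step j)
      then show ?case
        using norm_triangle_via[OF us[of "Suc j"] us[of j] us[of k]] conjunct1[OF u1[of j]] rS[of j] by simp
    qed
    then show ?thesis using r0[of j] by simp
  qed
  have "r \<longlonglongrightarrow> 0" unfolding r_def by (intro LIMSEQ_power_zero) simp
  then have lim: "(\<lambda>k. r k / 2) \<longlonglongrightarrow> 0" by (rule tendsto_divide_zero)
  obtain v where v: "v \<in> l2 A w" "\<And>k. nrm (\<lambda>x. v x - u k x) \<le> r k / 2"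
    using l2_complete[where u = u and \<epsilon> = "\<lambda>k. r k / 2", OF pos u0 cauchy lim] by blast
  have big: "real (Suc k) / 4 \<le> nrm (T (t k) v)" for k
  proof -
    let ?s = "u (Suc k)"
    have Npos: "0 < N k" using NM[of k] M0[of k] by linarith
    have "nrm (T (t k) (\<lambda>x. ?s x - v x)) \<le> N k * nrm (\<lambda>x. ?s x - v x)"
      by (rule N1[OF l2_diff[OF u0 v(1)]])
    also have "\<dots> \<le> N k * (r (Suc k) / 2)"
      using v(2)[of "Suc k"] Npos by (intro mult_left_mono) (auto simp: norm_minus_commute[of ?s])
    finally have 1: "nrm (\<lambda>x. T (t k) ?s x - T (t k) v x) \<le> N k * r (Suc k) / 2"
      using C0_diff[OF t0 u0 v(1)] by simp
    have 2: "3 / 4 * r (Suc k) * N k \<le> nrm (T (t k) ?s)" using u1 by blast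
    have "nrm (T (t k) ?s) - nrm (T (t k) v) \<le> N k * r (Suc k) / 2"
      using norm_reverse_triangle[OF C0_sq[OF t0 u0] C0_sq[OF t0 v(1)], of k "Suc k" k] 1 by linarith
    with 2 have 3: "N k * r (Suc k) / 4 \<le> nrm (T (t k) v)" by (simp add: mult_ac)
    have "real (Suc k) = M k * r (Suc k)"
      by (simp add: M_def r_def power_one_over field_simps)
    also have "\<dots> \<le> N k * r (Suc k)"
      using NM[of k] r0[of "Suc k"] by (intro mult_right_mono) auto
    finally have "real (Suc k) / 4 \<le> N k * r (Suc k) / 4" by (rule divide_right_mono) simp
    then show ?thesis using 3 by (rule order_trans)
  qed
  have "t \<longlonglongrightarrow> 0"
    by (rule tendsto_sandwich[OF _ _ tendsto_const LIMSEQ_inverse_real_of_nat])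
       (use t0 t(2) in \<open>auto simp: inverse_eq_divide\<close>)
  then have "filterlim t (at_right 0) sequentially"
    using t(1) less_imp_neq[OF t(1), THEN not_sym]
    by (auto simp: filterlim_at intro!: always_eventually)
  from filterlim_compose[OF C0_continuous[OF v(1)] this]
  have "(\<lambda>k. nrm (\<lambda>x. T (t k) v x - v x)) \<longlonglongrightarrow> 0" .
  then have "\<forall>\<^sub>F k in sequentially. nrm (\<lambda>x. T (t k) v x - v x) < 1" by (rule order_tendstoD) simp
  moreover have "\<forall>\<^sub>F k in sequentially. 4 * (nrm v + 1) \<le> real k"
    using filterlim_real_sequentially by (simp add: filterlim_at_top)
  ultimately have "\<forall>\<^sub>F k in sequentially. False"
  proof eventually_elim
    case (elim k)
    have "sqs v" using v(1) by (simp add: l2_mem_iff)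
    from norm_reverse_triangle[OF C0_sq[OF t0 v(1)] this, of k]
    show ?case using elim big[of k] by simp
  qed
  then show False by simp
qed

lemma C0_locally_bounded:
  assumes pos: "\<And>x. x \<in> A \<Longrightarrow> 0 < w x"
  obtains M where "0 \<le> M" "\<And>s f. 0 \<le> s \<Longrightarrow> s \<le> t \<Longrightarrow> f \<in> l2 A w \<Longrightarrow> nrm (T s f) \<le> M * nrm f"
proof -
  obtain \<delta> M where \<delta>: "0 < \<delta>"
    and M: "\<And>t f. 0 \<le> t \<Longrightarrow> t \<le> \<delta> \<Longrightarrow> f \<in> l2 A w \<Longrightarrow> nrm (T t f) \<le> M * nrm f"
    using C0_bounded_near_0[OF pos] by blast
  define C where "C = max M 0"
  have C: "nrm (T t f) \<le> C * nrm f" if "0 \<le> t" "t \<le> \<delta>" "f \<in> l2 A w" for t f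
    using M[OF that] mult_right_mono[OF max.cobounded1[of M 0] norm_nonneg[of f]] by (simp add: C_def)
  obtain k where k: "t / \<delta> < real k" using reals_Archimedean2 by blast
  have "nrm (T s f) \<le> C ^ Suc k * nrm f" if s: "0 \<le> s" "s \<le> t" and f: "f \<in> l2 A w" for s f
  proof -
    define q where "q = s / real (Suc k)"
    have "s \<le> \<delta> * real (Suc k)" using k s \<delta> by (simp add: field_simps)
    then have q: "0 \<le> q" "q \<le> \<delta>" using s by (auto simp: q_def field_simps)
    have "nrm (T (real i * q) f) \<le> C ^ i * nrm f" for i
    proof (induction i)
      case 0
      then show ?case using f by (simp add: C0_0)
    next
      case (Suc i)
      have "T (real (Suc i) * q) f = T q (T (real i * q) f)"
        using C0_add[of q "real i * q" f] q f by (simp add: algebra_simps)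
      moreover have "nrm (T q (T (real i * q) f)) \<le> C * nrm (T (real i * q) f)"
        using q f by (intro C C0_l2) auto
      moreover have "C * nrm (T (real i * q) f) \<le> C * (C ^ i * nrm f)"
        using Suc by (intro mult_left_mono) (auto simp: C_def)
      ultimately show ?case by simp
    qed
    from this[of "Suc k"] show ?thesis by (simp add: q_def)
  qed
  then show ?thesis using that[of "C ^ Suc k"] by (simp add: C_def)
qed

text \<open>
  The semigroup commutes with its difference quotients, and each \<open>T s\<close> is continuous.
\<close>

lemma generator_invariant:
  assumes hg: "(h, g) \<in> generator A w T" and s: "0 \<le> s"
  shows "(T s h, T s g) \<in> generator A w T"
proof -
  have h: "h \<in> l2 A w" and g: "g \<in> l2 A w"
    and lim: "((\<lambda>t. nrm (\<lambda>x. (T t h x - h x) / t - g x)) \<longlongrightarrow> 0) (at_right 0)"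
    using hg by (auto simp: generator_def)
  obtain C where C: "0 \<le> C" "\<And>f. f \<in> l2 A w \<Longrightarrow> nrm (T s f) \<le> C * nrm f"
    using C0_bounded[OF s] by blast
  have "((\<lambda>t. nrm (\<lambda>x. (T t (T s h) x - T s h x) / t - T s g x)) \<longlongrightarrow> 0) (at_right 0)"
  proof (rule tendsto_sandwich[OF _ _ tendsto_const])
    show "((\<lambda>t. C * nrm (\<lambda>x. (T t h x - h x) / t - g x)) \<longlongrightarrow> 0) (at_right 0)"
      by (rule tendsto_mult_right_zero[OF lim])
    have "\<forall>\<^sub>F t in at_right (0::real). 0 < t" by (simp add: eventually_at_right_less)
    then show "\<forall>\<^sub>F t in at_right 0. nrm (\<lambda>x. (T t (T s h) x - T s h x) / t - T s g x)
        \<le> C * nrm (\<lambda>x. (T t h x - h x) / t - g x)"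
    proof eventually_elim
      case (elim t)
      then have t: "0 \<le> t" by simp
      define d where "d x = (1 / t) * (T t h x - h x) + (-1) * g x" for x
      have dl: "(\<lambda>x. T t h x - h x) \<in> l2 A w" by (intro l2_diff C0_l2 t h)
      have "d \<in> l2 A w" unfolding d_def by (rule l2_lincomb[OF dl g])
      then have "nrm (T s d) \<le> C * nrm d" by (rule C(2))
      moreover have "T s d = (\<lambda>x. (1 / t) * (T s (T t h) x - T s h x) + (-1) * T s g x)"
        unfolding d_def using C0_lincomb[OF s dl g, of "1 / t" "-1"] C0_diff[OF s C0_l2[OF t h] h] by simp
      moreover have "T s (T t h) = T t (T s h)"
        using C0_add[OF s t h] C0_add[OF t s h] by (simp add: add.commute)
      ultimately show ?case by (simp add: d_def[abs_def])
    qed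
  qed (simp add: norm_nonneg)
  then show ?thesis using C0_l2[OF s h] C0_l2[OF s g] by (simp add: generator_def)
qed

text \<open>
  Strong continuity gives derivatives from the right only. From the left, the difference quotient
  at \<open>s\<close> is \<open>T r\<close> applied to an initial difference quotient with \<open>r < s\<close> varying, so that the
  local bound on the operator norms is needed.
\<close>

lemma orbit_differentiable:
  assumes pos: "\<And>x. x \<in> A \<Longrightarrow> 0 < w x"
    and hg: "(h, g) \<in> generator A w T" and s: "0 \<le> s"
  shows "((\<lambda>r. nrm (\<lambda>x. (T r h x - T s h x) / (r - s) - T s g x)) \<longlongrightarrow> 0) (at s within {0..})"
proof (rule tendstoI)
  fix e :: real assume e: "0 < e"
  have h: "h \<in> l2 A w" and g: "g \<in> l2 A w"
    and lim: "((\<lambda>t. nrm (\<lambda>x. (T t h x - h x) / t - g x)) \<longlongrightarrow> 0) (at_right 0)"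
    using hg by (auto simp: generator_def)
  obtain M where M: "0 \<le> M" "\<And>s' f. 0 \<le> s' \<Longrightarrow> s' \<le> s \<Longrightarrow> f \<in> l2 A w \<Longrightarrow> nrm (T s' f) \<le> M * nrm f"
    using C0_locally_bounded[OF pos, of s] by blast
  define \<eta> where "\<eta> = e / (2 * (M + 1))"
  have \<eta>: "0 < \<eta>" "M * (2 * \<eta>) < e" using e M(1) by (auto simp: \<eta>_def field_simps)
  have "\<forall>\<^sub>F t in at_right 0. nrm (\<lambda>x. (T t h x - h x) / t - g x) < \<eta> \<and> nrm (\<lambda>x. T t g x - g x) < \<eta>"
    using order_tendstoD(2)[OF lim \<eta>(1)] order_tendstoD(2)[OF C0_continuous[OF g] \<eta>(1)]
    by (rule eventually_conj)
  then obtain \<delta> where \<delta>: "0 < \<delta>"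
    and near: "\<And>t. 0 < t \<Longrightarrow> t < \<delta> \<Longrightarrow> nrm (\<lambda>x. (T t h x - h x) / t - g x) < \<eta> \<and> nrm (\<lambda>x. T t g x - g x) < \<eta>"
    by (auto simp: eventually_at_right_field)
  have dl: "(\<lambda>x. (T t h x - h x) / t - g x) \<in> l2 A w" if "0 \<le> t" for t
    using l2_lincomb[OF l2_diff[OF C0_l2[OF that h] h] g, of "1 / t" "-1"] by simp
  have key: "T s' (\<lambda>x. (T t h x - h x) / t - g x) = (\<lambda>x. (T (s' + t) h x - T s' h x) / t - T s' g x)"
    if t: "0 \<le> t" and s': "0 \<le> s'" for t s'
    using C0_lincomb[OF s' l2_diff[OF C0_l2[OF t h] h] g, of "1 / t" "-1"] C0_diff[OF s' C0_l2[OF t h] h] C0_add[OF s' t h]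
    by simp
  have close: "nrm (\<lambda>x. (T r h x - T s h x) / (r - s) - T s g x) < e"
    if r: "0 \<le> r" "r \<noteq> s" "dist r s < \<delta>" for r
  proof (cases "s < r")
    case True
    define t where "t = r - s"
    have t: "0 < t" "t < \<delta>" "r = s + t" using True r by (auto simp: t_def dist_real_def)
    have "nrm (T s (\<lambda>x. (T t h x - h x) / t - g x)) \<le> M * nrm (\<lambda>x. (T t h x - h x) / t - g x)"
      using t s by (intro M(2) dl) auto
    also have "\<dots> \<le> M * (2 * \<eta>)" using near[OF t(1,2)] \<eta>(1) M(1) by (intro mult_left_mono) auto
    also have "\<dots> < e" by (rule \<eta>(2))
    finally show ?thesis using key[of t s] t s by simp
  next
    case False
    define t where "t = s - r"
    have t: "0 < t" "t < \<delta>" "s = r + t" using False r by (auto simp: t_def dist_real_def)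
    \<comment> \<open>Here \<open>T r d\<close> is the deviation of the left difference quotient from \<open>T s g = T r (T t g)\<close>.\<close>
    define d where "d x = ((T t h x - h x) / t - g x) - (T t g x - g x)" for x
    have d: "d \<in> l2 A w" unfolding d_def using t by (intro l2_diff dl C0_l2 g) auto
    have "T r d = (\<lambda>x. ((T s h x - T r h x) / t - T r g x) - (T s g x - T r g x))"
      unfolding d_def
      using C0_diff[OF r(1) dl l2_diff[OF C0_l2[OF _ g] g], of t t] key[of t r]
        C0_diff[OF r(1) C0_l2[OF _ g] g, of t] C0_add[OF r(1) _ g, of t] t r(1) by simp
    also have "\<dots> = (\<lambda>x. (T r h x - T s h x) / (r - s) - T s g x)"
      using t by (auto simp: fun_eq_iff field_simps)
    finally have eq: "T r d = (\<lambda>x. (T r h x - T s h x) / (r - s) - T s g x)" .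
    have "nrm (T r d) \<le> M * nrm d" using r False d by (intro M(2)) auto
    also have "nrm d \<le> nrm (\<lambda>x. (T t h x - h x) / t - g x) + nrm (\<lambda>x. T t g x - g x)"
      unfolding d_def using dl[of t] l2_diff[OF C0_l2[OF _ g] g, of t] t
      by (intro norm_triangle_diff) (auto simp: l2_mem_iff)
    also have "\<dots> \<le> 2 * \<eta>" using near[OF t(1,2)] by simp
    finally show ?thesis unfolding eq using \<eta>(2) M(1) by (simp add: mult_left_mono)
  qed
  show "\<forall>\<^sub>F r in at s within {0..}. dist (nrm (\<lambda>x. (T r h x - T s h x) / (r - s) - T s g x)) 0 < e"
    unfolding eventually_at using \<delta> close by (intro exI[of _ \<delta>]) (auto simp: norm_nonneg)
qed

end

end

section \<open>Linear differential equations on finite sets\<close>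

text \<open>
  The exponential series of the coefficient matrix, written out entry by entry because the size of
  the system is the cardinality of a set.
\<close>

lemma finite_linear_ode:
  fixes a :: "'a \<Rightarrow> 'a \<Rightarrow> real"
  assumes K: "finite K"
  shows "\<exists>u. \<forall>x\<in>K. u 0 x = f x \<and>
           (\<forall>t. ((\<lambda>t. u t x) has_real_derivative (\<Sum>y\<in>K. a x y * u t y)) (at t))"
proof -
  define it where "it = rec_nat f (\<lambda>_ g x. \<Sum>y\<in>K. a x y * g y)"
  have it0: "it 0 = f" and itS: "it (Suc k) x = (\<Sum>y\<in>K. a x y * it k y)" for k x
    by (simp_all add: it_def)
  define C where "C = (\<Sum>x\<in>K. \<Sum>y\<in>K. \<bar>a x y\<bar>)"
  define M where "M = (\<Sum>x\<in>K. \<bar>f x\<bar>)"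
  have C0: "0 \<le> C" and M0: "0 \<le> M" by (simp_all add: C_def M_def sum_nonneg)
  have bnd: "\<bar>it k x\<bar> \<le> M * C ^ k" if "x \<in> K" for k x
    using that
  proof (induction k arbitrary: x)
    case 0
    then show ?case using K by (auto simp: it0 M_def intro: member_le_sum)
  next
    case (Suc k)
    have "\<bar>it (Suc k) x\<bar> \<le> (\<Sum>y\<in>K. \<bar>a x y\<bar> * \<bar>it k y\<bar>)"
      unfolding itS using sum_abs[of "\<lambda>y. a x y * it k y" K] by (simp add: abs_mult)
    also have "\<dots> \<le> (\<Sum>y\<in>K. \<bar>a x y\<bar> * (M * C ^ k))"
      using Suc.IH by (intro sum_mono mult_left_mono) auto
    also have "\<dots> = (\<Sum>y\<in>K. \<bar>a x y\<bar>) * (M * C ^ k)" by (simp add: sum_distrib_right)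
    also have "\<dots> \<le> C * (M * C ^ k)"
      using K Suc.prems C0 M0 unfolding C_def
      by (intro mult_right_mono member_le_sum) (auto simp: sum_nonneg)
    finally show ?case by (simp add: mult_ac)
  qed
  define c where "c x k = it k x / fact k" for x k
  have summ: "summable (\<lambda>k. c x k * t ^ k)" if x: "x \<in> K" for x t
  proof (rule summable_comparison_test')
    show "summable (\<lambda>k. M * (inverse (fact k) * (C * \<bar>t\<bar>) ^ k))"
      by (intro summable_mult summable_exp)
    fix k
    have "\<bar>it k x\<bar> * (\<bar>t\<bar> ^ k / fact k) \<le> M * C ^ k * (\<bar>t\<bar> ^ k / fact k)"
      using bnd[OF x, of k] by (intro mult_right_mono) auto
    then show "norm (c x k * t ^ k) \<le> M * (inverse (fact k) * (C * \<bar>t\<bar>) ^ k)"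
      by (simp add: c_def abs_mult power_abs power_mult_distrib field_simps)
  qed
  define u where "u t x = (\<Sum>k. c x k * t ^ k)" for t x
  have "u 0 x = f x" for x
    unfolding u_def using powser_zero[of "c x"] by (simp add: c_def it0)
  moreover have "((\<lambda>t. u t x) has_real_derivative (\<Sum>y\<in>K. a x y * u t y)) (at t)"
    if x: "x \<in> K" for x t
  proof -
    have "((\<lambda>t. u t x) has_real_derivative (\<Sum>k. diffs (c x) k * t ^ k)) (at t)"
      unfolding u_def using summ[OF x] by (rule termdiffs_strong_converges_everywhere)
    also have "(\<Sum>k. diffs (c x) k * t ^ k) = (\<Sum>k. \<Sum>y\<in>K. a x y * (c y k * t ^ k))"
    proof (rule suminf_cong)
      fix k
      have "diffs (c x) k = it (Suc k) x / fact k"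
        by (simp add: diffs_def c_def field_simps del: of_nat_Suc)
      also have "\<dots> = (\<Sum>y\<in>K. a x y * c y k)" by (simp add: itS c_def sum_divide_distrib)
      finally show "diffs (c x) k * t ^ k = (\<Sum>y\<in>K. a x y * (c y k * t ^ k))"
        by (simp add: sum_distrib_right mult.assoc)
    qed
    also have "\<dots> = (\<Sum>y\<in>K. \<Sum>k. a x y * (c y k * t ^ k))"
      using summ by (intro suminf_sum summable_mult) auto
    also have "\<dots> = (\<Sum>y\<in>K. a x y * u t y)"
      unfolding u_def using summ by (intro sum.cong refl suminf_mult) auto
    finally show ?thesis .
  qed
  ultimately show ?thesis by blast
qed

text \<open>
  The square of the negative part is differentiable, also at zero. This makes the energy of the
  negative part usable in comparison principles.
\<close>

lemma min_zero_square_derivative: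
  "((\<lambda>s::real. (min s 0)\<^sup>2) has_real_derivative 2 * min s 0) (at s)"
proof (cases "s = 0")
  case True
  have "((\<lambda>h. (min h 0)\<^sup>2 / h) \<longlongrightarrow> 0) (at (0::real))"
  proof (rule tendsto_sandwich[where f = "\<lambda>h. - \<bar>h\<bar>" and h = "\<lambda>h. \<bar>h\<bar>"])
    show "\<forall>\<^sub>F h in at (0::real). - \<bar>h\<bar> \<le> (min h 0)\<^sup>2 / h"
      by (rule always_eventually) (auto simp: min_def power2_eq_square)
    show "\<forall>\<^sub>F h in at (0::real). (min h 0)\<^sup>2 / h \<le> \<bar>h\<bar>"
      by (rule always_eventually) (auto simp: min_def power2_eq_square)
  qed (auto intro!: tendsto_eq_intros)
  then show ?thesis using True by (simp add: DERIV_def)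
next
  case False
  consider "s < 0" | "s > 0" using False by linarith
  then show ?thesis
  proof cases
    case 1
    have "((\<lambda>s. s\<^sup>2) has_real_derivative 2 * min s 0) (at s)"
      using 1 by (auto intro!: derivative_eq_intros)
    then show ?thesis
      by (rule has_field_derivative_transform_within_open[where S = "{..<0}"]) (use 1 in auto)
  next
    case 2
    have "((\<lambda>s. 0) has_real_derivative 2 * min s 0) (at s)"
      using 2 by (auto intro!: derivative_eq_intros)
    then show ?thesis
      by (rule has_field_derivative_transform_within_open[where S = "{0<..}"]) (use 2 in auto)
  qed
qed

section \<open>Comparison principles on finite sets of vertices\<close>

text \<open>
  Local finiteness turns all sums over neighbours into finite sums.
\<close>

locale lf_graph =
  fixes X :: "'a set" and m :: "'a \<Rightarrow> real" and b :: "'a \<Rightarrow> 'a \<Rightarrow> real"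
  assumes graph: "graph_over X m b"
    and locally_finite: "locally_finite X b"
begin

lemma countable_X: "countable X" using graph by (simp add: graph_over_def)
lemma m_pos: "x \<in> X \<Longrightarrow> 0 < m x" using graph by (simp add: graph_over_def)
lemma b_nonneg: "x \<in> X \<Longrightarrow> y \<in> X \<Longrightarrow> 0 \<le> b x y" using graph by (simp add: graph_over_def)
lemma b_sym: "x \<in> X \<Longrightarrow> y \<in> X \<Longrightarrow> b x y = b y x" using graph by (simp add: graph_over_def)

sublocale l2: weighted_set X m
  by unfold_locales (use m_pos in \<open>auto intro: less_imp_le\<close>)

definition nbrs :: "'a \<Rightarrow> 'a set" where "nbrs x = {y \<in> X. 0 < b x y}"

lemma nbrs_finite: "x \<in> X \<Longrightarrow> finite (nbrs x)"
  using locally_finite by (simp add: locally_finite_def nbrs_def)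

lemma nbrs_subset: "nbrs x \<subseteq> X" by (auto simp: nbrs_def)

lemma not_nbr: "x \<in> X \<Longrightarrow> y \<in> X \<Longrightarrow> y \<notin> nbrs x \<Longrightarrow> b x y = 0"
  using b_nonneg[of x y] by (auto simp: nbrs_def)

definition deg :: "'a \<Rightarrow> real" where "deg x = (\<Sum>y\<in>nbrs x. b x y)"

lemma sum_nbrs:
  assumes "x \<in> X" "finite K" "K \<subseteq> X" "nbrs x \<subseteq> K"
  shows "(\<Sum>y\<in>K. b x y * g y) = (\<Sum>y\<in>nbrs x. b x y * g y)"
  using assms not_nbr by (intro sum.mono_neutral_right) auto

lemma sum_le_deg:
  assumes "x \<in> X" "finite K" "K \<subseteq> X"
  shows "(\<Sum>y\<in>K. b x y) \<le> deg x"
proof -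
  have "(\<Sum>y\<in>K. b x y) \<le> (\<Sum>y\<in>K \<union> nbrs x. b x y)"
    using assms nbrs_finite b_nonneg[OF assms(1)] by (intro sum_mono2) (auto simp: nbrs_def)
  also have "\<dots> = deg x"
    using sum_nbrs[of x "K \<union> nbrs x" "\<lambda>_. 1"] assms nbrs_finite nbrs_subset by (simp add: deg_def)
  finally show ?thesis .
qed

text \<open>
  The Laplacian with Dirichlet condition outside \<open>K\<close>: edges leaving \<open>K\<close> contribute to the degree
  only, which means that the function is continued by zero.
\<close>

definition dirL :: "'a set \<Rightarrow> ('a \<Rightarrow> real) \<Rightarrow> 'a \<Rightarrow> real" where
  "dirL K f x = (deg x * f x - (\<Sum>y\<in>K. b x y * f y)) / m x"

lemma dirL_cong: "x \<in> K \<Longrightarrow> (\<And>y. y \<in> K \<Longrightarrow> f y = g y) \<Longrightarrow> dirL K f x = dirL K g x"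
  unfolding dirL_def by (simp cong: sum.cong)

lemma dirL_lincomb: "dirL K (\<lambda>y. \<alpha> * f y + \<beta> * g y) x = \<alpha> * dirL K f x + \<beta> * dirL K g x"
  by (simp add: dirL_def sum.distrib algebra_simps sum_distrib_left diff_divide_distrib add_divide_distrib)

text \<open>
  Summation by parts. After symmetrization the sum consists of the terms
  \<open>b x y * (\<phi> (z x) - \<phi> (z y)) * (z x - z y)\<close>, nonnegative by monotonicity, and of the killing
  terms for the edges leaving \<open>K\<close>, nonnegative by the sign condition. With \<open>\<phi> = id\<close> this is
  positivity of the form, with the negative part it is the source of all comparison principles.
\<close>

lemma dirL_monotone_pairing:
  fixes \<phi> :: "real \<Rightarrow> real"
  assumes K: "finite K" "K \<subseteq> X" and mono: "mono \<phi>" and sign: "\<And>s. 0 \<le> \<phi> s * s"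
  shows "0 \<le> (\<Sum>x\<in>K. m x * \<phi> (z x) * dirL K z x)"
proof -
  let ?k = "\<lambda>x. deg x - (\<Sum>y\<in>K. b x y)"
  have "(\<Sum>x\<in>K. m x * \<phi> (z x) * dirL K z x)
      = (\<Sum>x\<in>K. ?k x * (\<phi> (z x) * z x) + (\<Sum>y\<in>K. b x y * \<phi> (z x) * (z x - z y)))"
  proof (rule sum.cong)
    fix x assume "x \<in> K"
    then have "m x \<noteq> 0" using K m_pos by force
    then have "m x * \<phi> (z x) * dirL K z x = \<phi> (z x) * (deg x * z x - (\<Sum>y\<in>K. b x y * z y))"
      by (simp add: dirL_def)
    also have "\<dots> = ?k x * (\<phi> (z x) * z x) + (\<Sum>y\<in>K. b x y * \<phi> (z x) * (z x - z y))"
      by (simp add: algebra_simps sum_subtractf sum_distrib_left sum_distrib_right)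
    finally show "m x * \<phi> (z x) * dirL K z x
      = ?k x * (\<phi> (z x) * z x) + (\<Sum>y\<in>K. b x y * \<phi> (z x) * (z x - z y))" .
  qed simp
  also have "\<dots> = (\<Sum>x\<in>K. ?k x * (\<phi> (z x) * z x))
      + (\<Sum>x\<in>K. \<Sum>y\<in>K. b x y * \<phi> (z x) * (z x - z y))"
    by (simp add: sum.distrib)
  also have "(\<Sum>x\<in>K. \<Sum>y\<in>K. b x y * \<phi> (z x) * (z x - z y))
      = (\<Sum>x\<in>K. \<Sum>y\<in>K. b x y * (\<phi> (z x) - \<phi> (z y)) * (z x - z y)) / 2" (is "?S = ?D / 2")
  proof -
    have "?S = (\<Sum>x\<in>K. \<Sum>y\<in>K. b y x * \<phi> (z y) * (z y - z x))" by (rule sum.swap)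
    also have "\<dots> = (\<Sum>x\<in>K. \<Sum>y\<in>K. b x y * \<phi> (z y) * (z y - z x))"
      using K b_sym by (intro sum.cong refl) (metis subsetD)
    finally have "2 * ?S = ?S + (\<Sum>x\<in>K. \<Sum>y\<in>K. b x y * \<phi> (z y) * (z y - z x))" by simp
    also have "\<dots> = ?D" by (simp add: sum.distrib[symmetric] algebra_simps)
    finally show ?thesis by simp
  qed
  finally have eq: "(\<Sum>x\<in>K. m x * \<phi> (z x) * dirL K z x)
      = (\<Sum>x\<in>K. ?k x * (\<phi> (z x) * z x)) + ?D / 2" .
  have "0 \<le> (\<Sum>x\<in>K. ?k x * (\<phi> (z x) * z x))"
    using K sum_le_deg sign by (intro sum_nonneg mult_nonneg_nonneg[where b = "\<phi> _ * _"]) auto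
  moreover have "0 \<le> ?D"
  proof (intro sum_nonneg)
    fix x y assume "x \<in> K" "y \<in> K"
    then have "0 \<le> b x y" using K b_nonneg by auto
    moreover have "0 \<le> (\<phi> (z x) - \<phi> (z y)) * (z x - z y)"
      using monoD[OF mono, of "z x" "z y"] monoD[OF mono, of "z y" "z x"]
      by (cases "z x \<le> z y") (auto intro: mult_nonneg_nonneg mult_nonpos_nonpos)
    ultimately show "0 \<le> b x y * (\<phi> (z x) - \<phi> (z y)) * (z x - z y)"
      by (simp add: mult.assoc)
  qed
  ultimately show ?thesis unfolding eq by simp
qed

lemma dirL_min_pairing:
  assumes "finite K" "K \<subseteq> X"
  shows "0 \<le> (\<Sum>x\<in>K. m x * min (z x) 0 * dirL K z x)"
  using dirL_monotone_pairing[OF assms, of "\<lambda>s. min s 0" z]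
  by (auto simp: mono_def min_def mult_nonpos_nonpos)

lemma weighted_sum_squares_zero:
  assumes "finite K" "K \<subseteq> X" "(\<Sum>x\<in>K. m x * (g x)\<^sup>2) \<le> 0" "x \<in> K"
  shows "g x = 0"
proof -
  have nn: "0 \<le> m y * (g y)\<^sup>2" if "y \<in> K" for y
    using that assms(2) m_pos[of y] by (intro mult_nonneg_nonneg) (auto intro: less_imp_le)
  then have "0 \<le> (\<Sum>x\<in>K. m x * (g x)\<^sup>2)" by (intro sum_nonneg)
  then have "(\<Sum>x\<in>K. m x * (g x)\<^sup>2) = 0" using assms(3) by simp
  then have "m x * (g x)\<^sup>2 = 0" using sum_nonneg_eq_0_iff[OF assms(1), of "\<lambda>y. m y * (g y)\<^sup>2"] nn assms(4) by blast
  then show ?thesis using m_pos[of x] assms by auto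
qed

lemma elliptic_comparison:
  assumes K: "finite K" "K \<subseteq> X" and super: "\<And>x. x \<in> K \<Longrightarrow> 0 \<le> dirL K z x + z x" and x: "x \<in> K"
  shows "0 \<le> z x"
proof -
  have "(\<Sum>x\<in>K. m x * (min (z x) 0)\<^sup>2)
      = (\<Sum>x\<in>K. m x * min (z x) 0 * (dirL K z x + z x)) - (\<Sum>x\<in>K. m x * min (z x) 0 * dirL K z x)"
    unfolding sum_subtractf[symmetric]
    by (intro sum.cong refl) (auto simp: min_def power2_eq_square algebra_simps)
  moreover have "(\<Sum>x\<in>K. m x * min (z x) 0 * (dirL K z x + z x)) \<le> 0"
    using K m_pos super
    by (intro sum_nonpos mult_nonpos_nonneg mult_nonneg_nonpos) (auto intro: less_imp_le)
  ultimately have "(\<Sum>x\<in>K. m x * (min (z x) 0)\<^sup>2) \<le> 0"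
    using dirL_min_pairing[OF K, of z] by simp
  from weighted_sum_squares_zero[OF K this x] show ?thesis by (simp add: min_def split: if_splits)
qed

text \<open>
  The weighted square sum of the negative part starts at zero and cannot increase.
\<close>

lemma parabolic_comparison:
  assumes K: "finite K" "K \<subseteq> X"
    and deriv: "\<And>t x. 0 \<le> t \<Longrightarrow> x \<in> K \<Longrightarrow> ((\<lambda>t. z t x) has_real_derivative z' t x) (at t)"
    and super: "\<And>t x. 0 \<le> t \<Longrightarrow> x \<in> K \<Longrightarrow> - dirL K (z t) x \<le> z' t x"
    and init: "\<And>x. x \<in> K \<Longrightarrow> 0 \<le> z 0 x"
    and t: "0 \<le> t" and x: "x \<in> K"
  shows "0 \<le> z t x"
proof -
  define g where "g t = (\<Sum>x\<in>K. m x * (min (z t x) 0)\<^sup>2)" for t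
  have g': "(g has_real_derivative (\<Sum>x\<in>K. m x * (2 * min (z t x) 0 * z' t x))) (at t)"
    if "0 \<le> t" for t
    unfolding g_def
    by (intro DERIV_sum DERIV_cmult DERIV_chain2[OF min_zero_square_derivative] deriv that)
  have "(\<Sum>x\<in>K. m x * (2 * min (z t x) 0 * z' t x)) \<le> 0" if t: "0 \<le> t" for t
  proof -
    have "(\<Sum>x\<in>K. m x * (2 * min (z t x) 0 * z' t x))
        \<le> (\<Sum>x\<in>K. - 2 * (m x * min (z t x) 0 * dirL K (z t) x))"
    proof (rule sum_mono)
      fix x assume x: "x \<in> K"
      have "0 \<le> m x * (- min (z t x) 0) * (z' t x + dirL K (z t) x)"
        using super[OF t x] m_pos[of x] x K by (intro mult_nonneg_nonneg) auto
      then show "m x * (2 * min (z t x) 0 * z' t x) \<le> - 2 * (m x * min (z t x) 0 * dirL K (z t) x)"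
        by (simp add: algebra_simps)
    qed
    also have "\<dots> \<le> 0"
      using dirL_min_pairing[OF K, of "z t"] by (simp add: sum_distrib_left[symmetric] sum_negf)
    finally show ?thesis .
  qed
  then have "g t \<le> g 0"
    using g' by (intro DERIV_nonpos_imp_nonincreasing[OF t]) blast
  also have "g 0 = 0" unfolding g_def using init by (intro sum.neutral) (auto simp: min_absorb2)
  finally have "(\<Sum>x\<in>K. m x * (min (z t x) 0)\<^sup>2) \<le> 0" by (simp add: g_def)
  from weighted_sum_squares_zero[OF K this x] show ?thesis by (simp add: min_def split: if_splits)
qed

section \<open>Heat flow absorbed outside a finite set\<close>

definition heat_solution :: "'a set \<Rightarrow> ('a \<Rightarrow> real) \<Rightarrow> (real \<Rightarrow> 'a \<Rightarrow> real) \<Rightarrow> bool" where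
  "heat_solution K f u \<longleftrightarrow> (\<forall>x\<in>K. u 0 x = f x \<and>
     (\<forall>t\<ge>0. ((\<lambda>t. u t x) has_real_derivative - dirL K (u t) x) (at t)))"

text \<open>
  Absorption outside \<open>K\<close>; values off \<open>K\<close> are fixed to be zero so that the flow is a function on
  the whole type.
\<close>

definition heatK :: "'a set \<Rightarrow> ('a \<Rightarrow> real) \<Rightarrow> real \<Rightarrow> 'a \<Rightarrow> real" where
  "heatK K f = (SOME u. heat_solution K f u \<and> (\<forall>t x. x \<notin> K \<longrightarrow> u t x = 0))"

lemma heatK_exists:
  assumes K: "finite K" "K \<subseteq> X"
  shows "\<exists>u. heat_solution K f u \<and> (\<forall>t x. x \<notin> K \<longrightarrow> u t x = 0)"
proof -
  define a where "a x y = (b x y - (if x = y then deg x else 0)) / m x" for x y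
  have a: "(\<Sum>y\<in>K. a x y * g y) = - dirL K g x" if x: "x \<in> K" for g x
  proof -
    have "(\<Sum>y\<in>K. a x y * g y) = (\<Sum>y\<in>K. b x y * g y - (if x = y then deg x * g x else 0)) / m x"
      unfolding a_def sum_divide_distrib by (intro sum.cong refl) (auto simp: field_simps)
    also have "\<dots> = - dirL K g x"
      using K x by (simp add: sum_subtractf dirL_def minus_divide_left)
    finally show ?thesis .
  qed
  obtain u where u: "\<forall>x\<in>K. u 0 x = f x \<and>
      (\<forall>t. ((\<lambda>t. u t x) has_real_derivative (\<Sum>y\<in>K. a x y * u t y)) (at t))"
    using finite_linear_ode[OF K(1)] by blast
  define v where "v t x = (if x \<in> K then u t x else 0)" for t x
  have "heat_solution K f v"
    unfolding heat_solution_def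
  proof (intro ballI conjI allI impI)
    fix x assume x: "x \<in> K"
    then show "v 0 x = f x" using u by (simp add: v_def)
    fix t :: real
    have "dirL K (v t) x = dirL K (u t) x" using x by (intro dirL_cong) (auto simp: v_def)
    moreover have "((\<lambda>t. u t x) has_real_derivative - dirL K (u t) x) (at t)"
      using u x a by auto
    ultimately show "((\<lambda>t. v t x) has_real_derivative - dirL K (v t) x) (at t)"
      using x by (simp add: v_def)
  qed
  moreover have "\<forall>t x. x \<notin> K \<longrightarrow> v t x = 0" by (simp add: v_def)
  ultimately show ?thesis by blast
qed

lemma heatK_spec:
  assumes "finite K" "K \<subseteq> X"
  shows heatK_solution: "heat_solution K f (heatK K f)"
    and heatK_outside: "x \<notin> K \<Longrightarrow> heatK K f t x = 0"
  using someI_ex[OF heatK_exists[OF assms, of f]] unfolding heatK_def by auto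

context
  fixes K assumes K: "finite K" "K \<subseteq> X"
begin

lemma heatK_0: "x \<in> K \<Longrightarrow> heatK K f 0 x = f x"
  using heatK_solution[OF K] by (simp add: heat_solution_def)

lemma heatK_deriv:
  "x \<in> K \<Longrightarrow> 0 \<le> t \<Longrightarrow> ((\<lambda>t. heatK K f t x) has_real_derivative - dirL K (heatK K f t) x) (at t)"
  using heatK_solution[OF K] by (simp add: heat_solution_def)

text \<open>
  Uniqueness, positivity, linearity and the semigroup law are all consequences of this comparison
  of two solutions.
\<close>

lemma heat_solution_mono:
  assumes u: "heat_solution K f u" and v: "heat_solution K g v"
    and le: "\<And>x. x \<in> K \<Longrightarrow> f x \<le> g x" and t: "0 \<le> t" and x: "x \<in> K"
  shows "u t x \<le> v t x"
proof -
  have "0 \<le> v t x - u t x"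
  proof (rule parabolic_comparison[OF K _ _ _ t x, where z' = "\<lambda>t x. - dirL K (v t) x - - dirL K (u t) x"])
    fix t x assume "(0::real) \<le> t" "x \<in> K"
    then show "((\<lambda>t. v t x - u t x) has_real_derivative - dirL K (v t) x - - dirL K (u t) x) (at t)"
      using u v by (intro DERIV_diff) (auto simp: heat_solution_def)
    show "- dirL K (\<lambda>x. v t x - u t x) x \<le> - dirL K (v t) x - - dirL K (u t) x"
      using dirL_lincomb[of K 1 "v t" "-1" "u t" x] by simp
  qed (use u v le in \<open>auto simp: heat_solution_def\<close>)
  then show ?thesis by simp
qed

lemma heatK_unique:
  assumes "heat_solution K f u" "0 \<le> t" "x \<in> K"
  shows "heatK K f t x = u t x"
  using heat_solution_mono[OF assms(1) heatK_solution[OF K, of f] _ assms(2,3)]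
    heat_solution_mono[OF heatK_solution[OF K, of f] assms(1) _ assms(2,3)] by force

lemma heatK_mono:
  assumes "\<And>x. x \<in> K \<Longrightarrow> f x \<le> g x" "0 \<le> t"
  shows "heatK K f t x \<le> heatK K g t x"
  using heat_solution_mono[OF heatK_solution[OF K] heatK_solution[OF K], of f g t x] assms heatK_outside[OF K]
  by (cases "x \<in> K") auto

lemma heatK_cong:
  assumes "\<And>x. x \<in> K \<Longrightarrow> f x = g x" "0 \<le> t"
  shows "heatK K f t x = heatK K g t x"
  using assms by (intro antisym heatK_mono) auto

lemma heatK_lincomb:
  assumes t: "0 \<le> t"
  shows "heatK K (\<lambda>x. \<alpha> * f x + \<beta> * g x) t x = \<alpha> * heatK K f t x + \<beta> * heatK K g t x"
proof (cases "x \<in> K")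
  case True
  have "heat_solution K (\<lambda>x. \<alpha> * f x + \<beta> * g x) (\<lambda>t x. \<alpha> * heatK K f t x + \<beta> * heatK K g t x)"
    unfolding heat_solution_def
  proof (intro ballI conjI allI impI)
    fix x t assume "x \<in> K" "(0::real) \<le> t"
    then have "((\<lambda>t. \<alpha> * heatK K f t x + \<beta> * heatK K g t x) has_real_derivative
       \<alpha> * (- dirL K (heatK K f t) x) + \<beta> * (- dirL K (heatK K g t) x)) (at t)"
      by (intro DERIV_add DERIV_cmult heatK_deriv)
    then show "((\<lambda>t. \<alpha> * heatK K f t x + \<beta> * heatK K g t x) has_real_derivative
       - dirL K (\<lambda>x. \<alpha> * heatK K f t x + \<beta> * heatK K g t x) x) (at t)"
      by (simp add: dirL_lincomb algebra_simps)
  qed (simp add: heatK_0)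
  from heatK_unique[OF this t True] show ?thesis .
qed (simp add: heatK_outside[OF K])

lemma heatK_nonneg:
  assumes "\<And>x. x \<in> K \<Longrightarrow> 0 \<le> f x" "0 \<le> t"
  shows "0 \<le> heatK K f t x"
  using heatK_mono[of "\<lambda>x. 0 * f x + 0 * f x" f t x] heatK_lincomb[OF assms(2), of 0 f 0 f x] assms by simp

lemma heatK_le_1:
  assumes f: "\<And>x. x \<in> K \<Longrightarrow> f x \<le> 1" and t: "0 \<le> t"
  shows "heatK K f t x \<le> 1"
proof (cases "x \<in> K")
  case True
  have "0 \<le> 1 - heatK K f t x"
  proof (rule parabolic_comparison[OF K _ _ _ t True, where z' = "\<lambda>t x. dirL K (heatK K f t) x"])
    fix t x assume x: "x \<in> K" and "(0::real) \<le> t"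
    then show "((\<lambda>t. 1 - heatK K f t x) has_real_derivative dirL K (heatK K f t) x) (at t)"
      by (auto intro!: derivative_eq_intros heatK_deriv)
    have "0 \<le> dirL K (\<lambda>_. 1) x"
      using sum_le_deg[of x K] K x m_pos[of x] by (auto simp: dirL_def intro!: divide_nonneg_pos)
    then show "- dirL K (\<lambda>x. 1 - heatK K f t x) x \<le> dirL K (heatK K f t) x"
      using dirL_lincomb[of K 1 "\<lambda>_. 1" "-1" "heatK K f t" x] by simp
  qed (use f in \<open>auto simp: heatK_0\<close>)
  then show ?thesis by simp
qed (simp add: heatK_outside[OF K])

lemma heatK_semigroup:
  assumes s: "0 \<le> s" and t: "0 \<le> t"
  shows "heatK K f (s + t) x = heatK K (heatK K f t) s x"
proof (cases "x \<in> K")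
  case True
  have "heat_solution K (heatK K f t) (\<lambda>s. heatK K f (s + t))"
    unfolding heat_solution_def
  proof (intro ballI conjI allI impI)
    fix x s assume "x \<in> K" "(0::real) \<le> s"
    then have "((\<lambda>t. heatK K f t x) has_real_derivative - dirL K (heatK K f (s + t)) x) (at (s + t))"
      using t by (intro heatK_deriv) auto
    then show "((\<lambda>s. heatK K f (s + t) x) has_real_derivative - dirL K (heatK K f (s + t)) x) (at s)"
      by (simp add: DERIV_shift)
  qed simp
  from heatK_unique[OF this s True] show ?thesis by simp
qed (simp add: heatK_outside[OF K])

lemma heatK_contraction:
  assumes t: "0 \<le> t"
  shows "(\<Sum>x\<in>K. m x * (heatK K f t x)\<^sup>2) \<le> (\<Sum>x\<in>K. m x * (f x)\<^sup>2)"
proof -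
  define g where "g t = (\<Sum>x\<in>K. m x * (heatK K f t x)\<^sup>2)" for t
  have g': "(g has_real_derivative (\<Sum>x\<in>K. m x * (2 * heatK K f t x * - dirL K (heatK K f t) x))) (at t)"
    if "0 \<le> t" for t
    unfolding g_def
    by (intro DERIV_sum DERIV_cmult)
       (use heatK_deriv that in \<open>force intro!: derivative_eq_intros\<close>)
  have "(\<Sum>x\<in>K. m x * (2 * heatK K f t x * - dirL K (heatK K f t) x)) \<le> 0" for t
  proof -
    have "(\<Sum>x\<in>K. m x * (2 * heatK K f t x * - dirL K (heatK K f t) x))
        = - 2 * (\<Sum>x\<in>K. m x * heatK K f t x * dirL K (heatK K f t) x)"
      by (simp add: sum_distrib_left sum_negf[symmetric] mult_ac)
    then show ?thesis
      using dirL_monotone_pairing[OF K, of "\<lambda>s. s" "heatK K f t"] by (simp add: mono_def)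
  qed
  then have "g t \<le> g 0"
    using g' by (intro DERIV_nonpos_imp_nonincreasing[OF t]) blast
  then show ?thesis by (simp add: g_def heatK_0)
qed

end

text \<open>
  On the smaller set, the flow on the larger set is a supersolution: it receives additional mass
  from the vertices outside.
\<close>

lemma heatK_mono_set:
  assumes K: "finite K" "K \<subseteq> X" and K': "finite K'" "K' \<subseteq> X" and sub: "K \<subseteq> K'"
    and f: "\<And>x. x \<in> K' \<Longrightarrow> 0 \<le> f x" and t: "0 \<le> t"
  shows "heatK K f t x \<le> heatK K' f t x"
proof (cases "x \<in> K")
  case True
  let ?u = "heatK K f" and ?v = "heatK K' f"
  have "0 \<le> ?v t x - ?u t x"
  proof (rule parabolic_comparison[OF K _ _ _ t True, where z' = "\<lambda>t x. - dirL K' (?v t) x - - dirL K (?u t) x"])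
    fix t x assume t: "(0::real) \<le> t" and x: "x \<in> K"
    then show "((\<lambda>t. ?v t x - ?u t x) has_real_derivative - dirL K' (?v t) x - - dirL K (?u t) x) (at t)"
      using K K' sub by (intro DERIV_diff heatK_deriv) auto
    have "(\<Sum>y\<in>K. b x y * ?v t y) \<le> (\<Sum>y\<in>K'. b x y * ?v t y)"
      using K' sub x f t heatK_nonneg[OF K'] by (intro sum_mono2 mult_nonneg_nonneg b_nonneg) auto
    then have "dirL K' (?v t) x \<le> dirL K (?v t) x"
      using m_pos[of x] x K unfolding dirL_def by (intro divide_right_mono) auto
    then show "- dirL K (\<lambda>x. ?v t x - ?u t x) x \<le> - dirL K' (?v t) x - - dirL K (?u t) x"
      using dirL_lincomb[of K 1 "?v t" "-1" "?u t" x] by simp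
  qed (use K K' sub in \<open>auto simp: heatK_0\<close>)
  then show ?thesis by simp
next
  case False
  then show ?thesis using heatK_outside[OF K] heatK_nonneg[OF K' f t] by simp
qed

end

section \<open>The Laplace transform at one\<close>

text \<open>
  The class of functions to which the Laplace transform is applied; all orbits considered below,
  evaluated at a vertex, belong to it.
\<close>

definition bdd_cont :: "real \<Rightarrow> (real \<Rightarrow> real) \<Rightarrow> bool" where
  "bdd_cont C h \<longleftrightarrow> continuous_on {0..} h \<and> (\<forall>t\<ge>0. \<bar>h t\<bar> \<le> C)"

definition laplace1 :: "(real \<Rightarrow> real) \<Rightarrow> real" where
  "laplace1 h = integral {0..} (\<lambda>t. exp (- t) * h t)"

lemma bdd_cont_continuous_on: "bdd_cont C h \<Longrightarrow> S \<subseteq> {0..} \<Longrightarrow> continuous_on S h"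
  by (auto simp: bdd_cont_def intro: continuous_on_subset)

lemma exp_weight_integral: "((\<lambda>t::real. exp (- t)) has_integral 1) {0..}"
  using has_integral_exp_minus_to_infinity[of 1 0] by simp

lemma exp_weight_integrable: "(\<lambda>t::real. C * exp (- t)) integrable_on {0..}"
  using has_integral_mult_right[OF exp_weight_integral, of C] by (rule has_integral_integrable)

lemma laplace1_integrable:
  assumes "bdd_cont C h"
  shows "(\<lambda>t. exp (- t) * h t) integrable_on {0..}"
proof (rule measurable_bounded_by_integrable_imp_integrable)
  show "(\<lambda>t. exp (- t) * h t) \<in> borel_measurable (lebesgue_on {0..})"
    using assms by (intro continuous_imp_measurable_on_sets_lebesgue continuous_intros) (auto simp: bdd_cont_def)
  show "(\<lambda>t. C * exp (- t)) integrable_on {0..}" by (rule exp_weight_integrable)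
  show "norm (exp (- t) * h t) \<le> C * exp (- t)" if "t \<in> {0..}" for t
    using assms that by (auto simp: bdd_cont_def abs_mult mult.commute)
qed auto

lemma laplace1_const: "laplace1 (\<lambda>_. c) = c"
  unfolding laplace1_def using has_integral_mult_left[OF exp_weight_integral, of c] by (auto dest: integral_unique)

lemma laplace1_lincomb:
  assumes "bdd_cont C h" "bdd_cont D k"
  shows "laplace1 (\<lambda>t. \<alpha> * h t + \<beta> * k t) = \<alpha> * laplace1 h + \<beta> * laplace1 k"
proof -
  have "laplace1 (\<lambda>t. \<alpha> * h t + \<beta> * k t)
     = integral {0..} (\<lambda>t. \<alpha> * (exp (- t) * h t) + \<beta> * (exp (- t) * k t))"
    unfolding laplace1_def by (simp add: algebra_simps)
  also have "\<dots> = \<alpha> * laplace1 h + \<beta> * laplace1 k"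
    unfolding laplace1_def using laplace1_integrable[OF assms(1)] laplace1_integrable[OF assms(2)]
    by (subst integral_add) (auto intro!: integrable_on_mult_right)
  finally show ?thesis .
qed

lemma laplace1_mono:
  assumes "bdd_cont C h" "bdd_cont D k" "\<And>t. 0 \<le> t \<Longrightarrow> h t \<le> k t"
  shows "laplace1 h \<le> laplace1 k"
  unfolding laplace1_def
  using laplace1_integrable[OF assms(1)] laplace1_integrable[OF assms(2)] assms(3)
  by (intro integral_le) auto

lemma bdd_cont_const: "bdd_cont \<bar>c\<bar> (\<lambda>_. c)" by (simp add: bdd_cont_def)

lemma bdd_cont_lincomb:
  "bdd_cont C h \<Longrightarrow> bdd_cont D k \<Longrightarrow> bdd_cont (\<bar>\<alpha>\<bar> * C + \<bar>\<beta>\<bar> * D) (\<lambda>t. \<alpha> * h t + \<beta> * k t)"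
  unfolding bdd_cont_def
  by (auto intro!: continuous_intros order_trans[OF abs_triangle_ineq] add_mono mult_left_mono simp: abs_mult)

lemma laplace1_sum:
  assumes "finite F" "\<And>y. y \<in> F \<Longrightarrow> bdd_cont (C y) (h y)"
  shows "laplace1 (\<lambda>t. \<Sum>y\<in>F. c y * h y t) = (\<Sum>y\<in>F. c y * laplace1 (h y)) \<and>
         (\<exists>D. bdd_cont D (\<lambda>t. \<Sum>y\<in>F. c y * h y t))"
  using assms
proof (induction F)
  case empty
  then show ?case using laplace1_const[of 0] bdd_cont_const[of 0] by auto
next
  case (insert z F)
  then obtain D where D: "bdd_cont D (\<lambda>t. \<Sum>y\<in>F. c y * h y t)" by blast
  have z: "bdd_cont (C z) (h z)" using insert by simp
  show ?case using insert laplace1_lincomb[OF z D, of "c z" 1] bdd_cont_lincomb[OF z D, of "c z" 1]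
    by auto
qed

lemma laplace1_dominated:
  assumes "\<And>n. bdd_cont C (h n)" "\<And>t. 0 \<le> t \<Longrightarrow> (\<lambda>n. h n t) \<longlonglongrightarrow> k t"
  shows "(\<lambda>n. laplace1 (h n)) \<longlonglongrightarrow> laplace1 k"
  unfolding laplace1_def
proof (rule dominated_convergence(2))
  show "(\<lambda>t. C * exp (- t)) integrable_on {0..}" by (rule exp_weight_integrable)
  show "norm (exp (- t) * h n t) \<le> C * exp (- t)" if "t \<in> {0..}" for t n
    using assms(1)[of n] that by (auto simp: bdd_cont_def abs_mult mult.commute)
qed (use assms laplace1_integrable in \<open>auto intro!: tendsto_intros\<close>)

lemma laplace1_truncate:
  assumes h: "bdd_cont C h"
  shows "(\<lambda>n. integral {0..real n} (\<lambda>t. exp (- t) * h t)) \<longlonglongrightarrow> laplace1 h"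
proof -
  have "(\<lambda>n. integral {0..} (\<lambda>t. if t \<in> {0..real n} then exp (- t) * h t else 0)) \<longlonglongrightarrow> laplace1 h"
    unfolding laplace1_def
  proof (rule dominated_convergence(2))
    show "(\<lambda>t. C * exp (- t)) integrable_on {0..}" by (rule exp_weight_integrable)
    fix n
    have "(\<lambda>t. exp (- t) * h t) integrable_on {0..real n}"
      by (intro integrable_continuous_interval continuous_intros bdd_cont_continuous_on[OF h]) auto
    then show "(\<lambda>t. if t \<in> {0..real n} then exp (- t) * h t else 0) integrable_on {0..}"
      by (subst integrable_restrict_Int) (simp add: Int_absorb2)
    show "norm (if t \<in> {0..real n} then exp (- t) * h t else 0) \<le> C * exp (- t)" if "t \<in> {0..}" for t
    proof -
      have "\<bar>h t\<bar> \<le> C" using h that by (simp add: bdd_cont_def)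
      then show ?thesis by (auto simp: abs_mult mult.commute)
    qed
  next
    fix t :: real assume "t \<in> {0..}"
    then have t: "0 \<le> t" by simp
    have "\<forall>\<^sub>F n in sequentially. (if t \<in> {0..real n} then exp (- t) * h t else 0) = exp (- t) * h t"
    proof (rule eventually_sequentiallyI)
      fix n assume "nat \<lceil>t\<rceil> \<le> n"
      then have "t \<le> real n" by linarith
      then show "(if t \<in> {0..real n} then exp (- t) * h t else 0) = exp (- t) * h t" using t by simp
    qed
    then show "(\<lambda>n. if t \<in> {0..real n} then exp (- t) * h t else 0) \<longlonglongrightarrow> exp (- t) * h t"
      by (rule tendsto_eventually)
  qed
  moreover have "{0..real n} \<inter> {0..} = {0..real n}" for n by auto
  ultimately show ?thesis
    by (simp only: Henstock_Kurzweil_Integration.integral_restrict_Int)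
qed

lemma exp_minus_nat_tendsto: "(\<lambda>n. exp (- real n)) \<longlonglongrightarrow> 0"
  by (rule filterlim_compose[OF exp_at_bot])
     (simp add: filterlim_uminus_at_top[symmetric] filterlim_real_sequentially)

text \<open>
  Integration by parts on \<open>[0, N]\<close>; the boundary term at \<open>N\<close> vanishes in the limit.
\<close>

lemma laplace1_deriv:
  assumes h: "bdd_cont C h" and h': "bdd_cont D h'"
    and deriv: "\<And>t. 0 \<le> t \<Longrightarrow> (h has_real_derivative h' t) (at t)"
  shows "laplace1 h' = laplace1 h - h 0"
proof -
  have eq: "integral {0..real n} (\<lambda>t. exp (- t) * h' t)
      = integral {0..real n} (\<lambda>t. exp (- t) * h t) + (exp (- real n) * h (real n) - h 0)" for n
  proof -
    have c: "continuous_on {0..real n} h" "continuous_on {0..real n} h'"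
      by (auto intro!: bdd_cont_continuous_on[OF h] bdd_cont_continuous_on[OF h'])
    have i: "(\<lambda>t. exp (- t) * h t) integrable_on {0..real n}" "(\<lambda>t. exp (- t) * h' t) integrable_on {0..real n}"
      using c by (auto intro!: integrable_continuous_interval continuous_intros)
    have "((\<lambda>t. exp (- t) * h' t - exp (- t) * h t) has_integral exp (- real n) * h (real n) - exp (- 0) * h 0) {0..real n}"
    proof (rule fundamental_theorem_of_calculus)
      fix t assume t: "t \<in> {0..real n}"
      have "((\<lambda>t. exp (- t) * h t) has_real_derivative exp (- t) * h' t - exp (- t) * h t) (at t)"
        using t by (auto intro!: derivative_eq_intros deriv simp: algebra_simps)
      then show "((\<lambda>t. exp (- t) * h t) has_vector_derivative exp (- t) * h' t - exp (- t) * h t) (at t within {0..real n})"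
        by (simp add: has_real_derivative_iff_has_vector_derivative has_vector_derivative_at_within)
    qed simp
    from integral_unique[OF this] show ?thesis unfolding integral_diff[OF i(2,1)] by simp
  qed
  have "(\<lambda>n. exp (- real n) * h (real n)) \<longlonglongrightarrow> 0"
  proof (rule Lim_null_comparison)
    show "(\<lambda>n. C * exp (- real n)) \<longlonglongrightarrow> 0" using tendsto_mult_right_zero[OF exp_minus_nat_tendsto] .
    show "\<forall>\<^sub>F n in sequentially. norm (exp (- real n) * h (real n)) \<le> C * exp (- real n)"
      using h by (auto simp: bdd_cont_def abs_mult mult.commute)
  qed
  then have "(\<lambda>n. integral {0..real n} (\<lambda>t. exp (- t) * h' t)) \<longlonglongrightarrow> laplace1 h + (0 - h 0)"
    unfolding eq by (intro tendsto_intros laplace1_truncate[OF h])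
  with laplace1_truncate[OF h'] have "laplace1 h' = laplace1 h + (0 - h 0)" by (rule LIMSEQ_unique)
  then show ?thesis by simp
qed

lemma bdd_cont_shift: "bdd_cont C h \<Longrightarrow> 0 \<le> t \<Longrightarrow> bdd_cont C (\<lambda>s. h (s + t))"
  unfolding bdd_cont_def by (auto intro!: continuous_on_compose2[of "{0..}" h] continuous_intros)

text \<open>
  This yields the orbit of a resolvent under the semigroup: evolving a Laplace transform by time
  \<open>t\<close> means shifting the integrand.
\<close>

lemma laplace1_shift:
  assumes h: "bdd_cont C h" and t: "0 \<le> t"
  shows "laplace1 (\<lambda>s. h (s + t)) = exp t * (laplace1 h - integral {0..t} (\<lambda>s. exp (- s) * h s))"
proof -
  let ?f = "\<lambda>s. exp (- s) * h s"
  let ?G = "\<lambda>S. integral {0..S} ?f"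
  have int: "?f integrable_on {0..S}" for S
    by (intro integrable_continuous_interval continuous_intros bdd_cont_continuous_on[OF h]) auto
  have eq: "integral {0..real n} (\<lambda>s. exp (- s) * h (s + t)) = exp t * (?G (real n + t) - ?G t)" for n
  proof -
    have "integral {0..real n} (\<lambda>s. exp (- s) * h (s + t)) = integral {0..real n} (\<lambda>s. exp t * ?f (s + t))"
      by (rule integral_cong) (simp add: exp_add[symmetric] mult.assoc[symmetric])
    also have "\<dots> = exp t * integral {0..real n} (\<lambda>s. ?f (s + t))" by simp
    also have "integral {0..real n} (\<lambda>s. ?f (s + t)) = integral {t..real n + t} ?f"
      using integral_shift_real_ivl[of t t "real n + t" ?f] by simp
    also have "\<dots> = ?G (real n + t) - ?G t"
      using Henstock_Kurzweil_Integration.integral_combine[of 0 t "real n + t" ?f] t int by simp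
    finally show ?thesis .
  qed
  have "(\<lambda>n. ?G (real n + t) - ?G (real n)) \<longlonglongrightarrow> 0"
  proof (rule Lim_null_comparison)
    show "(\<lambda>n. (C * t) * exp (- real n)) \<longlonglongrightarrow> 0" by (rule tendsto_mult_right_zero[OF exp_minus_nat_tendsto])
    show "\<forall>\<^sub>F n in sequentially. norm (?G (real n + t) - ?G (real n)) \<le> (C * t) * exp (- real n)"
    proof (rule always_eventually, rule allI)
      fix n
      have "?G (real n + t) - ?G (real n) = integral {real n..real n + t} ?f"
        using Henstock_Kurzweil_Integration.integral_combine[of 0 "real n" "real n + t" ?f] t int by simp
      also have "norm \<dots> \<le> (C * exp (- real n)) * (real n + t - real n)"
      proof (rule integral_bound)
        show "continuous_on {real n..real n + t} ?f"
          by (intro continuous_intros bdd_cont_continuous_on[OF h]) auto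
        show "norm (?f s) \<le> C * exp (- real n)" if "s \<in> {real n..real n + t}" for s
        proof -
          have "0 \<le> s" using that by simp
          then have hs: "\<bar>h s\<bar> \<le> C" using h by (simp add: bdd_cont_def)
          have "exp (- s) * \<bar>h s\<bar> \<le> exp (- real n) * C"
            using that hs by (intro mult_mono) auto
          then show ?thesis by (simp add: abs_mult mult.commute)
        qed
      qed (use t in auto)
      finally show "norm (?G (real n + t) - ?G (real n)) \<le> (C * t) * exp (- real n)" by (simp add: mult_ac)
    qed
  qed
  from tendsto_add[OF this laplace1_truncate[OF h]]
  have "(\<lambda>n. ?G (real n + t)) \<longlonglongrightarrow> laplace1 h" by simp
  then have "(\<lambda>n. integral {0..real n} (\<lambda>s. exp (- s) * h (s + t))) \<longlonglongrightarrow> exp t * (laplace1 h - ?G t)"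
    unfolding eq by (intro tendsto_intros)
  from LIMSEQ_unique[OF laplace1_truncate[OF bdd_cont_shift[OF h t]] this] show ?thesis .
qed

section \<open>The minimal heat semigroup\<close>

context lf_graph
begin

abbreviation sqs :: "('a \<Rightarrow> real) \<Rightarrow> bool" where "sqs \<equiv> sq_summable X m"
abbreviation nrm :: "('a \<Rightarrow> real) \<Rightarrow> real" where "nrm \<equiv> l2_norm X m"
abbreviation ip :: "('a \<Rightarrow> real) \<Rightarrow> ('a \<Rightarrow> real) \<Rightarrow> real" where "ip \<equiv> l2_inner X m"

lemmas l2_iff = l2.l2_mem_iff

text \<open>
  An exhaustion by finite sets, from an enumeration of the vertices.
\<close>

definition Kn :: "nat \<Rightarrow> 'a set" where "Kn n = {x \<in> X. to_nat_on X x < n}"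

lemma Kn_subset: "Kn n \<subseteq> X" by (auto simp: Kn_def)

lemma Kn_finite: "finite (Kn n)"
proof (rule inj_on_finite)
  show "inj_on (to_nat_on X) (Kn n)"
    using inj_on_to_nat_on[OF countable_X] Kn_subset by (rule inj_on_subset)
  show "to_nat_on X ` Kn n \<subseteq> {..<n}" by (auto simp: Kn_def)
qed simp

lemma Kn_mono: "n \<le> k \<Longrightarrow> Kn n \<subseteq> Kn k" by (auto simp: Kn_def)

lemma Kn_exhaust:
  assumes "finite F" "F \<subseteq> X"
  obtains n where "\<And>k. n \<le> k \<Longrightarrow> F \<subseteq> Kn k"
proof
  fix k assume k: "Suc (\<Sum>x\<in>F. to_nat_on X x) \<le> k"
  show "F \<subseteq> Kn k"
  proof
    fix x assume x: "x \<in> F"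
    then have "to_nat_on X x \<le> (\<Sum>x\<in>F. to_nat_on X x)" using assms by (intro member_le_sum) auto
    then show "x \<in> Kn k" using x k assms by (auto simp: Kn_def)
  qed
qed

lemmas KnK = Kn_finite Kn_subset

lemma heatK_sum:
  assumes K: "finite K" "K \<subseteq> X" and t: "0 \<le> t" and F: "finite F"
  shows "heatK K (\<lambda>x. \<Sum>y\<in>F. c y * g y x) t x = (\<Sum>y\<in>F. c y * heatK K (g y) t x)"
  using F
proof induction
  case empty
  then show ?case using heatK_lincomb[OF K t, of 0 "\<lambda>_. 0" 0 "\<lambda>_. 0" x] by simp
next
  case (insert z F)
  then show ?case
    using heatK_lincomb[OF K t, of "c z" "g z" 1 "\<lambda>x. \<Sum>y\<in>F. c y * g y x" x] by simp
qed

text \<open>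
  For finite \<open>K\<close> the flow is given by a finite kernel. Hence it commutes with pointwise limits
  and with Laplace transforms.
\<close>

lemma heatK_kernel:
  assumes K: "finite K" "K \<subseteq> X" and t: "0 \<le> t"
  shows "heatK K f t x = (\<Sum>y\<in>K. f y * heatK K (\<lambda>z. if z = y then 1 else 0) t x)"
proof -
  have "heatK K f t x = heatK K (\<lambda>z. \<Sum>y\<in>K. f y * (if z = y then 1 else 0)) t x"
    using K by (intro heatK_cong[OF K _ t]) (simp add: if_distrib[of "\<lambda>a. _ * a"] cong: if_cong)
  then show ?thesis using heatK_sum[OF K t K(1)] by simp
qed

lemma heatK_tendsto:
  assumes K: "finite K" "K \<subseteq> X" and t: "0 \<le> t" and lim: "\<And>y. y \<in> K \<Longrightarrow> (\<lambda>k. g k y) \<longlonglongrightarrow> f y"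
  shows "(\<lambda>k. heatK K (g k) t x) \<longlonglongrightarrow> heatK K f t x"
  unfolding heatK_kernel[OF K t, of "g _"] heatK_kernel[OF K t, of f]
  by (intro tendsto_intros lim)

lemma finite_support_sqs:
  "finite K \<Longrightarrow> (\<And>x. x \<in> X - K \<Longrightarrow> f x = 0) \<Longrightarrow> sqs f"
  by (rule l2.sq_summable_finite_support) (rule finite_subset[of _ K]; auto)

lemma heatK_sqs: "finite K \<Longrightarrow> K \<subseteq> X \<Longrightarrow> sqs (heatK K f t)"
  by (rule finite_support_sqs[of K]) (auto simp: heatK_outside)

lemma heatK_nrm_le:
  assumes K: "finite K" "K \<subseteq> X" and f: "sqs f" and t: "0 \<le> t"
  shows "nrm (heatK K f t) \<le> nrm f"
proof -
  have "ip (heatK K f t) (heatK K f t) = (\<Sum>x\<in>K. m x * (heatK K f t x)\<^sup>2)"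
    using K by (subst l2.inner_finite_support[of K]) (auto simp: heatK_outside power2_eq_square mult.assoc)
  also have "\<dots> \<le> (\<Sum>x\<in>K. m x * (f x)\<^sup>2)" by (rule heatK_contraction[OF K t])
  also have "\<dots> \<le> ip f f" using l2.finite_sum_le_inner[OF f K] .
  finally show ?thesis unfolding l2_norm_def by simp
qed

lemma heatK_bound:
  assumes K: "finite K" "K \<subseteq> X" and f: "sqs f" and t: "0 \<le> t" and x: "x \<in> X"
  shows "\<bar>heatK K f t x\<bar> \<le> nrm f / sqrt (m x)"
  using l2.pointwise_le_norm[OF heatK_sqs[OF K] x m_pos[OF x], of f t] heatK_nrm_le[OF K f t] m_pos[OF x]
  by (meson divide_right_mono order_trans less_imp_le real_sqrt_ge_zero)

text \<open>
  Along the exhaustion the flows increase for nonnegative \<open>f\<close> and are bounded by the norm of \<open>f\<close>,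
  so the limit exists; for general square summable \<open>f\<close> one splits into positive and negative part.
\<close>

definition heat :: "real \<Rightarrow> ('a \<Rightarrow> real) \<Rightarrow> 'a \<Rightarrow> real" where
  "heat t f x = lim (\<lambda>n. heatK (Kn n) f t x)"

lemma heat_outside: "x \<notin> X \<Longrightarrow> heat t f x = 0"
proof -
  assume "x \<notin> X"
  then have "x \<notin> Kn n" for n using Kn_subset by auto
  then show ?thesis unfolding heat_def by (simp add: heatK_outside[OF KnK] limI[OF tendsto_const])
qed

lemma heatK_Kn_incseq:
  assumes "\<And>x. x \<in> X \<Longrightarrow> 0 \<le> f x" "0 \<le> t"
  shows "incseq (\<lambda>n. heatK (Kn n) f t x)"
proof (rule incseq_SucI)
  fix n
  show "heatK (Kn n) f t x \<le> heatK (Kn (Suc n)) f t x"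
    using assms Kn_subset[of "Suc n"] by (intro heatK_mono_set KnK Kn_mono) auto
qed

lemma heatK_Kn_convergent_nonneg:
  assumes f: "sqs f" "\<And>x. x \<in> X \<Longrightarrow> 0 \<le> f x" and t: "0 \<le> t"
  shows "convergent (\<lambda>n. heatK (Kn n) f t x)"
proof (cases "x \<in> X")
  case True
  have "heatK (Kn n) f t x \<le> nrm f / sqrt (m x)" for n
    using heatK_bound[OF KnK f(1) t True, of n] by simp
  then have "\<forall>n. heatK (Kn n) f t x \<le> nrm f / sqrt (m x)" by simp
  from incseq_convergent[OF heatK_Kn_incseq[OF f(2) t] this] show ?thesis
    by (auto intro: convergentI)
next
  case False
  then have "x \<notin> Kn n" for n using Kn_subset by auto
  then show ?thesis by (simp add: heatK_outside[OF KnK] convergent_const)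
qed

lemma positive_part_sqs: "sqs f \<Longrightarrow> sqs (\<lambda>x. max (f x) 0)"
  by (erule l2.sq_summable_dominated) auto

lemma negative_part_sqs: "sqs f \<Longrightarrow> sqs (\<lambda>x. max (- f x) 0)"
  by (erule l2.sq_summable_dominated) auto

lemma heat_lim:
  assumes f: "sqs f" and t: "0 \<le> t"
  shows "(\<lambda>n. heatK (Kn n) f t x) \<longlonglongrightarrow> heat t f x"
proof -
  have "heatK (Kn n) f t x
      = 1 * heatK (Kn n) (\<lambda>x. max (f x) 0) t x + (-1) * heatK (Kn n) (\<lambda>x. max (- f x) 0) t x" for n
    unfolding heatK_lincomb[OF KnK t, symmetric] by (intro heatK_cong[OF KnK _ t]) auto
  moreover have "convergent (\<lambda>n. heatK (Kn n) (\<lambda>x. max (f x) 0) t x)"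
    "convergent (\<lambda>n. heatK (Kn n) (\<lambda>x. max (- f x) 0) t x)"
    using positive_part_sqs[OF f] negative_part_sqs[OF f] by (auto intro!: heatK_Kn_convergent_nonneg t)
  ultimately have "convergent (\<lambda>n. heatK (Kn n) f t x)"
    by (auto intro: convergent_diff)
  then show ?thesis unfolding heat_def by (rule convergent_LIMSEQ_iff[THEN iffD1])
qed

lemma heat_sqs: "sqs f \<Longrightarrow> 0 \<le> t \<Longrightarrow> sqs (heat t f)"
  and heat_nrm_le: "sqs f \<Longrightarrow> 0 \<le> t \<Longrightarrow> nrm (heat t f) \<le> nrm f"
  using l2.Fatou[of "\<lambda>n. heatK (Kn n) f t" "heat t f" "nrm f"]
  by (auto intro!: heat_lim heatK_sqs KnK heatK_nrm_le always_eventually)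

lemma heat_bound:
  assumes "sqs f" "0 \<le> t" "x \<in> X"
  shows "\<bar>heat t f x\<bar> \<le> nrm f / sqrt (m x)"
  using tendsto_rabs[OF heat_lim[OF assms(1,2), of x]] heatK_bound[OF KnK assms]
  by (intro tendsto_upperbound[OF _ always_eventually]) auto

lemma heat_lincomb:
  assumes "sqs f" "sqs g" "0 \<le> t"
  shows "heat t (\<lambda>x. \<alpha> * f x + \<beta> * g x) x = \<alpha> * heat t f x + \<beta> * heat t g x"
proof -
  have "(\<lambda>n. heatK (Kn n) (\<lambda>x. \<alpha> * f x + \<beta> * g x) t x) \<longlonglongrightarrow> \<alpha> * heat t f x + \<beta> * heat t g x"
    unfolding heatK_lincomb[OF KnK assms(3)] by (intro tendsto_intros heat_lim assms)
  from LIMSEQ_unique[OF heat_lim this] assms show ?thesis by (auto intro: l2.sq_summable_lincomb)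
qed

lemma heat_diff:
  assumes "sqs f" "sqs g" "0 \<le> t"
  shows "heat t (\<lambda>x. f x - g x) x = heat t f x - heat t g x"
  using heat_lincomb[OF assms, of 1 "-1" x] by simp

lemma heat_mono:
  assumes "sqs f" "sqs g" "\<And>x. x \<in> X \<Longrightarrow> f x \<le> g x" "0 \<le> t"
  shows "heat t f x \<le> heat t g x"
  using assms Kn_subset
  by (intro LIMSEQ_le[OF heat_lim heat_lim]) (auto intro!: exI[of _ 0] heatK_mono[OF KnK])

lemma heat_cong:
  assumes "sqs f" "sqs g" "\<And>x. x \<in> X \<Longrightarrow> f x = g x" "0 \<le> t"
  shows "heat t f x = heat t g x"
  using assms by (intro antisym heat_mono) auto

lemma heatK_le_heat:
  assumes "sqs f" "\<And>x. x \<in> X \<Longrightarrow> 0 \<le> f x" "0 \<le> t"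
  shows "heatK (Kn n) f t x \<le> heat t f x"
  by (rule incseq_le[OF heatK_Kn_incseq heat_lim]) (use assms in auto)

lemma heat_nonneg:
  assumes "sqs f" "\<And>x. x \<in> X \<Longrightarrow> 0 \<le> f x" "0 \<le> t"
  shows "0 \<le> heat t f x"
  using heatK_le_heat[OF assms, of 0 x] heatK_nonneg[OF KnK, of 0 f t x] assms Kn_subset by force

lemma heat_le_1:
  assumes "sqs f" "\<And>x. x \<in> X \<Longrightarrow> f x \<le> 1" "0 \<le> t"
  shows "heat t f x \<le> 1"
  using heatK_le_1[OF KnK] assms Kn_subset
  by (intro tendsto_upperbound[OF heat_lim always_eventually]) (auto, meson subsetD)

lemma heat_0: "sqs f \<Longrightarrow> x \<in> X \<Longrightarrow> heat 0 f x = f x"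
proof -
  assume f: "sqs f" and x: "x \<in> X"
  obtain n where n: "\<And>k. n \<le> k \<Longrightarrow> {x} \<subseteq> Kn k" using Kn_exhaust[of "{x}"] x by auto
  have "(\<lambda>n. heatK (Kn n) f 0 x) \<longlonglongrightarrow> f x"
    using n by (intro tendsto_eventually eventually_sequentiallyI[of n]) (simp add: heatK_0[OF KnK])
  with heat_lim[OF f order.refl] show ?thesis by (rule LIMSEQ_unique)
qed

text \<open>
  Both inequalities follow from monotonicity in the set: the limits in the two time steps may be
  taken along different members of the exhaustion.
\<close>

lemma heat_semigroup_nonneg:
  assumes f: "sqs f" "\<And>x. x \<in> X \<Longrightarrow> 0 \<le> f x" and s: "0 \<le> s" and t: "0 \<le> t"
  shows "heat (s + t) f x = heat s (heat t f) x"
proof (rule antisym)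
  have st: "0 \<le> s + t" using s t by simp
  note g = heat_sqs[OF f(1) t]
  show "heat (s + t) f x \<le> heat s (heat t f) x"
  proof (rule LIMSEQ_le[OF heat_lim[OF f(1) st] heat_lim[OF g s]])
    have "heatK (Kn n) f (s + t) x \<le> heatK (Kn n) (heat t f) s x" for n
      unfolding heatK_semigroup[OF KnK s t] by (intro heatK_mono[OF KnK _ s] heatK_le_heat f t)
    then show "\<exists>N. \<forall>n\<ge>N. heatK (Kn n) f (s + t) x \<le> heatK (Kn n) (heat t f) s x" by blast
  qed
  show "heat s (heat t f) x \<le> heat (s + t) f x"
  proof (rule LIMSEQ_le_const2[OF heat_lim[OF g s]], intro exI allI impI)
    fix n
    show "heatK (Kn n) (heat t f) s x \<le> heat (s + t) f x"
    proof (rule LIMSEQ_le_const2[OF heatK_tendsto[OF KnK s]], rule heat_lim[OF f(1) t], intro exI allI impI)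
      fix k assume k: "n \<le> k"
      have "heatK (Kn n) (heatK (Kn k) f t) s x \<le> heatK (Kn k) (heatK (Kn k) f t) s x"
        using f t Kn_subset by (intro heatK_mono_set KnK Kn_mono k s heatK_nonneg[OF KnK]) auto
      also have "\<dots> = heatK (Kn k) f (s + t) x" by (rule heatK_semigroup[OF KnK s t, symmetric])
      also have "\<dots> \<le> heat (s + t) f x" by (rule heatK_le_heat[OF f st])
      finally show "heatK (Kn n) (heatK (Kn k) f t) s x \<le> heat (s + t) f x" .
    qed
  qed
qed

lemma heat_parts:
  assumes f: "sqs f" and t: "0 \<le> t"
  shows "heat t f x = heat t (\<lambda>x. max (f x) 0) x - heat t (\<lambda>x. max (- f x) 0) x"
proof -
  have "heat t f x = heat t (\<lambda>x. max (f x) 0 - max (- f x) 0) x"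
    using f by (intro heat_cong l2.sq_summable_diff positive_part_sqs negative_part_sqs t) auto
  then show ?thesis using heat_diff[OF positive_part_sqs[OF f] negative_part_sqs[OF f] t] by simp
qed

lemma heat_semigroup:
  assumes f: "sqs f" and s: "0 \<le> s" and t: "0 \<le> t"
  shows "heat (s + t) f x = heat s (heat t f) x"
proof -
  let ?p = "\<lambda>x. max (f x) 0" and ?q = "\<lambda>x. max (- f x) 0"
  note p = positive_part_sqs[OF f] and q = negative_part_sqs[OF f]
  have st: "0 \<le> s + t" using s t by simp
  have "heat (s + t) f x = heat s (heat t ?p) x - heat s (heat t ?q) x"
    using heat_parts[OF f st] heat_semigroup_nonneg[OF p _ s t] heat_semigroup_nonneg[OF q _ s t] by simp
  also have "\<dots> = heat s (\<lambda>x. heat t ?p x - heat t ?q x) x"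
    by (rule heat_diff[symmetric]) (intro heat_sqs p q s t)+
  also have "(\<lambda>x. heat t ?p x - heat t ?q x) = heat t f"
    using heat_parts[OF f t] by auto
  finally show ?thesis .
qed

text \<open>
  By contractivity, the square of the norm of \<open>heat t f - f\<close> is at most twice the difference of
  the square norm of \<open>f\<close> and the inner product of \<open>heat t f\<close> with \<open>f\<close>. For nonnegative \<open>f\<close> that
  inner product is bounded below by finitely many terms of a finite flow, which is continuous in \<open>t\<close>.
\<close>

lemma heat_continuous_nonneg:
  assumes f: "sqs f" "\<And>x. x \<in> X \<Longrightarrow> 0 \<le> f x"
  shows "((\<lambda>t. nrm (\<lambda>x. heat t f x - f x)) \<longlongrightarrow> 0) (at_right 0)"
proof (rule tendstoI)
  fix e :: real assume e: "0 < e"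
  obtain F where F: "finite F" "F \<subseteq> X" "ip f f - e\<^sup>2 / 4 < (\<Sum>x\<in>F. m x * (f x)\<^sup>2)"
    using l2.inner_finite_approx[OF f(1), of "e\<^sup>2 / 4"] e by auto
  obtain n where "\<And>k. n \<le> k \<Longrightarrow> F \<subseteq> Kn k" using Kn_exhaust F by blast
  then have FK: "F \<subseteq> Kn n" by simp
  have "((\<lambda>t. \<Sum>x\<in>F. m x * heatK (Kn n) f t x * f x) \<longlongrightarrow> (\<Sum>x\<in>F. m x * heatK (Kn n) f 0 x * f x)) (at_right 0)"
  proof (intro tendsto_intros)
    fix x assume "x \<in> F"
    then have "x \<in> Kn n" using FK by auto
    from DERIV_isCont[OF heatK_deriv[OF KnK this order.refl, of f]]
    show "((\<lambda>t. heatK (Kn n) f t x) \<longlongrightarrow> heatK (Kn n) f 0 x) (at_right 0)"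
      by (simp add: isCont_def filterlim_at_split)
  qed
  also have "(\<Sum>x\<in>F. m x * heatK (Kn n) f 0 x * f x) = (\<Sum>x\<in>F. m x * (f x)\<^sup>2)"
    using FK by (intro sum.cong) (auto simp: heatK_0[OF KnK] power2_eq_square)
  finally have "\<forall>\<^sub>F t in at_right 0. ip f f - e\<^sup>2 / 4 < (\<Sum>x\<in>F. m x * heatK (Kn n) f t x * f x)"
    using F(3) by (rule order_tendstoD(1))
  moreover have "\<forall>\<^sub>F t in at_right (0::real). 0 < t" by (simp add: eventually_at_right_less)
  ultimately show "\<forall>\<^sub>F t in at_right 0. dist (nrm (\<lambda>x. heat t f x - f x)) 0 < e"
  proof eventually_elim
    case (elim t)
    then have t: "0 \<le> t" by simp
    note g = heat_sqs[OF f(1) t]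
    have "(\<Sum>x\<in>F. m x * heatK (Kn n) f t x * f x) \<le> (\<Sum>x\<in>F. m x * heat t f x * f x)"
      using F f m_pos t by (intro sum_mono mult_right_mono mult_left_mono heatK_le_heat) (auto intro: less_imp_le)
    also have "\<dots> \<le> ip (heat t f) f"
      unfolding l2_inner_def
      using F f t l2.product_summable[OF g f(1)] heat_nonneg[OF f t] l2.weight_nonneg
      by (intro finite_sum_le_infsum) (auto intro!: mult_nonneg_nonneg)
    finally have 1: "ip f f - e\<^sup>2 / 4 < ip (heat t f) f" using elim by simp
    have 2: "ip (heat t f) (heat t f) \<le> ip f f"
      using heat_nrm_le[OF f(1) t] unfolding l2_norm_def by simp
    have "(nrm (\<lambda>x. heat t f x - f x))\<^sup>2 = ip (heat t f) (heat t f) - 2 * ip (heat t f) f + ip f f"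
      using l2.inner_square_lincomb[OF g f(1), of 1 "-1"] by (simp add: l2.norm_square)
    also have "\<dots> < e\<^sup>2" using 1 2 zero_le_power2[of e] by linarith
    finally have "nrm (\<lambda>x. heat t f x - f x) < e" using e by (simp add: power_less_imp_less_base)
    then show ?case using l2.norm_nonneg[of "\<lambda>x. heat t f x - f x"] by simp
  qed
qed

lemma heat_continuous:
  assumes f: "sqs f"
  shows "((\<lambda>t. nrm (\<lambda>x. heat t f x - f x)) \<longlongrightarrow> 0) (at_right 0)"
proof -
  let ?p = "\<lambda>x. max (f x) 0" and ?q = "\<lambda>x. max (- f x) 0"
  note p = positive_part_sqs[OF f] and q = negative_part_sqs[OF f]
  show ?thesis
  proof (rule tendsto_sandwich[OF _ _ tendsto_const])
    show "((\<lambda>t. nrm (\<lambda>x. heat t ?p x - ?p x) + nrm (\<lambda>x. heat t ?q x - ?q x)) \<longlongrightarrow> 0) (at_right 0)"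
      using tendsto_add[OF heat_continuous_nonneg[OF p] heat_continuous_nonneg[OF q]] by simp
    show "\<forall>\<^sub>F t in at_right 0. 0 \<le> nrm (\<lambda>x. heat t f x - f x)" by (simp add: l2.norm_nonneg)
    have "\<forall>\<^sub>F t in at_right (0::real). 0 < t" by (simp add: eventually_at_right_less)
    then show "\<forall>\<^sub>F t in at_right 0. nrm (\<lambda>x. heat t f x - f x)
        \<le> nrm (\<lambda>x. heat t ?p x - ?p x) + nrm (\<lambda>x. heat t ?q x - ?q x)"
    proof eventually_elim
      case (elim t)
      then have t: "0 \<le> t" by simp
      have "(\<lambda>x. heat t f x - f x) = (\<lambda>x. (heat t ?p x - ?p x) - (heat t ?q x - ?q x))"
        using heat_parts[OF f t] by (auto simp: fun_eq_iff)
      then show ?case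
        using l2.norm_triangle_diff[OF l2.sq_summable_diff[OF heat_sqs[OF p t] p]
            l2.sq_summable_diff[OF heat_sqs[OF q t] q]] by simp
    qed
  qed
qed

lemma heat_C0_semigroup: "C0_semigroup X m heat"
  unfolding C0_semigroup_def
proof (intro conjI allI ballI impI)
  fix t :: real and f assume "0 \<le> t" "f \<in> l2 X m"
  then show "heat t f \<in> l2 X m" by (auto simp: l2_iff heat_outside intro: heat_sqs)
next
  fix t :: real and f g and \<alpha> \<beta> :: real assume "0 \<le> t" "f \<in> l2 X m" "g \<in> l2 X m"
  then show "heat t (\<lambda>x. \<alpha> * f x + \<beta> * g x) = (\<lambda>x. \<alpha> * heat t f x + \<beta> * heat t g x)"
    using heat_lincomb by (auto simp: l2_iff)
next
  fix t :: real assume "0 \<le> t"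
  then show "\<exists>C. \<forall>f\<in>l2 X m. nrm (heat t f) \<le> C * nrm f"
    by (intro exI[of _ 1]) (auto simp: l2_iff intro: heat_nrm_le)
next
  fix f assume f: "f \<in> l2 X m"
  show "heat 0 f = f"
  proof
    fix x show "heat 0 f x = f x" using f by (cases "x \<in> X") (auto simp: l2_iff heat_0 heat_outside)
  qed
next
  fix s t :: real and f assume "0 \<le> s" "0 \<le> t" "f \<in> l2 X m"
  then show "heat (s + t) f = heat s (heat t f)" using heat_semigroup by (auto simp: l2_iff)
next
  fix f assume "f \<in> l2 X m"
  then show "((\<lambda>t. nrm (\<lambda>x. heat t f x - f x)) \<longlongrightarrow> 0) (at_right 0)"
    using heat_continuous by (auto simp: l2_iff)
qed

section \<open>The form and the resolvent\<close>

text \<open>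
  The form norm is itself a weighted square sum: over ordered pairs of vertices, with weight
  \<open>b x y / 2\<close> and the differences of the function, and over the vertices, with weight \<open>m\<close>. All
  Hilbert space facts for the form thus come from those on weighted square summable functions.
\<close>

definition form_index :: "('a \<times> 'a + 'a) set" where "form_index = (X \<times> X) <+> X"

definition form_weight :: "'a \<times> 'a + 'a \<Rightarrow> real" where
  "form_weight = case_sum (\<lambda>(x, y). b x y / 2) m"

text \<open>
  The differences of \<open>f\<close> along pairs, together with the values of \<open>f\<close>.
\<close>

definition jet :: "('a \<Rightarrow> real) \<Rightarrow> 'a \<times> 'a + 'a \<Rightarrow> real" where
  "jet f = case_sum (\<lambda>(x, y). f x - f y) f"

sublocale frm: weighted_set form_index form_weight
  by unfold_locales (auto simp: form_index_def form_weight_def b_nonneg l2.weight_nonneg)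

text \<open>
  The form shifted by one, the inner product belonging to \<open>form_norm\<close>.
\<close>

definition E :: "('a \<Rightarrow> real) \<Rightarrow> ('a \<Rightarrow> real) \<Rightarrow> real" where
  "E f g = l2_inner form_index form_weight (jet f) (jet g)"

definition Enorm :: "('a \<Rightarrow> real) \<Rightarrow> real" where
  "Enorm f = l2_norm form_index form_weight (jet f)"

definition in_form :: "('a \<Rightarrow> real) \<Rightarrow> bool" where
  "in_form f \<longleftrightarrow> sq_summable form_index form_weight (jet f)"

lemma jet_lincomb: "jet (\<lambda>x. \<alpha> * f x + \<beta> * g x) = (\<lambda>i. \<alpha> * jet f i + \<beta> * jet g i)"
  by (auto simp: jet_def fun_eq_iff algebra_simps split: sum.split)

lemma jet_diff: "jet (\<lambda>x. f x - g x) = (\<lambda>i. jet f i - jet g i)"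
  using jet_lincomb[of 1 f "-1" g] by simp

lemma sum_over_form_index:
  fixes g :: "'a \<times> 'a + 'a \<Rightarrow> real"
  assumes "(\<lambda>(x, y). g (Inl (x, y))) summable_on X \<times> X" "(\<lambda>x. g (Inr x)) summable_on X"
  shows "g summable_on form_index"
    and "infsum g form_index = (\<Sum>\<^sub>\<infinity>(x, y)\<in>X \<times> X. g (Inl (x, y))) + (\<Sum>\<^sub>\<infinity>x\<in>X. g (Inr x))"
proof -
  have e: "form_index = Inl ` (X \<times> X) \<union> Inr ` X" by (auto simp: form_index_def)
  have 1: "g summable_on Inl ` (X \<times> X)"
    using assms(1) by (subst summable_on_reindex) (auto simp: comp_def case_prod_unfold)
  have 2: "g summable_on Inr ` X" using assms(2) by (subst summable_on_reindex) (auto simp: comp_def)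
  have 0: "Inl ` (X \<times> X) \<inter> Inr ` X = {}" by auto
  show "g summable_on form_index" unfolding e by (rule summable_on_union[OF 1 2])
  have "infsum g form_index = infsum g (Inl ` (X \<times> X)) + infsum g (Inr ` X)"
    unfolding e using 1 2 0 by (rule infsum_Un_disjoint)
  also have "infsum g (Inl ` (X \<times> X)) = (\<Sum>\<^sub>\<infinity>(x, y)\<in>X \<times> X. g (Inl (x, y)))"
    by (subst infsum_reindex) (auto simp: comp_def case_prod_unfold)
  also have "infsum g (Inr ` X) = (\<Sum>\<^sub>\<infinity>x\<in>X. g (Inr x))"
    by (subst infsum_reindex) (auto simp: comp_def)
  finally show "infsum g form_index = (\<Sum>\<^sub>\<infinity>(x, y)\<in>X \<times> X. g (Inl (x, y))) + (\<Sum>\<^sub>\<infinity>x\<in>X. g (Inr x))" .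
qed

lemma in_form_iff: "in_form f \<longleftrightarrow> finite_energy X b f \<and> sqs f"
proof
  let ?g = "\<lambda>i. form_weight i * (jet f i)\<^sup>2"
  have half: "(\<lambda>(x, y). ?g (Inl (x, y))) = (\<lambda>p. (1 / 2) * (case p of (x, y) \<Rightarrow> b x y * (f x - f y)\<^sup>2))"
    by (auto simp: form_weight_def jet_def)
  have r: "(\<lambda>x. ?g (Inr x)) = (\<lambda>x. m x * (f x)\<^sup>2)" by (simp add: form_weight_def jet_def)
  {
    assume "in_form f"
    then have s: "?g summable_on form_index" by (simp add: in_form_def sq_summable_def)
    have "?g summable_on Inl ` (X \<times> X)" "?g summable_on Inr ` X"
      using s by (auto intro!: summable_on_subset_banach[OF s] simp: form_index_def)
    then have "(\<lambda>(x, y). ?g (Inl (x, y))) summable_on X \<times> X" "(\<lambda>x. ?g (Inr x)) summable_on X"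
      by (auto simp: summable_on_reindex comp_def case_prod_unfold)
    then show "finite_energy X b f \<and> sqs f"
      unfolding half r
      using summable_on_cmult_right[of "\<lambda>p. (1 / 2) * (case p of (x, y) \<Rightarrow> b x y * (f x - f y)\<^sup>2)" "X \<times> X" 2]
      by (auto simp: finite_energy_def sq_summable_def)
  next
    assume "finite_energy X b f \<and> sqs f"
    then have 1: "(\<lambda>(x, y). b x y * (f x - f y)\<^sup>2) summable_on X \<times> X"
      and 2: "(\<lambda>x. ?g (Inr x)) summable_on X"
      unfolding r by (auto simp: finite_energy_def sq_summable_def)
    have "(\<lambda>(x, y). ?g (Inl (x, y))) summable_on X \<times> X"
      unfolding half by (rule summable_on_cmult_right[OF 1])
    with 2 show "in_form f" unfolding in_form_def sq_summable_def by (intro sum_over_form_index(1))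
  }
qed

lemma in_form_sqs: "in_form f \<Longrightarrow> sqs f" by (simp add: in_form_iff)

lemma E_eq:
  assumes f: "in_form f" and g: "in_form g"
  shows "E f g = energy X b f g + ip f g"
proof -
  let ?h = "\<lambda>i. form_weight i * jet f i * jet g i"
  have s: "?h summable_on form_index"
    using f g unfolding in_form_def by (rule frm.product_summable)
  have "?h summable_on Inl ` (X \<times> X)" "?h summable_on Inr ` X"
    using s by (auto intro!: summable_on_subset_banach[OF s] simp: form_index_def)
  then have "(\<lambda>(x, y). ?h (Inl (x, y))) summable_on X \<times> X" "(\<lambda>x. ?h (Inr x)) summable_on X"
    by (auto simp: summable_on_reindex comp_def case_prod_unfold)
  then have "E f g = (\<Sum>\<^sub>\<infinity>(x, y)\<in>X \<times> X. ?h (Inl (x, y))) + (\<Sum>\<^sub>\<infinity>x\<in>X. ?h (Inr x))"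
    unfolding E_def l2_inner_def by (rule sum_over_form_index(2))
  also have "(\<Sum>\<^sub>\<infinity>(x, y)\<in>X \<times> X. ?h (Inl (x, y)))
      = (\<Sum>\<^sub>\<infinity>p\<in>X \<times> X. (1 / 2) * (case p of (x, y) \<Rightarrow> b x y * (f x - f y) * (g x - g y)))"
    by (rule infsum_cong) (auto simp: form_weight_def jet_def)
  also have "\<dots> = energy X b f g" unfolding energy_def by (rule infsum_cmult_right')
  also have "(\<Sum>\<^sub>\<infinity>x\<in>X. ?h (Inr x)) = ip f g" by (simp add: l2_inner_def form_weight_def jet_def)
  finally show ?thesis .
qed

lemma energy_nonneg: "0 \<le> energy X b f f"
  unfolding energy_def
  by (intro mult_nonneg_nonneg infsum_nonneg) (auto simp: b_nonneg mult.assoc)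

lemma nrm_le_Enorm: "in_form f \<Longrightarrow> nrm f \<le> Enorm f"
  using E_eq[of f f] energy_nonneg[of f] by (simp add: Enorm_def E_def l2_norm_def)

lemma form_norm_eq: "in_form f \<Longrightarrow> form_norm X m b f = Enorm f"
  using E_eq[of f f] by (simp add: form_norm_def Enorm_def E_def l2_norm_def l2.inner_self_nonneg)

lemma in_form_diff: "in_form f \<Longrightarrow> in_form g \<Longrightarrow> in_form (\<lambda>x. f x - g x)"
  unfolding in_form_def jet_diff by (rule frm.sq_summable_diff)

lemma E_commute: "E f g = E g f" unfolding E_def by (rule frm.inner_commute)

lemma E_diff_left: "in_form f \<Longrightarrow> in_form g \<Longrightarrow> in_form h \<Longrightarrow> E (\<lambda>x. f x - g x) h = E f h - E g h"
  unfolding in_form_def E_def jet_diff by (rule frm.inner_diff_left)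

lemma E_Cauchy_Schwarz: "in_form f \<Longrightarrow> in_form g \<Longrightarrow> \<bar>E f g\<bar> \<le> Enorm f * Enorm g"
  unfolding in_form_def E_def Enorm_def by (rule frm.Cauchy_Schwarz)

lemma Enorm_nonneg: "0 \<le> Enorm f" unfolding Enorm_def by (rule frm.norm_nonneg)

lemma Enorm_square: "(Enorm f)\<^sup>2 = E f f" unfolding Enorm_def E_def by (rule frm.norm_square)

text \<open>
  Only edges within \<open>K\<close> and its neighbours are seen by functions supported in \<open>K\<close>.
\<close>

lemma finite_support_nbhd:
  assumes K: "finite K" "K \<subseteq> X"
  defines "N \<equiv> K \<union> (\<Union>x\<in>K. nbrs x)"
  shows "finite N" "N \<subseteq> X" "\<And>x y. x \<in> X \<Longrightarrow> y \<in> X \<Longrightarrow> (x, y) \<notin> N \<times> N \<Longrightarrow> (x \<in> K \<or> y \<in> K) \<Longrightarrow> b x y = 0"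
proof -
  show "finite N" "N \<subseteq> X" using K nbrs_finite nbrs_subset by (auto simp: N_def)
  fix x y assume xy: "x \<in> X" "y \<in> X" "(x, y) \<notin> N \<times> N" "x \<in> K \<or> y \<in> K"
  then show "b x y = 0"
  proof (cases "x \<in> K")
    case True
    then have "y \<notin> nbrs x" using xy by (auto simp: N_def)
    then show ?thesis using xy not_nbr by blast
  next
    case False
    then have "x \<notin> nbrs y" using xy by (auto simp: N_def)
    then show ?thesis using xy not_nbr b_sym by metis
  qed
qed

lemma C\<^sub>c_in_form:
  assumes "f \<in> C\<^sub>c X"
  shows "in_form f"
proof -
  define K where "K = {x \<in> X. f x \<noteq> 0}"
  define N where "N = K \<union> (\<Union>x\<in>K. nbrs x)"
  have K: "finite K" "K \<subseteq> X" using assms by (auto simp: C\<^sub>c_def K_def)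
  note N = finite_support_nbhd[OF K, folded N_def]
  have "(\<lambda>(x, y). b x y * (f x - f y)\<^sup>2) summable_on N \<times> N" using N(1) by (intro summable_on_finite) auto
  moreover have "(\<lambda>(x, y). b x y * (f x - f y)\<^sup>2) summable_on N \<times> N
      \<longleftrightarrow> (\<lambda>(x, y). b x y * (f x - f y)\<^sup>2) summable_on X \<times> X"
  proof (rule summable_on_cong_neutral)
    fix p assume p: "p \<in> X \<times> X - N \<times> N"
    obtain x y where xy: "p = (x, y)" by (cases p)
    have "b x y = 0 \<or> f x = f y" using p xy N(3)[of x y] by (auto simp: K_def)
    then show "(case p of (x, y) \<Rightarrow> b x y * (f x - f y)\<^sup>2) = 0" using xy by auto
  qed (use N(2) in auto)
  moreover have "sqs f" by (rule finite_support_sqs[OF K(1)]) (auto simp: K_def)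
  ultimately show ?thesis by (simp add: in_form_iff finite_energy_def)
qed

lemma Green_formula:
  assumes K: "finite K" "K \<subseteq> X" and u: "\<And>x. x \<in> X - K \<Longrightarrow> u x = 0" and h: "\<And>x. x \<in> X - K \<Longrightarrow> h x = 0"
  shows "energy X b u h = (\<Sum>x\<in>K. m x * dirL K u x * h x)"
proof -
  define N where "N = K \<union> (\<Union>x\<in>K. nbrs x)"
  note N = finite_support_nbhd[OF K, folded N_def]
  have "(\<Sum>\<^sub>\<infinity>(x, y)\<in>X \<times> X. b x y * (u x - u y) * (h x - h y))
      = (\<Sum>\<^sub>\<infinity>(x, y)\<in>N \<times> N. b x y * (u x - u y) * (h x - h y))"
  proof (rule infsum_cong_neutral)
    fix p assume p: "p \<in> X \<times> X - N \<times> N"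
    obtain x y where xy: "p = (x, y)" by (cases p)
    have "b x y = 0 \<or> h x = h y"
    proof (cases "x \<in> K \<or> y \<in> K")
      case True
      then show ?thesis using p xy N(3)[of x y] by auto
    next
      case False
      then show ?thesis using p xy h[of x] h[of y] by auto
    qed
    then show "(case p of (x, y) \<Rightarrow> b x y * (u x - u y) * (h x - h y)) = 0" using xy by auto
  qed (use N(2) in auto)
  also have "\<dots> = (\<Sum>x\<in>N. \<Sum>y\<in>N. b x y * (u x - u y) * (h x - h y))"
    using N(1) by (simp add: sum.cartesian_product)
  also have "\<dots> = (\<Sum>x\<in>N. \<Sum>y\<in>N. b x y * (u x - u y) * h x) + (\<Sum>x\<in>N. \<Sum>y\<in>N. b x y * (u y - u x) * h y)"
    by (simp add: sum.distrib[symmetric] algebra_simps)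
  also have "(\<Sum>x\<in>N. \<Sum>y\<in>N. b x y * (u y - u x) * h y) = (\<Sum>y\<in>N. \<Sum>x\<in>N. b x y * (u y - u x) * h y)"
    by (rule sum.swap)
  also have "\<dots> = (\<Sum>x\<in>N. \<Sum>y\<in>N. b x y * (u x - u y) * h x)"
    using N(2) b_sym by (intro sum.cong refl) (metis subsetD)
  finally have "energy X b u h = (\<Sum>x\<in>N. \<Sum>y\<in>N. b x y * (u x - u y) * h x)"
    unfolding energy_def by simp
  also have "\<dots> = (\<Sum>x\<in>K. \<Sum>y\<in>N. b x y * (u x - u y) * h x)"
    using N h by (intro sum.mono_neutral_right) (auto simp: N_def)
  also have "\<dots> = (\<Sum>x\<in>K. m x * dirL K u x * h x)"
  proof (rule sum.cong)
    fix x assume x: "x \<in> K"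
    then have xX: "x \<in> X" and nb: "nbrs x \<subseteq> N" using K by (auto simp: N_def)
    have "(\<Sum>y\<in>N. b x y * (u x - u y) * h x) = (u x * (\<Sum>y\<in>N. b x y * 1) - (\<Sum>y\<in>N. b x y * u y)) * h x"
      by (simp add: sum_subtractf algebra_simps sum_distrib_left sum_distrib_right)
    also have "(\<Sum>y\<in>N. b x y * 1) = deg x" using sum_nbrs[OF xX N(1,2) nb, of "\<lambda>_. 1"] by (simp add: deg_def)
    also have "(\<Sum>y\<in>N. b x y * u y) = (\<Sum>y\<in>K. b x y * u y)"
      using N u by (intro sum.mono_neutral_right) (auto simp: N_def)
    also have "u x * deg x - (\<Sum>y\<in>K. b x y * u y) = m x * dirL K u x"
      using m_pos[OF xX] by (simp add: dirL_def mult.commute)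
    finally show "(\<Sum>y\<in>N. b x y * (u x - u y) * h x) = m x * dirL K u x * h x" .
  qed simp
  finally show ?thesis .
qed

lemma dirL_as_sum:
  assumes "finite K" "x \<in> K"
  shows "dirL K g x = (\<Sum>y\<in>K. ((if y = x then deg x else 0) - b x y) / m x * g y)"
proof -
  have "(\<Sum>y\<in>K. ((if y = x then deg x else 0) - b x y) / m x * g y)
      = (\<Sum>y\<in>K. (if y = x then deg x * g x else 0) - b x y * g y) / m x"
    unfolding sum_divide_distrib by (intro sum.cong refl) (auto simp: left_diff_distrib)
  also have "\<dots> = dirL K g x" using assms by (simp add: sum_subtractf dirL_def)
  finally show ?thesis by simp
qed

lemma heatK_bdd_cont:
  assumes K: "finite K" "K \<subseteq> X" and f: "sqs f" and x: "x \<in> X"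
  shows "bdd_cont (nrm f / sqrt (m x)) (\<lambda>t. heatK K f t x)"
  unfolding bdd_cont_def
proof (intro conjI allI impI)
  show "continuous_on {0..} (\<lambda>t. heatK K f t x)"
  proof (cases "x \<in> K")
    case True
    show ?thesis
      by (rule continuous_at_imp_continuous_on) (auto intro!: DERIV_isCont[OF heatK_deriv[OF K True]])
  qed (simp add: heatK_outside[OF K])
qed (use heatK_bound[OF K f _ x] in auto)

text \<open>
  By contractivity, the increment of an orbit over a time step \<open>r\<close> is controlled by the increment
  at time zero, uniformly in time.
\<close>

lemma heat_path_continuous:
  assumes f: "sqs f" and x: "x \<in> X"
  shows "continuous_on {0..} (\<lambda>t. heat t f x)"
  unfolding continuous_on_iff
proof (intro ballI allI impI)
  fix t :: real and e :: real assume t: "t \<in> {0..}" and e: "0 < e"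
  have mx: "0 < sqrt (m x)" using m_pos[OF x] by simp
  have "\<forall>\<^sub>F s in at_right 0. nrm (\<lambda>x. heat s f x - f x) < e * sqrt (m x)"
    using order_tendstoD(2)[OF heat_continuous[OF f]] e mx by simp
  then obtain \<delta> where \<delta>: "0 < \<delta>" "\<And>s. 0 < s \<Longrightarrow> s < \<delta> \<Longrightarrow> nrm (\<lambda>x. heat s f x - f x) < e * sqrt (m x)"
    by (auto simp: eventually_at_right_field)
  have key: "\<bar>heat (s + r) f x - heat s f x\<bar> < e" if "0 \<le> s" "0 < r" "r < \<delta>" for s r
  proof -
    have r: "0 \<le> r" using that by simp
    have g: "sqs (\<lambda>x. heat r f x - f x)" by (intro l2.sq_summable_diff heat_sqs f r)
    have "heat (s + r) f x - heat s f x = heat s (\<lambda>x. heat r f x - f x) x"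
      using heat_semigroup[OF f that(1) r] heat_diff[OF heat_sqs[OF f r] f that(1)] by simp
    also have "\<bar>\<dots>\<bar> \<le> nrm (\<lambda>x. heat r f x - f x) / sqrt (m x)" by (rule heat_bound[OF g that(1) x])
    also have "\<dots> < e" using \<delta>(2)[of r] that mx by (simp add: pos_divide_less_eq)
    finally show ?thesis .
  qed
  show "\<exists>d>0. \<forall>s\<in>{0..}. dist s t < d \<longrightarrow> dist (heat s f x) (heat t f x) < e"
  proof (intro exI conjI ballI impI)
    fix s :: real assume s: "s \<in> {0..}" "dist s t < \<delta>"
    consider "s = t" | "s < t" | "t < s" by linarith
    then show "dist (heat s f x) (heat t f x) < e"
    proof cases
      case 2 then show ?thesis using key[of s "t - s"] s by (simp add: dist_real_def)
    next
      case 3 then show ?thesis using key[of t "s - t"] s t by (simp add: dist_real_def)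
    qed (use e in simp)
  qed (rule \<delta>(1))
qed

lemma heat_bdd_cont:
  assumes f: "sqs f" and x: "x \<in> X"
  shows "bdd_cont (nrm f / sqrt (m x)) (\<lambda>t. heat t f x)"
  using heat_path_continuous[OF f x] heat_bound[OF f _ x] by (auto simp: bdd_cont_def)

definition resK :: "'a set \<Rightarrow> ('a \<Rightarrow> real) \<Rightarrow> 'a \<Rightarrow> real" where
  "resK K f x = laplace1 (\<lambda>t. heatK K f t x)"

text \<open>
  The Laplace transform of the semigroup at one, to be identified with \<open>(L + 1)\<^sup>-\<^sup>1\<close> for the
  operator \<open>L\<close> of the form.
\<close>

definition res :: "('a \<Rightarrow> real) \<Rightarrow> 'a \<Rightarrow> real" where
  "res f x = laplace1 (\<lambda>t. heat t f x)"

lemma resK_outside: "finite K \<Longrightarrow> K \<subseteq> X \<Longrightarrow> x \<notin> K \<Longrightarrow> resK K f x = 0"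
  by (simp add: resK_def heatK_outside laplace1_const)

lemma res_outside: "x \<notin> X \<Longrightarrow> res f x = 0"
  by (simp add: res_def heat_outside laplace1_const)

text \<open>
  The transform of the time derivative is the transform of the flow minus its initial value.
\<close>

lemma resK_equation:
  assumes K: "finite K" "K \<subseteq> X" and f: "sqs f" and x: "x \<in> K"
  shows "dirL K (resK K f) x + resK K f x = f x"
proof -
  have xX: "x \<in> X" using K x by auto
  define c where "c y = - (((if y = x then deg x else 0) - b x y) / m x)" for y
  have c: "(\<Sum>y\<in>K. c y * g y) = - dirL K g x" for g
    unfolding dirL_as_sum[OF K(1) x] c_def by (simp add: sum_negf)
  have "bdd_cont (nrm f / sqrt (m y)) (\<lambda>t. heatK K f t y)" if "y \<in> K" for y
    using heatK_bdd_cont[OF K f] that K by auto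
  from laplace1_sum[OF K(1) this, where c = c]
  have "laplace1 (\<lambda>t. - dirL K (heatK K f t) x) = - dirL K (resK K f) x"
    and "\<exists>D. bdd_cont D (\<lambda>t. - dirL K (heatK K f t) x)"
    unfolding c resK_def[symmetric] by simp_all
  then obtain D where D: "bdd_cont D (\<lambda>t. - dirL K (heatK K f t) x)"
    and l: "laplace1 (\<lambda>t. - dirL K (heatK K f t) x) = - dirL K (resK K f) x" by blast
  have "laplace1 (\<lambda>t. - dirL K (heatK K f t) x) = laplace1 (\<lambda>t. heatK K f t x) - heatK K f 0 x"
    by (rule laplace1_deriv[OF heatK_bdd_cont[OF K f xX] D heatK_deriv[OF K x]])
  then show ?thesis using l heatK_0[OF K x] by (simp add: resK_def)
qed

lemma resK_tendsto:
  assumes f: "sqs f"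
  shows "(\<lambda>n. resK (Kn n) f x) \<longlonglongrightarrow> res f x"
proof (cases "x \<in> X")
  case True
  show ?thesis unfolding resK_def res_def
    by (rule laplace1_dominated[OF heatK_bdd_cont[OF KnK f True] heat_lim[OF f]])
next
  case False
  then have "x \<notin> Kn n" for n using Kn_subset by auto
  then show ?thesis using False by (simp add: resK_outside[OF KnK] res_outside)
qed

lemma resK_C\<^sub>c: "finite K \<Longrightarrow> K \<subseteq> X \<Longrightarrow> resK K f \<in> C\<^sub>c X"
  using resK_outside[of K] by (auto simp: C\<^sub>c_def intro: finite_subset[of _ K] dest: subsetD)

lemma resK_in_form: "finite K \<Longrightarrow> K \<subseteq> X \<Longrightarrow> in_form (resK K f)"
  by (intro C\<^sub>c_in_form resK_C\<^sub>c)

text \<open>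
  So \<open>resK K f\<close> is the orthogonal projection, with respect to \<open>E\<close>, of the weak solution of
  \<open>(L + 1) u = f\<close> to the functions supported in \<open>K\<close>.
\<close>

lemma resK_Galerkin:
  assumes K: "finite K" "K \<subseteq> X" and f: "sqs f" and h: "h \<in> C\<^sub>c X" "\<And>x. x \<in> X - K \<Longrightarrow> h x = 0"
  shows "E (resK K f) h = ip f h"
proof -
  have "E (resK K f) h = (\<Sum>x\<in>K. m x * dirL K (resK K f) x * h x) + (\<Sum>x\<in>K. m x * resK K f x * h x)"
    unfolding E_eq[OF resK_in_form[OF K] C\<^sub>c_in_form[OF h(1)]]
    by (subst Green_formula[OF K _ h(2)])
       (use l2.inner_finite_support_right[OF K h(2)] in \<open>auto simp: resK_outside[OF K]\<close>)
  also have "\<dots> = (\<Sum>x\<in>K. m x * (dirL K (resK K f) x + resK K f x) * h x)"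
    by (simp add: sum.distrib[symmetric] algebra_simps)
  also have "\<dots> = (\<Sum>x\<in>K. m x * f x * h x)"
    using resK_equation[OF K f] by (intro sum.cong) auto
  also have "\<dots> = ip f h" by (rule l2.inner_finite_support_right[OF K h(2), symmetric])
  finally show ?thesis .
qed

lemma resK_Enorm_le:
  assumes K: "finite K" "K \<subseteq> X" and f: "sqs f"
  shows "Enorm (resK K f) \<le> nrm f"
proof -
  let ?u = "resK K f"
  have "(Enorm ?u)\<^sup>2 = ip f ?u"
    unfolding Enorm_square by (rule resK_Galerkin[OF K f resK_C\<^sub>c[OF K]]) (simp add: resK_outside[OF K])
  also have "\<dots> \<le> nrm f * nrm ?u"
    using l2.Cauchy_Schwarz[OF f in_form_sqs[OF resK_in_form[OF K]], of f] by linarith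
  also have "\<dots> \<le> nrm f * Enorm ?u"
    by (intro mult_left_mono nrm_le_Enorm resK_in_form K l2.norm_nonneg)
  finally have "Enorm ?u * Enorm ?u \<le> nrm f * Enorm ?u" by (simp add: power2_eq_square)
  then show ?thesis using Enorm_nonneg[of ?u] l2.norm_nonneg[of f]
    by (cases "Enorm ?u = 0") auto
qed

text \<open>
  Orthogonality of the projections gives that the square distance of two of them is the
  difference of their square norms. These increase and are bounded, so the projections form a
  Cauchy sequence in the form norm; its limit can only be the pointwise limit \<open>res f\<close>.
\<close>

lemma res_form_limit:
  assumes f: "sqs f"
  shows "in_form (res f)" and "(\<lambda>n. Enorm (\<lambda>x. res f x - resK (Kn n) f x)) \<longlonglongrightarrow> 0"
proof -
  let ?u = "\<lambda>n. resK (Kn n) f"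
  note u = resK_in_form[OF KnK]
  define e where "e n = E (?u n) (?u n)" for n
  \<comment> \<open>Pythagoras for nested projections.\<close>
  have eq: "(Enorm (\<lambda>x. ?u k x - ?u n x))\<^sup>2 = e k - e n" if "n \<le> k" for n k
  proof -
    have 1: "E (?u k) (?u n) = ip f (?u n)" "E (?u n) (?u n) = ip f (?u n)"
      using Kn_mono[OF that] by (auto intro!: resK_Galerkin[OF KnK f resK_C\<^sub>c[OF KnK]] resK_outside[OF KnK])
    let ?d = "\<lambda>x. ?u k x - ?u n x"
    have d: "in_form ?d" by (rule in_form_diff[OF u u])
    have "(Enorm ?d)\<^sup>2 = E (?u k) ?d - E (?u n) ?d"
      unfolding Enorm_square by (rule E_diff_left[OF u u d])
    also have "E (?u k) ?d = E (?u k) (?u k) - E (?u n) (?u k)"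
      by (subst E_commute) (rule E_diff_left[OF u u u])
    also have "E (?u n) (?u k) = E (?u k) (?u n)" by (rule E_commute)
    also have "E (?u n) ?d = E (?u k) (?u n) - E (?u n) (?u n)"
      by (subst E_commute) (rule E_diff_left[OF u u u])
    finally show ?thesis using 1 by (simp add: e_def)
  qed
  have inc: "incseq e"
  proof (rule incseq_SucI)
    fix n show "e n \<le> e (Suc n)"
      using eq[of n "Suc n"] zero_le_power2[of "Enorm (\<lambda>x. ?u (Suc n) x - ?u n x)"] by simp
  qed
  have "\<forall>n. e n \<le> (nrm f)\<^sup>2"
    using power_mono[OF resK_Enorm_le[OF KnK f] Enorm_nonneg, of _ 2] by (simp add: e_def Enorm_square)
  from incseq_convergent[OF inc this] obtain L where L: "e \<longlonglongrightarrow> L" "\<And>n. e n \<le> L"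
    by blast
  have F: "sq_summable form_index form_weight (jet (\<lambda>x. res f x - ?u n x)) \<and>
      l2_norm form_index form_weight (jet (\<lambda>x. res f x - ?u n x)) \<le> sqrt (L - e n)" for n
  proof (rule conjI)
    have s: "sq_summable form_index form_weight (jet (\<lambda>x. ?u k x - ?u n x))" for k
      using in_form_diff[OF u u] by (simp add: in_form_def)
    have l: "(\<lambda>k. jet (\<lambda>x. ?u k x - ?u n x) i) \<longlonglongrightarrow> jet (\<lambda>x. res f x - ?u n x) i" for i
      by (cases i) (auto simp: jet_def intro!: tendsto_intros resK_tendsto f)
    have "\<forall>\<^sub>F k in sequentially. l2_norm form_index form_weight (jet (\<lambda>x. ?u k x - ?u n x)) \<le> sqrt (L - e n)"
    proof (rule eventually_sequentiallyI)
      fix k assume "n \<le> k"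
      have "(Enorm (\<lambda>x. ?u k x - ?u n x))\<^sup>2 \<le> L - e n" using eq[OF \<open>n \<le> k\<close>] L(2)[of k] by simp
      then show "l2_norm form_index form_weight (jet (\<lambda>x. ?u k x - ?u n x)) \<le> sqrt (L - e n)"
        unfolding Enorm_def by (rule real_le_rsqrt)
    qed
    note * = frm.Fatou[OF s l this]
    show "sq_summable form_index form_weight (jet (\<lambda>x. res f x - ?u n x))" by (rule *(1))
    show "l2_norm form_index form_weight (jet (\<lambda>x. res f x - ?u n x)) \<le> sqrt (L - e n)" by (rule *(2))
  qed
  have "sq_summable form_index form_weight (\<lambda>i. jet (\<lambda>x. res f x - ?u 0 x) i + jet (?u 0) i)"
    using F u by (intro frm.sq_summable_add) (auto simp: in_form_def)
  then show "in_form (res f)" by (simp add: in_form_def jet_diff)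
  show "(\<lambda>n. Enorm (\<lambda>x. res f x - ?u n x)) \<longlonglongrightarrow> 0"
  proof (rule tendsto_sandwich[OF _ _ tendsto_const])
    have "(\<lambda>n. sqrt (L - e n)) \<longlonglongrightarrow> sqrt (L - L)" by (intro tendsto_intros L(1))
    then show "(\<lambda>n. sqrt (L - e n)) \<longlonglongrightarrow> 0" by simp
  qed (use F in \<open>auto simp: Enorm_def frm.norm_nonneg\<close>)
qed

lemma form_domain_iff:
  "f \<in> form_domain X m b \<longleftrightarrow> (\<forall>x. x \<notin> X \<longrightarrow> f x = 0) \<and> in_form f \<and>
     (\<exists>\<phi>. (\<forall>k. \<phi> k \<in> C\<^sub>c X) \<and> (\<lambda>k::nat. Enorm (\<lambda>x. f x - \<phi> k x)) \<longlonglongrightarrow> 0)"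
proof -
  have "form_norm X m b (\<lambda>x. f x - \<phi> x) = Enorm (\<lambda>x. f x - \<phi> x)" if "in_form f" "\<phi> \<in> C\<^sub>c X" for \<phi>
    using that(1) C\<^sub>c_in_form[OF that(2)] by (intro form_norm_eq in_form_diff)
  then show ?thesis unfolding form_domain_def by (auto simp: l2_iff in_form_iff)
qed

lemma form_domain_in_form: "f \<in> form_domain X m b \<Longrightarrow> in_form f"
  by (simp add: form_domain_iff)

lemma form_domain_diff:
  assumes f: "f \<in> form_domain X m b" and g: "g \<in> form_domain X m b"
  shows "(\<lambda>x. f x - g x) \<in> form_domain X m b"
proof -
  obtain \<phi> \<psi> where \<phi>: "\<And>k. \<phi> k \<in> C\<^sub>c X" "(\<lambda>k::nat. Enorm (\<lambda>x. f x - \<phi> k x)) \<longlonglongrightarrow> 0"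
    and \<psi>: "\<And>k. \<psi> k \<in> C\<^sub>c X" "(\<lambda>k::nat. Enorm (\<lambda>x. g x - \<psi> k x)) \<longlonglongrightarrow> 0"
    using f g by (auto simp: form_domain_iff)
  have "(\<lambda>k. Enorm (\<lambda>x. (f x - g x) - (\<phi> k x - \<psi> k x))) \<longlonglongrightarrow> 0"
  proof (rule tendsto_sandwich[OF _ _ tendsto_const])
    show "(\<lambda>k. Enorm (\<lambda>x. f x - \<phi> k x) + Enorm (\<lambda>x. g x - \<psi> k x)) \<longlonglongrightarrow> 0"
      using tendsto_add[OF \<phi>(2) \<psi>(2)] by simp
    have "Enorm (\<lambda>x. (f x - g x) - (\<phi> k x - \<psi> k x)) \<le> Enorm (\<lambda>x. f x - \<phi> k x) + Enorm (\<lambda>x. g x - \<psi> k x)" for k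
    proof -
      have "(\<lambda>x. (f x - g x) - (\<phi> k x - \<psi> k x)) = (\<lambda>x. (f x - \<phi> k x) - (g x - \<psi> k x))" by auto
      then show ?thesis
        using frm.norm_triangle_diff[of "jet (\<lambda>x. f x - \<phi> k x)" "jet (\<lambda>x. g x - \<psi> k x)"]
          in_form_diff[OF form_domain_in_form[OF f] C\<^sub>c_in_form[OF \<phi>(1)]]
          in_form_diff[OF form_domain_in_form[OF g] C\<^sub>c_in_form[OF \<psi>(1)]]
        by (simp add: Enorm_def in_form_def jet_diff)
    qed
    then show "\<forall>\<^sub>F k in sequentially. Enorm (\<lambda>x. (f x - g x) - (\<phi> k x - \<psi> k x))
       \<le> Enorm (\<lambda>x. f x - \<phi> k x) + Enorm (\<lambda>x. g x - \<psi> k x)" by simp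
  qed (simp add: Enorm_nonneg)
  moreover have "(\<lambda>x. \<phi> k x - \<psi> k x) \<in> C\<^sub>c X" for k
    using \<phi>(1)[of k] \<psi>(1)[of k]
    by (auto simp: C\<^sub>c_def intro: finite_subset[of _ "{x \<in> X. \<phi> k x \<noteq> 0} \<union> {x \<in> X. \<psi> k x \<noteq> 0}"])
  ultimately show ?thesis
    using f g in_form_diff[of f g] by (auto simp: form_domain_iff intro!: exI[of _ "\<lambda>k x. \<phi> k x - \<psi> k x"])
qed

lemma res_form_domain: "sqs f \<Longrightarrow> res f \<in> form_domain X m b"
  using res_form_limit[of f] res_outside resK_C\<^sub>c[OF KnK]
  by (auto simp: form_domain_iff intro!: exI[of _ "\<lambda>n. resK (Kn n) f"])

lemma res_sqs: "sqs f \<Longrightarrow> sqs (res f)"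
  using res_form_limit(1) in_form_sqs by blast

text \<open>
  Both sides are continuous in the test function with respect to the form norm.
\<close>

lemma weak_equation_closure:
  assumes r: "in_form u" and f: "sqs f" and cc: "\<And>g. g \<in> C\<^sub>c X \<Longrightarrow> E u g = ip f g"
    and h: "h \<in> form_domain X m b"
  shows "E u h = ip f h"
proof -
  obtain \<phi> where \<phi>: "\<And>k. \<phi> k \<in> C\<^sub>c X" "(\<lambda>k::nat. Enorm (\<lambda>x. h x - \<phi> k x)) \<longlonglongrightarrow> 0"
    using h by (auto simp: form_domain_iff)
  have hi: "in_form h" using h by (rule form_domain_in_form)
  have "(\<lambda>k::nat. E u h - ip f h) \<longlonglongrightarrow> 0"
  proof (rule Lim_null_comparison)
    show "(\<lambda>k. (Enorm u + nrm f) * Enorm (\<lambda>x. h x - \<phi> k x)) \<longlonglongrightarrow> 0"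
      by (rule tendsto_mult_right_zero[OF \<phi>(2)])
    have "norm (E u h - ip f h) \<le> (Enorm u + nrm f) * Enorm (\<lambda>x. h x - \<phi> k x)" for k
    proof -
      note p = C\<^sub>c_in_form[OF \<phi>(1)[of k]]
      note d = in_form_diff[OF hi p]
      have eq: "E u h - ip f h = E u (\<lambda>x. h x - \<phi> k x) - ip f (\<lambda>x. h x - \<phi> k x)"
        using cc[OF \<phi>(1)[of k]] E_diff_left[OF hi p r] l2.inner_diff_right[OF in_form_sqs[OF hi] in_form_sqs[OF p] f]
        by (simp add: E_commute[of u])
      have "norm (E u h - ip f h) \<le> Enorm u * Enorm (\<lambda>x. h x - \<phi> k x) + nrm f * nrm (\<lambda>x. h x - \<phi> k x)"
        using E_Cauchy_Schwarz[OF r d] l2.Cauchy_Schwarz[OF f in_form_sqs[OF d]]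
        unfolding eq real_norm_def by linarith
      also have "\<dots> \<le> Enorm u * Enorm (\<lambda>x. h x - \<phi> k x) + nrm f * Enorm (\<lambda>x. h x - \<phi> k x)"
        by (intro add_mono mult_left_mono nrm_le_Enorm d l2.norm_nonneg order.refl)
      finally show ?thesis by (simp add: algebra_simps)
    qed
    then show "\<forall>\<^sub>F k in sequentially. norm (E u h - ip f h) \<le> (Enorm u + nrm f) * Enorm (\<lambda>x. h x - \<phi> k x)"
      by simp
  qed
  then show ?thesis by (simp add: LIMSEQ_const_iff)
qed

lemma res_weak_equation:
  assumes f: "sqs f" and h: "h \<in> form_domain X m b"
  shows "E (res f) h = ip f h"
proof (rule weak_equation_closure[OF res_form_limit(1)[OF f] f _ h])
  note r = res_form_limit(1)[OF f]
  fix g assume g: "g \<in> C\<^sub>c X"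
  show "E (res f) g = ip f g"
  proof -
    obtain n where n: "\<And>k. n \<le> k \<Longrightarrow> {x \<in> X. g x \<noteq> 0} \<subseteq> Kn k"
      using Kn_exhaust[of "{x \<in> X. g x \<noteq> 0}"] g by (auto simp: C\<^sub>c_def)
    have "(\<lambda>k. E (res f) g - E (resK (Kn k) f) g) \<longlonglongrightarrow> 0"
    proof (rule Lim_null_comparison)
      show "(\<lambda>k. Enorm (\<lambda>x. res f x - resK (Kn k) f x) * Enorm g) \<longlonglongrightarrow> 0"
        by (rule tendsto_mult_left_zero[OF res_form_limit(2)[OF f]])
      show "\<forall>\<^sub>F k in sequentially. norm (E (res f) g - E (resK (Kn k) f) g)
          \<le> Enorm (\<lambda>x. res f x - resK (Kn k) f x) * Enorm g"
        using E_Cauchy_Schwarz[OF in_form_diff[OF r resK_in_form[OF KnK]] C\<^sub>c_in_form[OF g]]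
        by (simp add: E_diff_left r resK_in_form[OF KnK] C\<^sub>c_in_form[OF g])
    qed
    moreover have "\<forall>\<^sub>F k in sequentially. E (res f) g - E (resK (Kn k) f) g = E (res f) g - ip f g"
    proof (rule eventually_sequentiallyI)
      fix k assume "n \<le> k"
      then show "E (res f) g - E (resK (Kn k) f) g = E (res f) g - ip f g"
        using n[of k] by (subst resK_Galerkin[OF KnK f g]) auto
    qed
    ultimately have "(\<lambda>k::nat. E (res f) g - ip f g) \<longlonglongrightarrow> 0"
      by (rule Lim_transform_eventually)
    then show ?thesis by (simp add: LIMSEQ_const_iff)
  qed
qed

lemma nrm_zero_imp:
  assumes "sqs v" "nrm v \<le> 0" "x \<in> X"
  shows "v x = 0"
  using l2.pointwise_le_norm[OF assms(1,3) m_pos[OF assms(3)]] assms(2) l2.norm_nonneg[of v] by simp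

text \<open>
  The resolvent describes the operator completely: \<open>res f\<close> solves the weak equation, and solutions
  are unique because \<open>E\<close> is positive definite.
\<close>

theorem form_operator_eq: "form_operator X m b = {(res f, \<lambda>x. f x - res f x) | f. f \<in> l2 X m}"
proof (intro set_eqI iffI)
  fix p assume "p \<in> {(res f, \<lambda>x. f x - res f x) | f. f \<in> l2 X m}"
  then obtain f where f: "f \<in> l2 X m" and p: "p = (res f, \<lambda>x. f x - res f x)" by auto
  have fs: "sqs f" using f by (simp add: l2_iff)
  have "energy X b (res f) h = ip (\<lambda>x. f x - res f x) h" if h: "h \<in> form_domain X m b" for h
  proof -
    have hi: "in_form h" using h by (rule form_domain_in_form)
    show ?thesis
      using res_weak_equation[OF fs h] E_eq[OF res_form_limit(1)[OF fs] hi]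
        l2.inner_diff_left[OF fs res_sqs[OF fs] in_form_sqs[OF hi]] by simp
  qed
  then show "p \<in> form_operator X m b"
    using f fs p res_form_domain[OF fs] res_outside
    by (auto simp: form_operator_def l2_iff intro: l2.sq_summable_diff res_sqs)
next
  fix p assume "p \<in> form_operator X m b"
  then obtain h g where p: "p = (h, g)" and h: "h \<in> form_domain X m b" and g: "g \<in> l2 X m"
    and eq: "\<And>k. k \<in> form_domain X m b \<Longrightarrow> energy X b h k = ip g k"
    by (auto simp: form_operator_def)
  have hi: "in_form h" using h by (rule form_domain_in_form)
  note hs = in_form_sqs[OF hi]
  have gs: "sqs g" using g by (simp add: l2_iff)
  define f where "f x = 1 * g x + 1 * h x" for x
  have fs: "sqs f" unfolding f_def by (rule l2.sq_summable_lincomb[OF gs hs])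
  have fl: "f \<in> l2 X m" using g h fs by (auto simp: l2_iff f_def form_domain_iff)
  define v where "v x = h x - res f x" for x
  have v: "v \<in> form_domain X m b" unfolding v_def by (rule form_domain_diff[OF h res_form_domain[OF fs]])
  note vi = form_domain_in_form[OF v]
  have "E h v = ip f v"
    using E_eq[OF hi vi] eq[OF v] l2.inner_lincomb_left[OF gs hs in_form_sqs[OF vi], of 1 1]
    by (simp add: f_def[abs_def])
  then have "E v v = 0"
    using res_weak_equation[OF fs v] E_diff_left[OF hi res_form_limit(1)[OF fs] vi] by (simp add: v_def[abs_def])
  then have "Enorm v = 0" using Enorm_square[of v] by simp
  then have "nrm v \<le> 0" using nrm_le_Enorm[OF vi] by simp
  then have "h x = res f x" for x
    using nrm_zero_imp[OF in_form_sqs[OF vi], of x] h res_outside[of x f]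
    by (cases "x \<in> X") (auto simp: v_def form_domain_iff)
  then have "h = res f" by auto
  then have "p = (res f, \<lambda>x. f x - res f x)" using p by (auto simp: f_def)
  then show "p \<in> {(res f, \<lambda>x. f x - res f x) | f. f \<in> l2 X m}" using fl by blast
qed

section \<open>The generator of the minimal semigroup\<close>

text \<open>
  The finite flows commute with the Laplace transform, being given by finite kernels; the limit
  along the exhaustion is taken by dominated convergence.
\<close>

lemma heat_res:
  assumes f: "sqs f" and t: "0 \<le> t" and x: "x \<in> X"
  shows "heat t (res f) x = exp t * (res f x - integral {0..t} (\<lambda>s. exp (- s) * heat s f x))"
proof -
  let ?B = "nrm f / sqrt (m x)"
  define \<kappa> where "\<kappa> n y = heatK (Kn n) (\<lambda>z. if z = y then 1 else 0) t x" for n y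
  have ker: "heatK (Kn n) g t x = (\<Sum>y\<in>Kn n. \<kappa> n y * g y)" for g n
    using heatK_kernel[OF KnK t, of n g x] by (simp add: \<kappa>_def mult.commute)
  have bc: "bdd_cont (nrm f / sqrt (m y)) (\<lambda>s. heat s f y)" if "y \<in> Kn n" for y n
    using that Kn_subset by (intro heat_bdd_cont f) auto
  have 1: "laplace1 (\<lambda>s. heatK (Kn n) (heat s f) t x) = heatK (Kn n) (res f) t x"
    and 2: "\<exists>D. bdd_cont D (\<lambda>s. heatK (Kn n) (heat s f) t x)" for n
    using laplace1_sum[OF Kn_finite bc, where c = "\<kappa> n"] unfolding ker res_def by auto
  have bd: "bdd_cont ?B (\<lambda>s. heatK (Kn n) (heat s f) t x)" for n
    unfolding bdd_cont_def
  proof (intro conjI allI impI)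
    show "continuous_on {0..} (\<lambda>s. heatK (Kn n) (heat s f) t x)" using 2[of n] by (auto simp: bdd_cont_def)
    fix s :: real assume s: "0 \<le> s"
    have "\<bar>heatK (Kn n) (heat s f) t x\<bar> \<le> nrm (heat s f) / sqrt (m x)"
      by (rule heatK_bound[OF KnK heat_sqs[OF f s] t x])
    also have "\<dots> \<le> ?B" using heat_nrm_le[OF f s] m_pos[OF x] by (intro divide_right_mono) auto
    finally show "\<bar>heatK (Kn n) (heat s f) t x\<bar> \<le> ?B" .
  qed
  have "(\<lambda>n. laplace1 (\<lambda>s. heatK (Kn n) (heat s f) t x)) \<longlonglongrightarrow> laplace1 (\<lambda>s. heat t (heat s f) x)"
    by (rule laplace1_dominated[OF bd]) (rule heat_lim[OF heat_sqs[OF f] t])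
  moreover have "(\<lambda>n. laplace1 (\<lambda>s. heatK (Kn n) (heat s f) t x)) \<longlonglongrightarrow> heat t (res f) x"
    unfolding 1 by (rule heat_lim[OF res_sqs[OF f] t])
  ultimately have "heat t (res f) x = laplace1 (\<lambda>s. heat t (heat s f) x)" by (rule LIMSEQ_unique[symmetric])
  also have "\<dots> = laplace1 (\<lambda>s. heat (s + t) f x)"
    unfolding laplace1_def using heat_semigroup[OF f t] by (intro integral_cong) (auto simp: add.commute)
  also have "\<dots> = exp t * (res f x - integral {0..t} (\<lambda>s. exp (- s) * heat s f x))"
    unfolding res_def by (rule laplace1_shift[OF heat_bdd_cont[OF f x] t])
  finally show ?thesis .
qed

text \<open>
  By the formula for \<open>heat t (res f)\<close>, the deviation of the difference quotient from
  \<open>res f - f\<close> consists of a multiple of \<open>res f\<close> and of the average of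
  \<open>exp (t - s) * heat s f - f\<close> over \<open>s\<close> in \<open>[0, t]\<close>.
\<close>

lemma res_difference_quotient:
  assumes f: "sqs f" and t: "0 < t" and near: "\<And>s. 0 \<le> s \<Longrightarrow> s \<le> t \<Longrightarrow> nrm (\<lambda>x. heat s f x - f x) \<le> \<epsilon>"
  shows "nrm (\<lambda>x. (heat t (res f) x - res f x) / t - (res f x - f x))
     \<le> \<bar>(exp t - 1) / t - 1\<bar> * nrm (res f) + ((exp t - 1) * nrm f + \<epsilon>)"
proof -
  define g where "g s x = exp (t - s) * heat s f x - f x" for s x
  define G where "G = (\<lambda>x. integral {0..t} (\<lambda>s. g s x) / t)"
  let ?a = "(exp t - 1) / t - 1"
  have hc: "continuous_on {0..t} (\<lambda>s. heat s f x)" if "x \<in> X" for x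
    by (rule bdd_cont_continuous_on[OF heat_bdd_cont[OF f that]]) auto
  have cont: "continuous_on {0..t} (\<lambda>s. g s x)" if "x \<in> X" for x
    unfolding g_def by (intro continuous_intros hc that)
  have bound: "sqs (g s) \<and> nrm (g s) \<le> (exp t - 1) * nrm f + \<epsilon>" if s: "s \<in> {0..t}" for s
  proof -
    have s0: "0 \<le> s" and st: "s \<le> t" using s by auto
    note hs = heat_sqs[OF f s0]
    have eq: "g s = (\<lambda>x. (exp (t - s) - 1) * heat s f x + (heat s f x - f x))"
      by (auto simp: g_def algebra_simps)
    note a = l2.sq_summable_scale[OF hs, of "exp (t - s) - 1"] and b = l2.sq_summable_diff[OF hs f]
    have "nrm (g s) \<le> nrm (\<lambda>x. (exp (t - s) - 1) * heat s f x) + nrm (\<lambda>x. heat s f x - f x)"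
      unfolding eq by (rule l2.norm_triangle[OF a b])
    also have "nrm (\<lambda>x. (exp (t - s) - 1) * heat s f x) = (exp (t - s) - 1) * nrm (heat s f)"
      using st by (simp add: l2.norm_scale)
    also have "\<dots> \<le> (exp t - 1) * nrm f"
      using s0 st by (intro mult_mono heat_nrm_le f) (auto simp: l2.norm_nonneg)
    finally have "nrm (g s) \<le> (exp t - 1) * nrm f + \<epsilon>" using near[OF s0 st] by linarith
    then show ?thesis using l2.sq_summable_add[OF a b] unfolding eq by simp
  qed
  have Gs: "sqs G" and Gn: "nrm G \<le> (exp t - 1) * nrm f + \<epsilon>"
    using l2.path_average_bound[OF t cont bound] unfolding G_def by auto
  have "nrm (\<lambda>x. (heat t (res f) x - res f x) / t - (res f x - f x)) = nrm (\<lambda>x. ?a * res f x - G x)"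
  proof (rule l2.norm_cong)
    fix x assume x: "x \<in> X"
    let ?I = "integral {0..t} (\<lambda>s. exp (- s) * heat s f x)"
    have i: "(\<lambda>s. exp (- s) * heat s f x) integrable_on {0..t}"
      using hc[OF x] by (intro integrable_continuous_interval continuous_intros)
    have "integral {0..t} (\<lambda>s. g s x) = integral {0..t} (\<lambda>s. exp t * (exp (- s) * heat s f x) - f x)"
      by (intro integral_cong) (simp add: g_def exp_diff exp_minus field_simps)
    also have "\<dots> = exp t * ?I - t * f x"
      using t i by (subst integral_diff) (auto intro!: integrable_on_mult_right)
    finally have "G x = (exp t * ?I - t * f x) / t" by (simp add: G_def)
    then show "(heat t (res f) x - res f x) / t - (res f x - f x) = ?a * res f x - G x"
      using t heat_res[OF f less_imp_le[OF t] x] by (simp add: field_simps)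
  qed
  also have "\<dots> \<le> nrm (\<lambda>x. ?a * res f x) + nrm G"
    by (rule l2.norm_triangle_diff[OF l2.sq_summable_scale[OF res_sqs[OF f]] Gs])
  also have "\<dots> \<le> \<bar>?a\<bar> * nrm (res f) + ((exp t - 1) * nrm f + \<epsilon>)"
    using Gn by (simp only: l2.norm_scale add_le_cancel_left)
  finally show ?thesis .
qed

lemma res_in_generator:
  assumes f: "f \<in> l2 X m"
  shows "(res f, \<lambda>x. res f x - f x) \<in> generator X m heat"
proof -
  have fs: "sqs f" using f by (simp add: l2_iff)
  have rl: "res f \<in> l2 X m" using res_sqs[OF fs] by (simp add: l2_iff res_outside)
  have "((\<lambda>t. nrm (\<lambda>x. (heat t (res f) x - res f x) / t - (res f x - f x))) \<longlongrightarrow> 0) (at_right 0)"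
  proof (rule tendstoI)
    fix e :: real assume e: "0 < e"
    obtain \<delta> where \<delta>: "0 < \<delta>" "\<And>s. 0 < s \<Longrightarrow> s < \<delta> \<Longrightarrow> nrm (\<lambda>x. heat s f x - f x) < e / 2"
      using order_tendstoD(2)[OF heat_continuous[OF fs], of "e / 2"] e by (auto simp: eventually_at_right_field)
    have z: "nrm (\<lambda>x. heat 0 f x - f x) = nrm (\<lambda>x. 0)" using heat_0[OF fs] by (intro l2.norm_cong) auto
    have near: "nrm (\<lambda>x. heat s f x - f x) \<le> e / 2" if "0 \<le> s" "s < \<delta>" for s
      using \<delta>(2)[of s] that e z by (cases "s = 0") (auto simp: l2_norm_def l2_inner_def)
    have q: "((\<lambda>t::real. (exp t - 1) / t) \<longlongrightarrow> 1) (at_right 0)"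
      using DERIV_exp[of "0::real"] by (simp add: DERIV_def filterlim_at_split)
    have "((\<lambda>t. \<bar>(exp t - 1) / t - 1\<bar> * nrm (res f) + (exp t - 1) * nrm f) \<longlongrightarrow> \<bar>1 - 1\<bar> * nrm (res f) + (exp 0 - 1) * nrm f) (at_right 0)"
      by (intro tendsto_intros q)
    then have "\<forall>\<^sub>F t in at_right 0. \<bar>(exp t - 1) / t - 1\<bar> * nrm (res f) + (exp t - 1) * nrm f < e / 2"
      using e by (intro order_tendstoD(2)) auto
    moreover have "\<forall>\<^sub>F t in at_right (0::real). 0 < t" by (simp add: eventually_at_right_less)
    moreover have "\<forall>\<^sub>F t in at_right 0. t < \<delta>" using \<delta>(1) by (auto simp: eventually_at_right_field)
    ultimately show "\<forall>\<^sub>F t in at_right 0. dist (nrm (\<lambda>x. (heat t (res f) x - res f x) / t - (res f x - f x))) 0 < e"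
    proof eventually_elim
      case (elim t)
      have "nrm (\<lambda>x. (heat t (res f) x - res f x) / t - (res f x - f x))
         \<le> \<bar>(exp t - 1) / t - 1\<bar> * nrm (res f) + ((exp t - 1) * nrm f + e / 2)"
        by (rule res_difference_quotient[OF fs]) (use elim near in auto)
      then show ?case using elim by (simp add: l2.norm_nonneg)
    qed
  qed
  then show ?thesis using rl l2.l2_diff[OF rl f] by (simp add: generator_def)
qed

text \<open>
  The generator contains all pairs from the resolvent. It contains no others: if \<open>(h, g)\<close> belongs
  to it and \<open>f = h - g\<close>, then \<open>v = h - res f\<close> satisfies \<open>A v = v\<close> for the generator \<open>A\<close>, whereas
  the semigroup is contracting; so \<open>v = 0\<close>.
\<close>

lemma generator_eq: "generator X m heat = {(res f, \<lambda>x. res f x - f x) | f. f \<in> l2 X m}"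
proof (intro set_eqI iffI)
  fix p assume "p \<in> generator X m heat"
  then obtain h g where p: "p = (h, g)" and h: "h \<in> l2 X m" and g: "g \<in> l2 X m"
    and lim: "((\<lambda>t. nrm (\<lambda>x. (heat t h x - h x) / t - g x)) \<longlongrightarrow> 0) (at_right 0)"
    by (auto simp: generator_def)
  define f where "f x = h x - g x" for x
  have f: "f \<in> l2 X m" unfolding f_def by (rule l2.l2_diff[OF h g])
  have fs: "sqs f" and hs: "sqs h" and gs: "sqs g" using f h g by (auto simp: l2_iff)
  note rs = res_sqs[OF fs]
  have lim': "((\<lambda>t. nrm (\<lambda>x. (heat t (res f) x - res f x) / t - (res f x - f x))) \<longlongrightarrow> 0) (at_right 0)"
    using res_in_generator[OF f] by (simp add: generator_def)
  define v where "v x = h x - res f x" for x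
  have vs: "sqs v" unfolding v_def by (rule l2.sq_summable_diff[OF hs rs])
  have lim2: "((\<lambda>t. nrm v * (nrm (\<lambda>x. (heat t h x - h x) / t - g x) + nrm (\<lambda>x. (heat t (res f) x - res f x) / t - (res f x - f x)))) \<longlongrightarrow> nrm v * (0 + 0)) (at_right 0)"
    by (intro tendsto_intros lim lim')
  have "(nrm v)\<^sup>2 \<le> nrm v * (0 + 0)"
  proof (rule tendsto_lowerbound[OF lim2])
    have "\<forall>\<^sub>F t in at_right (0::real). 0 < t" by (simp add: eventually_at_right_less)
    then show "\<forall>\<^sub>F t in at_right 0. (nrm v)\<^sup>2 \<le> nrm v * (nrm (\<lambda>x. (heat t h x - h x) / t - g x) + nrm (\<lambda>x. (heat t (res f) x - res f x) / t - (res f x - f x)))"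
    proof eventually_elim
      case (elim t)
      then have t: "0 \<le> t" by simp
      note hvs = heat_sqs[OF vs t]
      define d1 where "d1 x = (1 / t) * (heat t h x - h x) + (-1) * g x" for x
      define d2 where "d2 x = (heat t (res f) x - res f x) / t - (res f x - f x)" for x
      have d1: "sqs d1" unfolding d1_def by (intro l2.sq_summable_lincomb l2.sq_summable_diff heat_sqs hs gs t)
      have d2: "sqs d2"
        using l2.sq_summable_lincomb[OF l2.sq_summable_diff[OF heat_sqs[OF rs t] rs]
            l2.sq_summable_diff[OF rs fs], of "1 / t" "-1"]
        unfolding d2_def by (simp only: mult_minus1 add_uminus_conv_diff mult_1 times_divide_eq_left)
      have hd: "heat t v x = heat t h x - heat t (res f) x" for x
        unfolding v_def using heat_diff[OF hs rs t] .
      have eq: "v x = (1 / t) * (heat t v x - v x) + (-1) * (d1 x - d2 x)" for x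
        unfolding hd unfolding d1_def d2_def v_def f_def by (simp add: algebra_simps diff_divide_distrib)
      have dd: "sqs (\<lambda>x. d1 x - d2 x)" by (rule l2.sq_summable_diff[OF d1 d2])
      have "ip v v = (1 / t) * ip (\<lambda>x. heat t v x - v x) v + (-1) * ip (\<lambda>x. d1 x - d2 x) v"
        using l2.inner_lincomb_left[OF l2.sq_summable_diff[OF hvs vs] dd vs, of "1 / t" "-1"] eq by (simp flip: eq)
      moreover have "ip (\<lambda>x. heat t v x - v x) v \<le> 0"
      proof -
        have "ip (heat t v) v \<le> nrm (heat t v) * nrm v" using l2.Cauchy_Schwarz[OF hvs vs] by linarith
        also have "\<dots> \<le> nrm v * nrm v" by (intro mult_right_mono heat_nrm_le vs t l2.norm_nonneg)
        also have "\<dots> = ip v v" using l2.norm_square[of v] by (simp add: power2_eq_square)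
        finally show ?thesis using l2.inner_diff_left[OF hvs vs vs] by simp
      qed
      then have "(1 / t) * ip (\<lambda>x. heat t v x - v x) v \<le> 0" using elim by (simp add: mult_nonneg_nonpos divide_nonpos_pos)
      moreover have "- ip (\<lambda>x. d1 x - d2 x) v \<le> nrm (\<lambda>x. d1 x - d2 x) * nrm v"
        using l2.Cauchy_Schwarz[OF dd vs] by linarith
      moreover have "nrm (\<lambda>x. d1 x - d2 x) * nrm v \<le> (nrm d1 + nrm d2) * nrm v"
        by (intro mult_right_mono l2.norm_triangle_diff d1 d2 l2.norm_nonneg)
      ultimately have "(nrm v)\<^sup>2 \<le> (nrm d1 + nrm d2) * nrm v" unfolding l2.norm_square by linarith
      then show ?case by (simp add: d1_def[abs_def] d2_def[abs_def] mult.commute)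
    qed
  qed simp
  then have "nrm v \<le> 0" by simp
  then have "h x = res f x" for x
    using nrm_zero_imp[OF vs, of x] h res_outside[of x f] by (cases "x \<in> X") (auto simp: v_def l2_iff)
  then have "h = res f" by auto
  then have "p = (res f, \<lambda>x. res f x - f x)" using p by (auto simp: f_def)
  then show "p \<in> {(res f, \<lambda>x. res f x - f x) | f. f \<in> l2 X m}" using f by blast
next
  fix p assume "p \<in> {(res f, \<lambda>x. res f x - f x) | f. f \<in> l2 X m}"
  then show "p \<in> generator X m heat" using res_in_generator by auto
qed

theorem heat_is_heat_semigroup: "is_heat_semigroup X m b heat"
proof -
  have "{(f, \<lambda>x. - g x) | f g. (f, g) \<in> form_operator X m b} = {(res f, \<lambda>x. res f x - f x) | f. f \<in> l2 X m}"
    unfolding form_operator_eq by (force simp: fun_eq_iff)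
  then show ?thesis unfolding is_heat_semigroup_def using heat_C0_semigroup generator_eq by simp
qed

section \<open>Uniqueness of the heat semigroup\<close>

text \<open>
  The formal Laplacian, acting on all functions.
\<close>

definition lap :: "('a \<Rightarrow> real) \<Rightarrow> 'a \<Rightarrow> real" where
  "lap u x = (deg x * u x - (\<Sum>y\<in>nbrs x. b x y * u y)) / m x"

lemma dirL_eq_lap:
  assumes x: "x \<in> X" and K: "finite K" "K \<subseteq> X" and u: "\<And>y. y \<in> nbrs x - K \<Longrightarrow> u y = 0"
  shows "dirL K u x = lap u x"
proof -
  let ?U = "K \<union> nbrs x"
  have "(\<Sum>y\<in>K. b x y * u y) = (\<Sum>y\<in>?U. b x y * u y)"
    using K nbrs_finite[OF x] u by (intro sum.mono_neutral_left) auto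
  also have "\<dots> = (\<Sum>y\<in>nbrs x. b x y * u y)"
    using K nbrs_finite[OF x] nbrs_subset x by (intro sum_nbrs) auto
  finally show ?thesis by (simp add: dirL_def lap_def)
qed

lemma C\<^sub>c_l2: "\<phi> \<in> C\<^sub>c X \<Longrightarrow> \<phi> \<in> l2 X m"
  using C\<^sub>c_in_form in_form_sqs by (auto simp: l2_iff C\<^sub>c_def)

lemma C\<^sub>c_form_domain: "\<phi> \<in> C\<^sub>c X \<Longrightarrow> \<phi> \<in> form_domain X m b"
proof -
  assume \<phi>: "\<phi> \<in> C\<^sub>c X"
  have "Enorm (\<lambda>x. \<phi> x - \<phi> x) = 0" unfolding Enorm_def jet_diff by (simp add: l2_norm_def l2_inner_def)
  then have "(\<lambda>k::nat. Enorm (\<lambda>x. \<phi> x - \<phi> x)) \<longlonglongrightarrow> 0" by simp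
  then show ?thesis
    unfolding form_domain_iff using \<phi> C\<^sub>c_in_form[OF \<phi>]
    by (intro conjI exI[of _ "\<lambda>_. \<phi>"]) (auto simp: C\<^sub>c_def)
qed

text \<open>
  For a locally finite graph the Laplacian of a finitely supported function is again finitely
  supported. As such functions are dense, two semigroups that agree on the domain of their generator
  agree everywhere.
\<close>

lemma C\<^sub>c_in_operator_domain:
  assumes u: "u \<in> C\<^sub>c X"
  obtains g where "(u, g) \<in> form_operator X m b"
proof -
  define K where "K = {x \<in> X. u x \<noteq> 0}"
  define N where "N = K \<union> (\<Union>x\<in>K. nbrs x)"
  have K: "finite K" "K \<subseteq> X" using u by (auto simp: C\<^sub>c_def K_def)
  note N = finite_support_nbhd[OF K, folded N_def]
  define g where "g x = (if x \<in> X then lap u x else 0)" for x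
  have g0: "g x = 0" if x: "x \<in> X - N" for x
  proof -
    have "b x y * u y = 0" if y: "y \<in> nbrs x" for y
      using N(3)[of x y] x y nbrs_subset by (cases "y \<in> K") (auto simp: K_def nbrs_def)
    then have "(\<Sum>y\<in>nbrs x. b x y * u y) = 0" by (intro sum.neutral) auto
    then show ?thesis using x by (simp add: g_def lap_def N_def K_def)
  qed
  have "finite {x \<in> X. g x \<noteq> 0}" using g0 by (intro finite_subset[OF _ N(1)]) auto
  then have g: "g \<in> C\<^sub>c X" by (auto simp: C\<^sub>c_def g_def)
  note ui = C\<^sub>c_in_form[OF u] and gi = C\<^sub>c_in_form[OF g]
  have cc: "E u h = ip (\<lambda>x. 1 * g x + 1 * u x) h" if h: "h \<in> C\<^sub>c X" for h
  proof -
    define K' where "K' = N \<union> {x \<in> X. h x \<noteq> 0}"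
    have K': "finite K'" "K' \<subseteq> X" using N h by (auto simp: K'_def C\<^sub>c_def)
    have uK: "\<And>x. x \<in> X - K' \<Longrightarrow> u x = 0" and hK: "\<And>x. x \<in> X - K' \<Longrightarrow> h x = 0"
      by (auto simp: K'_def N_def K_def)
    have "energy X b u h = (\<Sum>x\<in>K'. m x * dirL K' u x * h x)" by (rule Green_formula[OF K' uK hK])
    also have "\<dots> = (\<Sum>x\<in>K'. m x * g x * h x)"
    proof (rule sum.cong)
      fix x assume "x \<in> K'"
      then have x: "x \<in> X" using K' by auto
      have "dirL K' u x = lap u x"
        using uK nbrs_subset by (intro dirL_eq_lap[OF x K']) auto
      then show "m x * dirL K' u x * h x = m x * g x * h x" using x by (simp add: g_def)
    qed simp
    also have "\<dots> = ip g h" by (rule l2.inner_finite_support_right[OF K' hK, symmetric])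
    finally show ?thesis
      using E_eq[OF ui C\<^sub>c_in_form[OF h]]
        l2.inner_lincomb_left[OF in_form_sqs[OF gi] in_form_sqs[OF ui] in_form_sqs[OF C\<^sub>c_in_form[OF h]], of 1 1] by simp
  qed
  have fs: "sqs (\<lambda>x. 1 * g x + 1 * u x)" by (rule l2.sq_summable_lincomb[OF in_form_sqs[OF gi] in_form_sqs[OF ui]])
  have "energy X b u h = ip g h" if h: "h \<in> form_domain X m b" for h
    using weak_equation_closure[OF ui fs cc h] E_eq[OF ui form_domain_in_form[OF h]]
      l2.inner_lincomb_left[OF in_form_sqs[OF gi] in_form_sqs[OF ui] in_form_sqs[OF form_domain_in_form[OF h]], of 1 1]
    by simp
  then have "(u, g) \<in> form_operator X m b"
    using C\<^sub>c_form_domain[OF u] C\<^sub>c_l2[OF g] by (simp add: form_operator_def)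
  then show ?thesis by (rule that)
qed

lemma C\<^sub>c_dense:
  assumes f: "f \<in> l2 X m" and e: "0 < e"
  obtains \<phi> where "\<phi> \<in> C\<^sub>c X" "nrm (\<lambda>x. f x - \<phi> x) < e"
proof -
  have fs: "sqs f" using f by (simp add: l2_iff)
  obtain F where F: "finite F" "F \<subseteq> X" "ip f f - e\<^sup>2 < (\<Sum>x\<in>F. m x * (f x)\<^sup>2)"
    using l2.inner_finite_approx[OF fs, of "e\<^sup>2"] e by auto
  define \<phi> where "\<phi> x = (if x \<in> F then f x else 0)" for x
  have "finite {x \<in> X. \<phi> x \<noteq> 0}" by (rule finite_subset[OF _ F(1)]) (auto simp: \<phi>_def)
  then have \<phi>: "\<phi> \<in> C\<^sub>c X" using F by (auto simp: C\<^sub>c_def \<phi>_def)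
  have \<phi>s: "sqs \<phi>" using C\<^sub>c_l2[OF \<phi>] by (simp add: l2_iff)
  have 0: "\<And>x. x \<in> X - F \<Longrightarrow> \<phi> x = 0" by (simp add: \<phi>_def)
  have i: "ip g \<phi> = (\<Sum>x\<in>F. m x * g x * \<phi> x)" for g by (rule l2.inner_finite_support_right[OF F(1,2) 0])
  have "ip f \<phi> = (\<Sum>x\<in>F. m x * (f x)\<^sup>2)" "ip \<phi> \<phi> = (\<Sum>x\<in>F. m x * (f x)\<^sup>2)"
    unfolding i by (auto simp: \<phi>_def power2_eq_square intro!: sum.cong)
  then have "(nrm (\<lambda>x. f x - \<phi> x))\<^sup>2 < e\<^sup>2"
    using l2.inner_square_lincomb[OF fs \<phi>s, of 1 "-1"] F(3) by (simp add: l2.norm_square)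
  then have "nrm (\<lambda>x. f x - \<phi> x) < e" using e by (simp add: power_less_imp_less_base)
  then show ?thesis using that \<phi> by blast
qed

text \<open>
  The generator is minus the operator of a nonnegative form. It is stated for differences since it
  is used for the difference of two orbits.
\<close>

lemma generator_dissipative:
  assumes "(h1, g1) \<in> generator X m heat" "(h2, g2) \<in> generator X m heat"
  shows "ip (\<lambda>x. g1 x - g2 x) (\<lambda>x. h1 x - h2 x) \<le> 0"
proof -
  obtain f1 f2 where f: "f1 \<in> l2 X m" "f2 \<in> l2 X m"
    and 1: "h1 = res f1" "g1 = (\<lambda>x. res f1 x - f1 x)" and 2: "h2 = res f2" "g2 = (\<lambda>x. res f2 x - f2 x)"
    using assms unfolding generator_eq by blast
  have fs: "sqs f1" "sqs f2" using f by (simp_all add: l2_iff)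
  let ?v = "\<lambda>x. res f1 x - res f2 x"
  have v: "?v \<in> form_domain X m b" by (intro form_domain_diff res_form_domain fs)
  note vi = form_domain_in_form[OF v] and r = res_form_limit(1)[OF fs(1)] res_form_limit(1)[OF fs(2)]
  note vs = in_form_sqs[OF vi]
  have d: "sqs (\<lambda>x. f1 x - f2 x)" by (rule l2.sq_summable_diff[OF fs])
  have "E ?v ?v = ip (\<lambda>x. f1 x - f2 x) ?v"
    unfolding E_diff_left[OF r vi] res_weak_equation[OF fs(1) v] res_weak_equation[OF fs(2) v]
    by (rule l2.inner_diff_left[OF fs vs, symmetric])
  moreover have "E ?v ?v = energy X b ?v ?v + ip ?v ?v" by (rule E_eq[OF vi vi])
  moreover have "(\<lambda>x. g1 x - g2 x) = (\<lambda>x. ?v x - (f1 x - f2 x))" by (auto simp: 1 2)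
  ultimately show ?thesis
    using l2.inner_diff_left[OF vs d vs] energy_nonneg[of ?v] by (simp add: 1(1) 2(1))
qed

text \<open>
  For initial values in the common domain, the difference of the two orbits is differentiable and
  its square norm decreases, by dissipativity; it starts at zero. Density extends this to \<open>l2\<close>.
\<close>

theorem heat_semigroup_unique:
  assumes S: "is_heat_semigroup X m b S" and f: "f \<in> l2 X m" and t: "0 \<le> t"
  shows "S t f = heat t f"
proof -
  have S0: "C0_semigroup X m S" and gen: "generator X m S = generator X m heat"
    using S heat_is_heat_semigroup by (simp_all add: is_heat_semigroup_def)
  note H0 = heat_C0_semigroup
  have core: "nrm (\<lambda>x. S t h x - heat t h x) = 0" if hg: "(h, g) \<in> generator X m heat" for h g
  proof -
    have h: "h \<in> l2 X m" and g: "g \<in> l2 X m" using hg by (auto simp: generator_def)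
    have hg': "(h, g) \<in> generator X m S" using hg gen by simp
    \<comment> \<open>The difference of the two orbits and its derivative \<open>u\<close>.\<close>
    define v where "v s x = S s h x - heat s h x" for s x
    define u where "u s x = S s g x - heat s g x" for s x
    define \<phi> where "\<phi> s = ip (v s) (v s)" for s
    have vl: "v s \<in> l2 X m" if "0 \<le> s" for s
      unfolding v_def by (intro l2.l2_diff l2.C0_l2[OF S0] l2.C0_l2[OF H0] that h)
    have ul: "u s \<in> l2 X m" if "0 \<le> s" for s
      unfolding u_def by (intro l2.l2_diff l2.C0_l2[OF S0] l2.C0_l2[OF H0] that g)
    have deriv: "(\<phi> has_real_derivative 2 * ip (u s) (v s)) (at s within {0..})" if s: "0 \<le> s" for s
      unfolding \<phi>_def
    proof (rule l2.norm_square_derivative)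
      let ?a = "\<lambda>r x. (S r h x - S s h x) / (r - s) - S s g x"
      let ?b = "\<lambda>r x. (heat r h x - heat s h x) / (r - s) - heat s g x"
      show "((\<lambda>r. nrm (\<lambda>x. (v r x - v s x) / (r - s) - u s x)) \<longlongrightarrow> 0) (at s within {0..})"
      proof (rule tendsto_sandwich[OF _ _ tendsto_const])
        show "((\<lambda>r. nrm (?a r) + nrm (?b r)) \<longlongrightarrow> 0) (at s within {0..})"
          using tendsto_add[OF l2.orbit_differentiable[OF S0 m_pos hg' s] l2.orbit_differentiable[OF H0 m_pos hg s]] by simp
        show "\<forall>\<^sub>F r in at s within {0..}. nrm (\<lambda>x. (v r x - v s x) / (r - s) - u s x) \<le> nrm (?a r) + nrm (?b r)"
          unfolding eventually_at_filter
        proof (rule always_eventually, intro allI impI)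
          fix r :: real assume "r \<noteq> s" "r \<in> {0..}"
          then have r: "0 \<le> r" by simp
          have l: "(\<lambda>x. (1 / (r - s)) * (p x - q x) + (-1) * k x) \<in> l2 X m"
            if "p \<in> l2 X m" "q \<in> l2 X m" "k \<in> l2 X m" for p q k
            by (intro l2.l2_lincomb l2.l2_diff that)
          have "sqs (?a r)" "sqs (?b r)"
            using l[OF l2.C0_l2[OF S0 r h] l2.C0_l2[OF S0 s h] l2.C0_l2[OF S0 s g]]
              l[OF l2.C0_l2[OF H0 r h] l2.C0_l2[OF H0 s h] l2.C0_l2[OF H0 s g]] by (simp_all add: l2_iff)
          moreover have "(\<lambda>x. (v r x - v s x) / (r - s) - u s x) = (\<lambda>x. ?a r x - ?b r x)"
            by (simp add: v_def u_def fun_eq_iff diff_divide_distrib)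
          ultimately show "nrm (\<lambda>x. (v r x - v s x) / (r - s) - u s x) \<le> nrm (?a r) + nrm (?b r)"
            using l2.norm_triangle_diff by simp
        qed
      qed (simp add: l2.norm_nonneg)
    qed (use vl ul s in \<open>auto simp: l2_iff\<close>)
    have sign: "ip (u s) (v s) \<le> 0" if s: "0 \<le> s" for s
      using generator_dissipative[OF l2.generator_invariant[OF S0 hg' s, unfolded gen] l2.generator_invariant[OF H0 hg s]]
      by (simp add: u_def[abs_def] v_def[abs_def])
    have "\<phi> t \<le> \<phi> 0"
    proof (rule DERIV_nonpos_imp_decreasing_open[OF t])
      fix s assume s: "0 < s" "s < t"
      have "at s within {0..} = at s" using s by (intro at_within_interior) simp
      then show "\<exists>y. (\<phi> has_real_derivative y) (at s) \<and> y \<le> 0"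
        using deriv[of s] sign[of s] s by (intro exI[of _ "2 * ip (u s) (v s)"]) auto
    next
      have "continuous_on {0..} \<phi>" unfolding continuous_on_eq_continuous_within
        using deriv by (auto intro: DERIV_continuous)
      then show "continuous_on {0..t} \<phi>" by (rule continuous_on_subset) auto
    qed
    also have "\<phi> 0 = 0" unfolding \<phi>_def v_def l2.C0_0[OF S0 h] l2.C0_0[OF H0 h] by (simp add: l2_inner_def)
    finally have "nrm (v t) \<le> 0" by (simp add: \<phi>_def l2_norm_def)
    then show ?thesis using l2.norm_nonneg[of "v t"] by (simp add: v_def[abs_def])
  qed
  obtain C where C: "0 \<le> C" "\<And>k. k \<in> l2 X m \<Longrightarrow> nrm (S t k) \<le> C * nrm k"
    using l2.C0_bounded[OF S0 t] by blast
  have Sf: "S t f \<in> l2 X m" and Hf: "heat t f \<in> l2 X m" using l2.C0_l2[OF S0 t f] l2.C0_l2[OF H0 t f] by auto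
  have "nrm (\<lambda>x. S t f x - heat t f x) \<le> 0"
  proof (rule field_le_epsilon)
    fix e :: real assume e: "0 < e"
    obtain \<phi> where \<phi>: "\<phi> \<in> C\<^sub>c X" "nrm (\<lambda>x. f x - \<phi> x) < e / (C + 1)"
      using C\<^sub>c_dense[OF f, of "e / (C + 1)"] e C(1) by auto
    obtain g where "(\<phi>, g) \<in> form_operator X m b" using C\<^sub>c_in_operator_domain[OF \<phi>(1)] .
    then have "(\<phi>, \<lambda>x. - g x) \<in> generator X m heat"
      using heat_is_heat_semigroup by (auto simp: is_heat_semigroup_def)
    from core[OF this] have z: "nrm (\<lambda>x. S t \<phi> x - heat t \<phi> x) = 0" .
    note \<phi>l = C\<^sub>c_l2[OF \<phi>(1)]
    note S\<phi> = l2.C0_l2[OF S0 t \<phi>l] and H\<phi> = l2.C0_l2[OF H0 t \<phi>l] and d = l2.l2_diff[OF f \<phi>l]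
    have "nrm (\<lambda>x. S t f x - heat t f x) \<le> nrm (\<lambda>x. S t f x - S t \<phi> x) + nrm (\<lambda>x. S t \<phi> x - heat t f x)"
      using Sf Hf S\<phi> by (intro l2.norm_triangle_via) (auto simp: l2_iff)
    also have "nrm (\<lambda>x. S t \<phi> x - heat t f x) \<le> nrm (\<lambda>x. S t \<phi> x - heat t \<phi> x) + nrm (\<lambda>x. heat t \<phi> x - heat t f x)"
      using Hf S\<phi> H\<phi> by (intro l2.norm_triangle_via) (auto simp: l2_iff)
    also have "nrm (\<lambda>x. S t f x - S t \<phi> x) \<le> C * nrm (\<lambda>x. f x - \<phi> x)"
      using C(2)[OF d] l2.C0_diff[OF S0 t f \<phi>l] by simp
    also have "nrm (\<lambda>x. heat t \<phi> x - heat t f x) \<le> nrm (\<lambda>x. f x - \<phi> x)"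
      using heat_nrm_le[of "\<lambda>x. f x - \<phi> x" t] d t l2.C0_diff[OF H0 t f \<phi>l]
      by (simp add: l2_iff l2.norm_minus_commute[of "heat t \<phi>"])
    finally have "nrm (\<lambda>x. S t f x - heat t f x) \<le> (C + 1) * nrm (\<lambda>x. f x - \<phi> x)"
      using z by (simp add: algebra_simps)
    also have "\<dots> \<le> (C + 1) * (e / (C + 1))" using \<phi>(2) C(1) by (intro mult_left_mono) auto
    also have "\<dots> = e" using C(1) by simp
    finally show "nrm (\<lambda>x. S t f x - heat t f x) \<le> 0 + e" by simp
  qed
  then have "S t f x = heat t f x" for x
    using nrm_zero_imp[of "\<lambda>x. S t f x - heat t f x" x] l2.l2_diff[OF Sf Hf] Sf Hf
    by (cases "x \<in> X") (auto simp: l2_iff)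
  then show ?thesis by auto
qed

section \<open>Stochastic completeness and bounded solutions\<close>

abbreviation approx1 :: "(nat \<Rightarrow> 'a \<Rightarrow> real) \<Rightarrow> bool" where
  "approx1 \<phi> \<equiv> increasing_l2_approx X m \<phi> (\<lambda>_. 1)"

lemma approx1_props:
  assumes "approx1 \<phi>"
  shows "\<phi> k \<in> l2 X m" "sqs (\<phi> k)" "x \<in> X \<Longrightarrow> 0 \<le> \<phi> k x" "x \<in> X \<Longrightarrow> \<phi> k x \<le> 1"
    "x \<in> X \<Longrightarrow> incseq (\<lambda>k. \<phi> k x)" "x \<in> X \<Longrightarrow> (\<lambda>k. \<phi> k x) \<longlonglongrightarrow> 1"
  using assms incseq_le[of "\<lambda>k. \<phi> k x" 1 k] by (auto simp: increasing_l2_approx_def l2_iff)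

text \<open>
  The semigroup \<open>heat t\<close> preserves the constant function one. The following lemmas show that the
  choice of the approximating sequence and of \<open>t > 0\<close> does not matter.
\<close>

definition conservative_at :: "real \<Rightarrow> bool" where
  "conservative_at t \<longleftrightarrow> (\<exists>\<phi>. approx1 \<phi> \<and> (\<forall>x\<in>X. (\<lambda>k. heat t (\<phi> k) x) \<longlonglongrightarrow> 1))"

text \<open>
  Every function below one is the pointwise limit of its truncations \<open>min f (\<psi> k)\<close>, and on a
  finite set pointwise limits pass through the flow.
\<close>

lemma heat_le_approx_limit:
  assumes \<psi>: "approx1 \<psi>" and s: "0 \<le> s" and x: "x \<in> X" and c: "(\<lambda>k. heat s (\<psi> k) x) \<longlonglongrightarrow> c"
    and f: "sqs f" "\<And>x. x \<in> X \<Longrightarrow> f x \<le> 1"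
  shows "heat s f x \<le> c"
proof (rule LIMSEQ_le_const2[OF heat_lim[OF f(1) s]], intro exI allI impI)
  fix n
  note p = approx1_props[OF \<psi>]
  let ?g = "\<lambda>k x. min (f x) (\<psi> k x)"
  show "heatK (Kn n) f s x \<le> c"
  proof (rule LIMSEQ_le[OF heatK_tendsto[OF KnK s, of n ?g] c])
    fix y assume "y \<in> Kn n"
    then have y: "y \<in> X" using Kn_subset by auto
    have "(\<lambda>k. min (f y) (\<psi> k y)) \<longlonglongrightarrow> min (f y) 1" by (intro tendsto_intros p(6)[OF y])
    then show "(\<lambda>k. min (f y) (\<psi> k y)) \<longlonglongrightarrow> f y" using f(2)[OF y] by simp
  next
    have "heatK (Kn n) (?g k) s x \<le> heat s (\<psi> k) x" for k
    proof -
      have "heatK (Kn n) (?g k) s x \<le> heatK (Kn n) (\<psi> k) s x" by (rule heatK_mono[OF KnK _ s]) simp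
      also have "\<dots> \<le> heat s (\<psi> k) x" by (rule heatK_le_heat[OF p(2,3) s])
      finally show ?thesis .
    qed
    then show "\<exists>N. \<forall>k\<ge>N. heatK (Kn n) (?g k) s x \<le> heat s (\<psi> k) x" by blast
  qed
qed

lemma approx1_heat_limit:
  assumes \<phi>: "approx1 \<phi>" and s: "0 \<le> s" and x: "x \<in> X"
  obtains c where "(\<lambda>k. heat s (\<phi> k) x) \<longlonglongrightarrow> c" "c \<le> 1" "incseq (\<lambda>k. heat s (\<phi> k) x)"
proof -
  note p = approx1_props[OF \<phi>]
  have inc: "incseq (\<lambda>k. heat s (\<phi> k) x)"
    by (rule incseq_SucI) (use p incseq_SucD[OF p(5)] in \<open>auto intro!: heat_mono s\<close>)
  have le: "\<forall>k. heat s (\<phi> k) x \<le> 1" using p by (auto intro!: heat_le_1 s)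
  obtain c where "(\<lambda>k. heat s (\<phi> k) x) \<longlonglongrightarrow> c" using incseq_convergent[OF inc le] by blast
  moreover then have "c \<le> 1" by (rule LIMSEQ_le_const2) (use le in blast)
  ultimately show ?thesis using that inc by blast
qed

lemma conservative_at_any:
  assumes c: "conservative_at s" and \<phi>: "approx1 \<phi>" and s: "0 \<le> s" and x: "x \<in> X"
  shows "(\<lambda>k. heat s (\<phi> k) x) \<longlonglongrightarrow> 1"
proof -
  obtain \<psi> where \<psi>: "approx1 \<psi>" "(\<lambda>k. heat s (\<psi> k) x) \<longlonglongrightarrow> 1"
    using c x by (auto simp: conservative_at_def)
  obtain c where c: "(\<lambda>k. heat s (\<phi> k) x) \<longlonglongrightarrow> c" "c \<le> 1"
    using approx1_heat_limit[OF \<phi> s x] by blast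
  have "heat s (\<psi> k) x \<le> c" for k
    by (rule heat_le_approx_limit[OF \<phi> s x c(1)]) (use approx1_props[OF \<psi>(1)] in auto)
  then have "1 \<le> c" by (intro LIMSEQ_le_const2[OF \<psi>(2)]) blast
  then show ?thesis using c by simp
qed

definition ones :: "nat \<Rightarrow> 'a \<Rightarrow> real" where "ones k x = (if x \<in> Kn k then 1 else 0)"

lemma ones_approx1: "approx1 ones"
  unfolding increasing_l2_approx_def
proof (intro conjI allI ballI)
  fix k
  have "ones k \<in> C\<^sub>c X" using Kn_subset[of k] Kn_finite[of k]
    by (auto simp: C\<^sub>c_def ones_def intro: finite_subset[of _ "Kn k"])
  then show "ones k \<in> l2 X m" by (rule C\<^sub>c_l2)
next
  fix x assume x: "x \<in> X"
  show "incseq (\<lambda>k. ones k x)" using Kn_mono by (auto simp: incseq_def ones_def)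
  obtain n where n: "\<And>k. n \<le> k \<Longrightarrow> {x} \<subseteq> Kn k" using Kn_exhaust[of "{x}"] x by auto
  show "(\<lambda>k. ones k x) \<longlonglongrightarrow> 1"
    by (intro tendsto_eventually eventually_sequentiallyI[of n]) (use n in \<open>auto simp: ones_def\<close>)
qed (auto simp: ones_def)

text \<open>
  Mass that is lost at time \<open>s\<close> does not come back until time \<open>s + t\<close>.
\<close>

lemma conservative_at_smaller:
  assumes c: "conservative_at (s + t)" and s: "0 \<le> s" and t: "0 \<le> t"
  shows "conservative_at s"
  unfolding conservative_at_def
proof (intro exI conjI ballI)
  show "approx1 ones" by (rule ones_approx1)
  note p = approx1_props[OF ones_approx1]
  fix x assume x: "x \<in> X"
  obtain a where a: "(\<lambda>k. heat s (ones k) x) \<longlonglongrightarrow> a" "a \<le> 1"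
    using approx1_heat_limit[OF ones_approx1 s x] by blast
  have st: "0 \<le> s + t" using s t by simp
  have "heat (s + t) (ones k) x \<le> a" for k
    unfolding heat_semigroup[OF p(2) s t]
    by (rule heat_le_approx_limit[OF ones_approx1 s x a(1)]) (use p t in \<open>auto intro!: heat_sqs heat_le_1\<close>)
  then have "1 \<le> a" by (intro LIMSEQ_le_const2[OF conservative_at_any[OF c ones_approx1 st x]]) blast
  then show "(\<lambda>k. heat s (ones k) x) \<longlonglongrightarrow> 1" using a by simp
qed

text \<open>
  If no mass is lost up to time \<open>t\<close>, then the evolved functions \<open>heat t (ones k)\<close> again increase to
  one, and serve as approximating sequence for time \<open>s\<close>.
\<close>

lemma conservative_at_add:
  assumes c: "conservative_at s" "conservative_at t" and s: "0 \<le> s" and t: "0 \<le> t"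
  shows "conservative_at (s + t)"
proof -
  note p = approx1_props[OF ones_approx1]
  have a: "approx1 (\<lambda>k. heat t (ones k))"
    unfolding increasing_l2_approx_def
  proof (intro conjI allI ballI)
    fix k show "heat t (ones k) \<in> l2 X m" by (rule l2.C0_l2[OF heat_C0_semigroup t p(1)])
  next
    fix x assume x: "x \<in> X"
    show "0 \<le> heat t (ones k) x" for k using p t by (intro heat_nonneg) auto
    show "incseq (\<lambda>k. heat t (ones k) x)" using approx1_heat_limit[OF ones_approx1 t x] by blast
    show "(\<lambda>k. heat t (ones k) x) \<longlonglongrightarrow> 1" by (rule conservative_at_any[OF c(2) ones_approx1 t x])
  qed
  show ?thesis unfolding conservative_at_def
    using conservative_at_any[OF c(1) a s] ones_approx1 heat_semigroup[OF p(2) s t]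
    by (intro exI[of _ ones]) auto
qed

lemma conservative_at_all:
  assumes c: "conservative_at t" and t: "0 < t" and s: "0 \<le> s"
  shows "conservative_at s"
proof -
  have n: "conservative_at (real n * t)" for n
  proof (induction n)
    case 0
    show ?case unfolding conservative_at_def
      using ones_approx1 approx1_props[OF ones_approx1] by (intro exI[of _ ones]) (simp add: heat_0)
  next
    case (Suc n)
    then show ?case using conservative_at_add[OF c Suc] t by (simp add: algebra_simps)
  qed
  obtain n where "s / t < real n" using reals_Archimedean2 by blast
  then have "s \<le> real n * t" using t by (simp add: field_simps)
  then show ?thesis using conservative_at_smaller[of s "real n * t - s"] n s by simp
qed

text \<open>
  The definition asks for some heat semigroup; by uniqueness it can only be \<open>heat\<close>.
\<close>

lemma stochastically_complete_iff: "stochastically_complete X m b \<longleftrightarrow> (\<exists>t>0. conservative_at t)"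
proof
  assume "stochastically_complete X m b"
  then obtain S t \<phi> where S: "is_heat_semigroup X m b S" and t: "0 < t" and \<phi>: "approx1 \<phi>"
    and l: "\<forall>x\<in>X. (\<lambda>k. S t (\<phi> k) x) \<longlonglongrightarrow> 1"
    by (auto simp: stochastically_complete_def linf_extension_value_def)
  have "S t (\<phi> k) = heat t (\<phi> k)" for k
    using heat_semigroup_unique[OF S approx1_props(1)[OF \<phi>]] t by simp
  then show "\<exists>t>0. conservative_at t" using t \<phi> l by (auto simp: conservative_at_def)
next
  assume "\<exists>t>0. conservative_at t"
  then show "stochastically_complete X m b"
    using heat_is_heat_semigroup
    by (auto simp: stochastically_complete_def linf_extension_value_def conservative_at_def)
qed

lemma ones_bdd_cont: "x \<in> X \<Longrightarrow> bdd_cont 1 (\<lambda>t. heat t (ones k) x)"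
  using heat_path_continuous approx1_props[OF ones_approx1]
  by (auto simp: bdd_cont_def abs_le_iff intro: heat_le_1 order_trans[OF _ heat_nonneg])

text \<open>
  Stochastic completeness gives \<open>res (ones k) \<longlonglongrightarrow> 1\<close>. On a finite set, \<open>1 - w\<close> is a supersolution
  of the equation that defines \<open>resK\<close>: \<open>(L + 1) (1 - w) \<ge> 1\<close> by \<open>L w \<le> - w\<close>, and \<open>1 - w \<ge> 0\<close>
  outside. Hence \<open>res (ones k) \<le> 1 - w\<close> for all \<open>k\<close>.
\<close>

lemma stochastically_complete_no_subsolution:
  assumes sc: "stochastically_complete X m b"
    and w: "\<And>x. x \<in> X \<Longrightarrow> 0 \<le> w x" "\<And>x. x \<in> X \<Longrightarrow> w x \<le> 1"
    and sub: "\<And>x. x \<in> X \<Longrightarrow> lap w x \<le> - w x"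
    and x: "x \<in> X"
  shows "w x = 0"
proof -
  note p = approx1_props[OF ones_approx1]
  have all: "conservative_at s" if "0 \<le> s" for s
    using sc conservative_at_all that by (auto simp: stochastically_complete_iff)
  have "(\<lambda>k. res (ones k) x) \<longlonglongrightarrow> laplace1 (\<lambda>_. 1)"
    unfolding res_def
    by (rule laplace1_dominated[OF ones_bdd_cont[OF x]]) (intro conservative_at_any all ones_approx1 x)
  then have lim: "(\<lambda>k. res (ones k) x) \<longlonglongrightarrow> 1" by (simp add: laplace1_const)
  have "res (ones k) x \<le> 1 - w x" for k
  proof (rule LIMSEQ_le_const2[OF resK_tendsto[OF p(2)]], intro exI allI impI)
    fix n
    let ?u = "resK (Kn n) (ones k)" and ?z = "\<lambda>y. (1 - w y) - resK (Kn n) (ones k) y"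
    show "?u x \<le> 1 - w x"
    proof (cases "x \<in> Kn n")
      case True
      have "0 \<le> ?z x"
      proof (rule elliptic_comparison[OF KnK _ True])
        fix y assume y: "y \<in> Kn n"
        then have yX: "y \<in> X" using Kn_subset by auto
        have "(\<Sum>a\<in>Kn n. b y a * (1 - w a)) \<le> (\<Sum>a\<in>Kn n \<union> nbrs y. b y a * (1 - w a))"
          using KnK[of n] nbrs_finite[OF yX] nbrs_subset[of y] b_nonneg[OF yX] w(2)
          by (intro sum_mono2) (auto intro!: mult_nonneg_nonneg)
        also have "\<dots> = (\<Sum>a\<in>nbrs y. b y a * (1 - w a))"
          using KnK[of n] nbrs_finite[OF yX] nbrs_subset[of y] yX by (intro sum_nbrs) auto
        also have "\<dots> = deg y - (\<Sum>a\<in>nbrs y. b y a * w a)"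
          by (simp add: deg_def right_diff_distrib sum_subtractf)
        finally have "- (deg y * w y - (\<Sum>a\<in>nbrs y. b y a * w a)) \<le> deg y * (1 - w y) - (\<Sum>a\<in>Kn n. b y a * (1 - w a))"
          unfolding right_diff_distrib[of "deg y"] by linarith
        then have "- lap w y \<le> dirL (Kn n) (\<lambda>y. 1 - w y) y"
          using m_pos[OF yX] unfolding dirL_def lap_def minus_divide_left by (intro divide_right_mono) auto
        then have "w y \<le> dirL (Kn n) (\<lambda>y. 1 - w y) y" using sub[OF yX] by simp
        moreover have "dirL (Kn n) ?z y = dirL (Kn n) (\<lambda>y. 1 - w y) y - dirL (Kn n) ?u y"
          using dirL_lincomb[of "Kn n" 1 "\<lambda>y. 1 - w y" "-1" ?u y] by simp
        moreover have "dirL (Kn n) ?u y + ?u y = ones k y" by (rule resK_equation[OF KnK p(2) y])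
        ultimately show "0 \<le> dirL (Kn n) ?z y + ?z y" using p(4)[OF yX, of k] by simp
      qed
      then show ?thesis by simp
    next
      case False
      then show ?thesis using w(2)[OF x] by (simp add: resK_outside[OF KnK])
    qed
  qed
  then have "1 \<le> 1 - w x" by (intro LIMSEQ_le_const2[OF lim]) blast
  then show ?thesis using w(1)[OF x] by simp
qed

text \<open>
  Once the set contains all neighbours of \<open>x\<close>, the Dirichlet Laplacian at \<open>x\<close> is the formal one.
\<close>

lemma res_equation:
  assumes f: "sqs f" and x: "x \<in> X"
  shows "lap (res f) x + res f x = f x"
proof -
  obtain n where n: "\<And>k. n \<le> k \<Longrightarrow> insert x (nbrs x) \<subseteq> Kn k"
    using Kn_exhaust[of "insert x (nbrs x)"] x nbrs_finite[OF x] nbrs_subset[of x] by auto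
  have "(\<lambda>k. lap (resK (Kn k) f) x + resK (Kn k) f x) \<longlonglongrightarrow> lap (res f) x + res f x"
    unfolding lap_def using m_pos[OF x] by (intro tendsto_intros resK_tendsto f) simp
  moreover have "\<forall>\<^sub>F k in sequentially. lap (resK (Kn k) f) x + resK (Kn k) f x = f x"
  proof (rule eventually_sequentiallyI)
    fix k assume k: "n \<le> k"
    have "dirL (Kn k) (resK (Kn k) f) x = lap (resK (Kn k) f) x"
      using n[OF k] by (intro dirL_eq_lap[OF x KnK]) auto
    then show "lap (resK (Kn k) f) x + resK (Kn k) f x = f x"
      using resK_equation[OF KnK f, of x k] n[OF k] by simp
  qed
  ultimately have "(\<lambda>k::nat. f x) \<longlonglongrightarrow> lap (res f) x + res f x" by (rule Lim_transform_eventually)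
  then show ?thesis by (simp add: LIMSEQ_const_iff)
qed

text \<open>
  The limit \<open>u\<close> of \<open>res (ones k)\<close> satisfies \<open>L u + u = 1\<close>, so \<open>w = 1 - u\<close> has the required
  properties unless \<open>u = 1\<close> everywhere. In that case the average of \<open>heat s 1\<close> over the
  exponential distribution is one; since \<open>heat s 1 \<le> heat 1 1\<close> for \<open>s \<ge> 1\<close>, no mass is lost at
  time one.
\<close>

lemma not_stochastically_complete_solution:
  assumes "\<not> stochastically_complete X m b"
  obtains w where "\<And>x. x \<in> X \<Longrightarrow> 0 \<le> w x" "\<And>x. x \<in> X \<Longrightarrow> w x \<le> 1"
    "\<And>x. x \<in> X \<Longrightarrow> lap w x = - w x" "\<exists>x\<in>X. w x \<noteq> 0"
proof -
  note p = approx1_props[OF ones_approx1]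
  have r0: "0 \<le> res (ones k) x" if "x \<in> X" for k x
    using laplace1_mono[OF bdd_cont_const[of 0] ones_bdd_cont[OF that, of k]] p
    by (auto simp: res_def laplace1_const intro!: heat_nonneg)
  have r1: "res (ones k) x \<le> 1" if "x \<in> X" for k x
    using laplace1_mono[OF ones_bdd_cont[OF that, of k] bdd_cont_const[of 1]] heat_le_1[OF p(2) p(4)]
    by (auto simp: res_def laplace1_const)
  have inc: "incseq (\<lambda>k. res (ones k) x)" if "x \<in> X" for x
    unfolding res_def
    by (rule incseq_SucI, rule laplace1_mono[OF ones_bdd_cont[OF that] ones_bdd_cont[OF that]])
       (use p incseq_SucD[OF p(5)] in \<open>auto intro!: heat_mono\<close>)
  define u where "u x = lim (\<lambda>k. res (ones k) x)" for x
  have u: "(\<lambda>k. res (ones k) x) \<longlonglongrightarrow> u x" if "x \<in> X" for x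
  proof -
    have "\<forall>k. res (ones k) x \<le> 1" using r1[OF that] by blast
    from incseq_convergent[OF inc[OF that] this]
    obtain L where L: "(\<lambda>k. res (ones k) x) \<longlonglongrightarrow> L" by blast
    then show ?thesis unfolding u_def using limI[OF L] by simp
  qed
  have u0: "0 \<le> u x" and u1: "u x \<le> 1" if "x \<in> X" for x
    by (rule LIMSEQ_le_const[OF u[OF that]], use r0[OF that] in blast)
       (rule LIMSEQ_le_const2[OF u[OF that]], use r1[OF that] in blast)
  have eq: "lap u x + u x = 1" if x: "x \<in> X" for x
  proof -
    have "(\<lambda>k. lap (res (ones k)) x + res (ones k) x) \<longlonglongrightarrow> lap u x + u x"
      unfolding lap_def using m_pos[OF x] nbrs_subset x by (intro tendsto_intros u) auto
    moreover have "(\<lambda>k. lap (res (ones k)) x + res (ones k) x) \<longlonglongrightarrow> 1"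
      unfolding res_equation[OF p(2) x] by (rule p(6)[OF x])
    ultimately show ?thesis by (rule LIMSEQ_unique)
  qed
  have "\<exists>x\<in>X. u x \<noteq> 1"
  proof (rule ccontr)
    assume "\<not> (\<exists>x\<in>X. u x \<noteq> 1)"
    then have ux: "u x = 1" if "x \<in> X" for x using that by blast
    have "conservative_at 1"
      unfolding conservative_at_def
    proof (intro exI conjI ballI)
      show "approx1 ones" by (rule ones_approx1)
      fix x assume x: "x \<in> X"
      obtain c where c: "(\<lambda>k. heat 1 (ones k) x) \<longlonglongrightarrow> c" "c \<le> 1"
        using approx1_heat_limit[OF ones_approx1 _ x, of 1] by auto
      \<comment> \<open>The times before one contribute at most \<open>1 - exp (- 1)\<close>; at the later times
        the mass is at most its limit \<open>c\<close> at time one.\<close>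
      have low: "exp 1 * (res (ones k) x - (1 - exp (- 1))) \<le> c" for k
      proof -
        let ?h = "\<lambda>s. heat s (ones k) x"
        note bc = ones_bdd_cont[OF x, of k]
        have "((\<lambda>s. exp (- s)) has_integral (- exp (- 1) - - exp (- 0))) {0..1::real}"
          by (rule fundamental_theorem_of_calculus)
             (auto intro!: derivative_eq_intros simp flip: has_real_derivative_iff_has_vector_derivative)
        then have e: "((\<lambda>s. exp (- s)) has_integral (1 - exp (- 1))) {0..1::real}" by simp
        have i: "((\<lambda>s. exp (- s) * ?h s) has_integral integral {0..1} (\<lambda>s. exp (- s) * ?h s)) {0..1}"
          by (intro integrable_integral integrable_continuous_interval continuous_intros bdd_cont_continuous_on[OF bc]) auto
        have "integral {0..1} (\<lambda>s. exp (- s) * ?h s) \<le> 1 - exp (- 1)"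
        proof (rule has_integral_le[OF i e])
          fix s :: real assume "s \<in> {0..1}"
          then have "?h s \<le> 1" using p by (intro heat_le_1) auto
          then show "exp (- s) * ?h s \<le> exp (- s)" by simp
        qed
        then have "exp 1 * (res (ones k) x - (1 - exp (- 1))) \<le> laplace1 (\<lambda>s. ?h (s + 1))"
          unfolding laplace1_shift[OF bc zero_le_one] res_def[symmetric] by simp
        also have "\<dots> \<le> laplace1 (\<lambda>_. c)"
        proof (rule laplace1_mono[OF bdd_cont_shift[OF bc zero_le_one] bdd_cont_const])
          fix s :: real assume s: "0 \<le> s"
          have "?h (s + 1) = heat 1 (heat s (ones k)) x"
            using heat_semigroup[OF p(2) zero_le_one s] by (simp add: add.commute)
          also have "\<dots> \<le> c"
            by (rule heat_le_approx_limit[OF ones_approx1 zero_le_one x c(1)])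
               (use p s in \<open>auto intro!: heat_sqs heat_le_1\<close>)
          finally show "?h (s + 1) \<le> c" .
        qed
        finally show ?thesis by (simp add: laplace1_const)
      qed
      have "(\<lambda>k. exp 1 * (res (ones k) x - (1 - exp (- 1)))) \<longlonglongrightarrow> exp 1 * (u x - (1 - exp (- 1)))"
        by (intro tendsto_intros u x)
      then have "exp 1 * (u x - (1 - exp (- 1))) \<le> c" by (rule LIMSEQ_le_const2) (use low in blast)
      then have "1 \<le> c" using ux[OF x] by (simp add: exp_minus)
      then show "(\<lambda>k. heat 1 (ones k) x) \<longlonglongrightarrow> 1" using c by simp
    qed
    then have "stochastically_complete X m b" unfolding stochastically_complete_iff by (intro exI[of _ 1]) simp
    then show False using assms by simp
  qed
  moreover have "lap (\<lambda>x. 1 - u x) x = - (1 - u x)" if x: "x \<in> X" for x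
  proof -
    have "lap (\<lambda>x. 1 - u x) x = - lap u x"
      by (simp add: lap_def deg_def right_diff_distrib sum_subtractf minus_divide_left)
    then show ?thesis using eq[OF x] by simp
  qed
  ultimately show ?thesis using that[of "\<lambda>x. 1 - u x"] u0 u1 by auto
qed

end

section \<open>Refined graphs\<close>

context lf_graph
begin

lemma lap_difference:
  assumes x: "x \<in> X" and F: "finite F" "F \<subseteq> X" "nbrs x \<subseteq> F"
  shows "m x * lap u x = - (\<Sum>y\<in>F. b x y * (u y - u x))"
proof -
  have "(\<Sum>y\<in>F. b x y * (u y - u x)) = (\<Sum>y\<in>nbrs x. b x y * (u y - u x))"
    by (rule sum_nbrs[OF x F])
  also have "\<dots> = (\<Sum>y\<in>nbrs x. b x y * u y) - deg x * u x"
    by (simp add: deg_def right_diff_distrib sum_subtractf sum_distrib_right)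
  finally show ?thesis using m_pos[OF x] by (simp add: lap_def)
qed

end

text \<open>
  The components of \<open>is_refinement\<close> with the embedding \<open>\<iota>\<close>, the sets \<open>S\<close> of new vertices and the
  enumerations \<open>p\<close> as parameters.
\<close>

locale refined_graph = lf_graph X m b
  for X :: "'a set" and m :: "'a \<Rightarrow> real" and b :: "'a \<Rightarrow> 'a \<Rightarrow> real" +
  fixes d :: "'a \<Rightarrow> 'a \<Rightarrow> real" and n :: "'a \<Rightarrow> 'a \<Rightarrow> nat"
    and X' :: "'w set" and m' :: "'w \<Rightarrow> real" and b' :: "'w \<Rightarrow> 'w \<Rightarrow> real"
    and \<iota> :: "'a \<Rightarrow> 'w" and S :: "'a \<Rightarrow> 'a \<Rightarrow> 'w set" and p :: "'a \<Rightarrow> 'a \<Rightarrow> nat \<Rightarrow> 'w"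
  assumes intrinsic: "intrinsic_metric X m b d"
    and n_sym: "x \<in> X \<Longrightarrow> y \<in> X \<Longrightarrow> n x y = n y x"
    and n_pos: "x \<in> X \<Longrightarrow> y \<in> X \<Longrightarrow> n x y \<ge> 1 \<longleftrightarrow> b x y > 0"
    and inj: "inj_on \<iota> X"
    and S_card: "x \<in> X \<Longrightarrow> y \<in> X \<Longrightarrow> finite (S x y) \<and> card (S x y) = n x y"
    and S_new: "x \<in> X \<Longrightarrow> y \<in> X \<Longrightarrow> S x y \<inter> \<iota> ` X = {}"
    and S_disjoint: "x \<in> X \<Longrightarrow> y \<in> X \<Longrightarrow> u \<in> X \<Longrightarrow> v \<in> X \<Longrightarrow> {x, y} \<noteq> {u, v} \<Longrightarrow> S x y \<inter> S u v = {}"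
    and X'_eq: "X' = \<iota> ` X \<union> (\<Union>x\<in>X. \<Union>y\<in>X. S x y)"
    and m'_vertex: "x \<in> X \<Longrightarrow> m' (\<iota> x) = m x"
    and m'_edge: "x \<in> X \<Longrightarrow> y \<in> X \<Longrightarrow> b x y > 0 \<Longrightarrow> z \<in> S x y \<Longrightarrow>
        m' z = 2 * b x y * (d x y)\<^sup>2 / (real (n x y) + 1)"
    and m'_pos: "z \<in> X' \<Longrightarrow> m' z > 0"
    and p_0: "x \<in> X \<Longrightarrow> y \<in> X \<Longrightarrow> b x y > 0 \<Longrightarrow> p x y 0 = \<iota> x"
    and p_end: "x \<in> X \<Longrightarrow> y \<in> X \<Longrightarrow> b x y > 0 \<Longrightarrow> p x y (n x y + 1) = \<iota> y"
    and p_bij: "x \<in> X \<Longrightarrow> y \<in> X \<Longrightarrow> b x y > 0 \<Longrightarrow> bij_betw (p x y) {1..n x y} (S x y)"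
    and p_rev: "x \<in> X \<Longrightarrow> y \<in> X \<Longrightarrow> b x y > 0 \<Longrightarrow> i \<le> n x y + 1 \<Longrightarrow> p y x i = p x y (n x y + 1 - i)"
    and b'_edge: "x \<in> X \<Longrightarrow> y \<in> X \<Longrightarrow> b x y > 0 \<Longrightarrow> i \<in> {1..n x y + 1} \<Longrightarrow>
        b' (p x y (i - 1)) (p x y i) = b x y * (real (n x y) + 1) \<and>
        b' (p x y i) (p x y (i - 1)) = b x y * (real (n x y) + 1)"
    and b'_zero: "z \<in> X' \<Longrightarrow> w \<in> X' \<Longrightarrow>
        \<not> (\<exists>x\<in>X. \<exists>y\<in>X. b x y > 0 \<and>
             (\<exists>i\<in>{1..n x y + 1}. (z = p x y (i - 1) \<and> w = p x y i) \<or> (z = p x y i \<and> w = p x y (i - 1))))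
        \<Longrightarrow> b' z w = 0"
begin

definition edge :: "'a \<Rightarrow> 'a \<Rightarrow> bool" where "edge x y \<longleftrightarrow> x \<in> X \<and> y \<in> X \<and> 0 < b x y"

lemma edge_sym: "edge x y \<Longrightarrow> edge y x" by (auto simp: edge_def b_sym)

lemma edge_neq: "edge x y \<Longrightarrow> x \<noteq> y" using graph by (auto simp: edge_def graph_over_def)

lemma edge_n: "edge x y \<Longrightarrow> 1 \<le> n x y" using n_pos by (auto simp: edge_def)

lemma p_interior: "edge x y \<Longrightarrow> 1 \<le> i \<Longrightarrow> i \<le> n x y \<Longrightarrow> p x y i \<in> S x y"
  using p_bij[of x y] by (auto simp: edge_def bij_betw_def)

lemma p_in_X': "edge x y \<Longrightarrow> i \<le> n x y + 1 \<Longrightarrow> p x y i \<in> X'"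
proof -
  assume e: "edge x y" and i: "i \<le> n x y + 1"
  consider "i = 0" | "1 \<le> i" "i \<le> n x y" | "i = n x y + 1" using i by linarith
  then show ?thesis
  proof cases
    case 2
    then show ?thesis using p_interior[OF e] e by (auto simp: X'_eq edge_def)
  qed (use e p_0[of x y] p_end[of x y] in \<open>auto simp: X'_eq edge_def\<close>)
qed

lemma p_interior_new: "edge x y \<Longrightarrow> 1 \<le> i \<Longrightarrow> i \<le> n x y \<Longrightarrow> p x y i \<notin> \<iota> ` X"
  using p_interior[of x y i] S_new[of x y] by (auto simp: edge_def)

lemma p_vertex:
  assumes e: "edge x y" and i: "i \<le> n x y + 1" and z: "z \<in> X" and eq: "p x y i = \<iota> z"
  shows "(i = 0 \<and> z = x) \<or> (i = n x y + 1 \<and> z = y)"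
proof -
  have "\<not> (1 \<le> i \<and> i \<le> n x y)" using p_interior_new[OF e, of i] eq z by auto
  then have "i = 0 \<or> i = n x y + 1" using i by linarith
  then show ?thesis using e eq z p_0[of x y] p_end[of x y] inj by (auto simp: edge_def dest: inj_onD)
qed

lemma p_inj:
  assumes e: "edge x y" and i: "i \<le> n x y + 1" and j: "j \<le> n x y + 1" and eq: "p x y i = p x y j"
  shows "i = j"
proof (cases "1 \<le> i \<and> i \<le> n x y")
  case True
  then have "1 \<le> j \<and> j \<le> n x y"
    using p_interior_new[OF e, of i] eq p_0[of x y] p_end[of x y] e j
    by (cases "j = 0 \<or> j = n x y + 1") (auto simp: edge_def)
  then show ?thesis
    using True eq p_bij[of x y] e by (auto simp: edge_def bij_betw_def dest: inj_onD)
next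
  case False
  then have "i = 0 \<or> i = n x y + 1" using i by linarith
  then have "p x y i \<in> {\<iota> x, \<iota> y}" using p_0[of x y] p_end[of x y] e by (auto simp: edge_def)
  then obtain z where z: "z \<in> X" "p x y i = \<iota> z" using e by (auto simp: edge_def)
  show ?thesis using p_vertex[OF e i z] p_vertex[OF e j z(1)] z(2) eq edge_neq[OF e] by auto
qed

text \<open>
  A new vertex lies on one edge only, at one position, up to reversing the edge. Whatever is
  defined along edges and is invariant under reversal is therefore well defined on new vertices.
\<close>

lemma p_interior_unique:
  assumes e: "edge x y" and i: "1 \<le> i" "i \<le> n x y" and e': "edge u v" and j: "j \<le> n u v + 1"
    and eq: "p x y i = p u v j"
  shows "(u = x \<and> v = y \<and> j = i) \<or> (u = y \<and> v = x \<and> j = n x y + 1 - i)"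
proof -
  have "1 \<le> j \<and> j \<le> n u v"
    using p_interior_new[OF e i] eq p_0[of u v] p_end[of u v] e' j
    by (cases "j = 0 \<or> j = n u v + 1") (auto simp: edge_def)
  then have "p x y i \<in> S x y \<inter> S u v" using p_interior[OF e i] p_interior[OF e'] eq by auto
  then have "{x, y} = {u, v}" using S_disjoint[of x y u v] e e' by (auto simp: edge_def)
  then consider "u = x" "v = y" | "u = y" "v = x" by (auto simp: doubleton_eq_iff)
  then show ?thesis
  proof cases
    case 1
    then show ?thesis using p_inj[OF e, of i j] i j eq by auto
  next
    case 2
    then have nn: "n u v = n x y" using n_sym e by (auto simp: edge_def)
    have "p x y i = p x y (n x y + 1 - j)" using p_rev[of x y j] eq 2 e j nn by (auto simp: edge_def)
    then have "i = n x y + 1 - j" using p_inj[OF e, of i "n x y + 1 - j"] i by auto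
    then show ?thesis using 2 j nn by auto
  qed
qed

lemma b'_step:
  assumes "edge x y" "i \<le> n x y"
  shows "b' (p x y i) (p x y (Suc i)) = b x y * (real (n x y) + 1)"
    "b' (p x y (Suc i)) (p x y i) = b x y * (real (n x y) + 1)"
  using b'_edge[of x y "Suc i"] assms by (auto simp: edge_def)

text \<open>
  The symmetric description of the refined edges is reduced to steps in forward direction, by
  passing to the reversed enumeration where necessary.
\<close>

lemma b'_nonzero:
  assumes z: "z \<in> X'" and w: "w \<in> X'" and nz: "b' z w \<noteq> 0"
  obtains x y i where "edge x y" "i \<le> n x y" "z = p x y i" "w = p x y (Suc i)"
proof -
  obtain x y i where e: "edge x y" and i: "i \<in> {1..n x y + 1}"
    and zw: "(z = p x y (i - 1) \<and> w = p x y i) \<or> (z = p x y i \<and> w = p x y (i - 1))"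
    using b'_zero[OF z w] nz unfolding edge_def by blast
  from zw show ?thesis
  proof
    assume "z = p x y (i - 1) \<and> w = p x y i"
    then show ?thesis using that[OF e, of "i - 1"] i by auto
  next
    assume zw: "z = p x y i \<and> w = p x y (i - 1)"
    have nn: "n y x = n x y" using n_sym e by (auto simp: edge_def)
    let ?j = "n x y + 1 - i"
    have "p y x ?j = p x y (n x y + 1 - ?j)" "p y x (Suc ?j) = p x y (n x y + 1 - Suc ?j)"
      using p_rev[of x y] e i by (auto simp: edge_def)
    moreover have "n x y + 1 - ?j = i" "n x y + 1 - Suc ?j = i - 1" using i by auto
    ultimately show ?thesis using that[OF edge_sym[OF e], of ?j] zw nn i by auto
  qed
qed

lemma b'_sym_nonneg:
  assumes z: "z \<in> X'" and w: "w \<in> X'"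
  shows "0 \<le> b' z w" "b' z w = b' w z"
proof -
  have *: "0 \<le> b' z w \<and> b' w z = b' z w" if h: "z \<in> X'" "w \<in> X'" "b' z w \<noteq> 0" for z w
  proof -
    obtain x y i where e: "edge x y" "i \<le> n x y" and zw: "z = p x y i" "w = p x y (Suc i)"
      using b'_nonzero[OF h] .
    have "0 \<le> b x y * (real (n x y) + 1)" using e(1) by (simp add: edge_def)
    moreover have "b' z w = b x y * (real (n x y) + 1)" "b' w z = b x y * (real (n x y) + 1)"
      using b'_step[OF e] zw by simp_all
    ultimately show ?thesis by linarith
  qed
  show "0 \<le> b' z w"
  proof (cases "b' z w = 0")
    case False
    from *[OF z w False] show ?thesis by (rule conjunct1)
  qed simp
  show "b' z w = b' w z"
  proof (cases "b' z w = 0 \<and> b' w z = 0")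
    case False
    then consider "b' z w \<noteq> 0" | "b' w z \<noteq> 0" by blast
    then show ?thesis
    proof cases
      case 1
      from *[OF z w 1] show ?thesis by linarith
    next
      case 2
      from *[OF w z 2] show ?thesis by linarith
    qed
  qed simp
qed

lemma b'_diagonal:
  assumes z: "z \<in> X'"
  shows "b' z z = 0"
proof (rule ccontr)
  assume "b' z z \<noteq> 0"
  then obtain x y i where "edge x y" "i \<le> n x y" "z = p x y i" "z = p x y (Suc i)"
    using b'_nonzero[OF z z] by blast
  then show False using p_inj[of x y i "Suc i"] by auto
qed

lemma X'_cases:
  assumes "z \<in> X'"
  obtains (old) x where "x \<in> X" "z = \<iota> x"
  | (new) x y i where "edge x y" "1 \<le> i" "i \<le> n x y" "z = p x y i"
proof -
  consider "z \<in> \<iota> ` X" | x y where "x \<in> X" "y \<in> X" "z \<in> S x y" using assms by (auto simp: X'_eq)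
  then show ?thesis
  proof cases
    case 1
    then show ?thesis using old by auto
  next
    case 2
    have "finite (S x y)" "S x y \<noteq> {}" using S_card[OF 2(1,2)] 2(3) by auto
    then have "1 \<le> n x y" using S_card[OF 2(1,2)] card_gt_0_iff[of "S x y"] by linarith
    then have e: "edge x y" using 2 n_pos[of x y] by (auto simp: edge_def)
    then have "z \<in> p x y ` {1..n x y}" using p_bij[of x y] 2 by (auto simp: edge_def bij_betw_def)
    then show ?thesis using new[OF e] by auto
  qed
qed

lemma old_neighbours:
  assumes x: "x \<in> X"
  shows "{w \<in> X'. b' (\<iota> x) w \<noteq> 0} \<subseteq> (\<lambda>y. p x y 1) ` nbrs x"
proof
  fix w assume w: "w \<in> {w \<in> X'. b' (\<iota> x) w \<noteq> 0}"
  have "\<iota> x \<in> X'" using x by (auto simp: X'_eq)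
  then obtain u v i where e: "edge u v" and i: "i \<le> n u v" and z: "\<iota> x = p u v i" and w: "w = p u v (Suc i)"
    using b'_nonzero[of "\<iota> x" w] w by blast
  have "i = 0 \<and> x = u" using p_vertex[OF e _ x, of i] i z by auto
  then show "w \<in> (\<lambda>y. p x y 1) ` nbrs x" using w e by (auto simp: edge_def nbrs_def)
qed

lemma new_neighbours:
  assumes e: "edge x y" and i: "1 \<le> i" "i \<le> n x y"
  shows "{w \<in> X'. b' (p x y i) w \<noteq> 0} \<subseteq> {p x y (i - 1), p x y (Suc i)}"
proof
  fix w assume w: "w \<in> {w \<in> X'. b' (p x y i) w \<noteq> 0}"
  have "p x y i \<in> X'" using p_in_X'[OF e] i by auto
  then obtain u v j where e': "edge u v" and j: "j \<le> n u v" and z: "p x y i = p u v j" and w: "w = p u v (Suc j)"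
    using b'_nonzero[of "p x y i" w] w by blast
  from p_interior_unique[OF e i e' _ z] j
  consider "u = x" "v = y" "j = i" | "u = y" "v = x" "j = n x y + 1 - i" by auto
  then show "w \<in> {p x y (i - 1), p x y (Suc i)}"
  proof cases
    case 1
    then show ?thesis using w by simp
  next
    case 2
    have "p y x (Suc j) = p x y (n x y + 1 - Suc j)"
      using p_rev[of x y "Suc j"] e i 2 by (auto simp: edge_def)
    moreover have "n x y + 1 - Suc j = i - 1" using 2 i by auto
    ultimately show ?thesis using 2 w by simp
  qed
qed

lemma refined_lf_graph: "lf_graph X' m' b'"
proof
  have fin: "finite {w \<in> X'. b' z w \<noteq> 0}" if "z \<in> X'" for z
    using that
  proof (cases rule: X'_cases)
    case (old x)
    then show ?thesis using finite_subset[OF old_neighbours[OF old(1)]] nbrs_finite[OF old(1)] by simp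
  next
    case (new x y i)
    then show ?thesis using finite_subset[OF new_neighbours[OF new(1-3)]] by simp
  qed
  have sum: "b' z summable_on X'" if "z \<in> X'" for z
  proof -
    have "b' z summable_on {w \<in> X'. b' z w \<noteq> 0}" using fin[OF that] by (rule summable_on_finite)
    then show ?thesis
      by (subst summable_on_cong_neutral[where T = "{w \<in> X'. b' z w \<noteq> 0}" and g = "b' z"]) auto
  qed
  have "countable X'"
    unfolding X'_eq using countable_X S_card by (auto intro!: countable_UN intro: countable_finite)
  then show "graph_over X' m' b'"
    using sum m'_pos b'_sym_nonneg b'_diagonal by (auto simp: graph_over_def)
  show "locally_finite X' b'"
    unfolding locally_finite_def
  proof
    fix z assume "z \<in> X'"
    show "finite {w \<in> X'. 0 < b' z w}" by (rule finite_subset[OF _ fin[OF \<open>z \<in> X'\<close>]]) auto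
  qed
qed

sublocale ref: lf_graph X' m' b' by (rule refined_lf_graph)

text \<open>
  The linear interpolation of \<open>v\<close> along the edge minus a parabola that vanishes at both ends.
\<close>

definition profile :: "real \<Rightarrow> ('a \<Rightarrow> real) \<Rightarrow> 'a \<Rightarrow> 'a \<Rightarrow> real \<Rightarrow> real" where
  "profile \<kappa> v x y t = (let N = real (n x y) + 1 in
     v x * (1 - t / N) + v y * (t / N) - \<kappa> * (d x y)\<^sup>2 / N\<^sup>2 * (t * (N - t)))"

text \<open>
  The positive part of the profiles. On new vertices the value is selected by \<open>SOME\<close>; it is unique
  since profiles are invariant under reversal of the edge.
\<close>

definition interpolant :: "real \<Rightarrow> ('a \<Rightarrow> real) \<Rightarrow> 'w \<Rightarrow> real" where
  "interpolant \<kappa> v z =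
     (if z \<in> \<iota> ` X then max 0 (v (inv_into X \<iota> z))
      else SOME a. \<exists>x y i. edge x y \<and> 1 \<le> i \<and> i \<le> n x y \<and> z = p x y i \<and> a = max 0 (profile \<kappa> v x y (real i)))"

lemma profile_rev:
  assumes e: "edge x y" and i: "i \<le> n x y + 1"
  shows "profile \<kappa> v y x (real (n x y + 1 - i)) = profile \<kappa> v x y (real i)"
proof -
  define N where "N = real (n x y) + 1"
  have dd: "d y x = d x y" using intrinsic e by (auto simp: intrinsic_metric_def pseudo_metric_on_def edge_def)
  have nn: "n y x = n x y" using n_sym e by (auto simp: edge_def)
  have ri: "real (n x y + 1 - i) = N - real i" using i by (simp add: of_nat_diff N_def)
  have h: "(N - real i) / N = 1 - real i / N" by (simp add: diff_divide_distrib N_def)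
  show ?thesis
    unfolding profile_def Let_def dd nn ri N_def[symmetric] h by (simp add: algebra_simps)
qed

lemma interpolant_old: "x \<in> X \<Longrightarrow> interpolant \<kappa> v (\<iota> x) = max 0 (v x)"
  using inj by (simp add: interpolant_def)

lemma interpolant_new:
  assumes e: "edge x y" and i: "1 \<le> i" "i \<le> n x y"
  shows "interpolant \<kappa> v (p x y i) = max 0 (profile \<kappa> v x y (real i))"
proof -
  have "(SOME a. \<exists>u w j. edge u w \<and> 1 \<le> j \<and> j \<le> n u w \<and> p x y i = p u w j \<and> a = max 0 (profile \<kappa> v u w (real j)))
      = max 0 (profile \<kappa> v x y (real i))"
  proof (rule some_equality)
    show "\<exists>u w j. edge u w \<and> 1 \<le> j \<and> j \<le> n u w \<and> p x y i = p u w j \<and>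
        max 0 (profile \<kappa> v x y (real i)) = max 0 (profile \<kappa> v u w (real j))"
      using e i by blast
  next
    fix a assume "\<exists>u w j. edge u w \<and> 1 \<le> j \<and> j \<le> n u w \<and> p x y i = p u w j \<and> a = max 0 (profile \<kappa> v u w (real j))"
    then obtain u w j where e': "edge u w" and j: "1 \<le> j" "j \<le> n u w" and eq: "p x y i = p u w j"
      and a: "a = max 0 (profile \<kappa> v u w (real j))" by blast
    from p_interior_unique[OF e i e' _ eq] j
    consider "u = x" "w = y" "j = i" | "u = y" "w = x" "j = n x y + 1 - i" by auto
    then show "a = max 0 (profile \<kappa> v x y (real i))"
      using a profile_rev[OF e, of i \<kappa> v] i by cases auto
  qed
  then show ?thesis using p_interior_new[OF e i] by (simp add: interpolant_def)
qed

lemma profile_0: "profile \<kappa> v x y 0 = v x"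
  by (simp add: profile_def Let_def)

lemma profile_end: "profile \<kappa> v x y (real (n x y) + 1) = v y"
  by (simp add: profile_def Let_def)

lemma interpolant_edge:
  assumes e: "edge x y" and i: "i \<le> n x y + 1"
  shows "interpolant \<kappa> v (p x y i) = max 0 (profile \<kappa> v x y (real i))"
proof -
  consider "i = 0" | "1 \<le> i" "i \<le> n x y" | "i = n x y + 1" using i by linarith
  then show ?thesis
  proof cases
    case 1
    then show ?thesis using e p_0[of x y] by (simp add: edge_def interpolant_old profile_0)
  next
    case 2
    then show ?thesis by (rule interpolant_new[OF e])
  next
    case 3
    have "interpolant \<kappa> v (p x y i) = max 0 (v y)" using 3 e p_end[of x y] by (simp add: edge_def interpolant_old)
    moreover have "profile \<kappa> v x y (real i) = v y" using 3 profile_end[of \<kappa> v x y] by (simp add: add.commute)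
    ultimately show ?thesis by simp
  qed
qed

lemma profile_le:
  assumes "edge x y" "v x \<le> c" "v y \<le> c" "0 \<le> \<kappa>" "0 \<le> t" "t \<le> real (n x y) + 1"
  shows "profile \<kappa> v x y t \<le> c"
proof -
  let ?N = "real (n x y) + 1"
  have l: "0 \<le> t / ?N" "t / ?N \<le> 1" using assms by (auto simp: divide_le_eq)
  have "v x * (1 - t / ?N) + v y * (t / ?N) \<le> c * (1 - t / ?N) + c * (t / ?N)"
    using assms l by (intro add_mono mult_right_mono) auto
  also have "\<dots> = c" by (simp add: algebra_simps)
  finally have 1: "v x * (1 - t / ?N) + v y * (t / ?N) \<le> c" .
  have "0 \<le> \<kappa> * (d x y)\<^sup>2 / ?N\<^sup>2 * (t * (?N - t))" using assms by (intro mult_nonneg_nonneg) auto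
  with 1 show ?thesis by (simp add: profile_def Let_def)
qed

text \<open>
  After multiplication by the conductance and division by the mass of a new vertex, this is
  \<open>\<kappa>\<close>.
\<close>

lemma profile_second_difference:
  "profile \<kappa> v x y (t - 1) + profile \<kappa> v x y (t + 1) - 2 * profile \<kappa> v x y t
     = 2 * \<kappa> * (d x y)\<^sup>2 / (real (n x y) + 1)\<^sup>2"
proof -
  define N where "N = real (n x y) + 1"
  define q where "q = \<kappa> * (d x y)\<^sup>2 / N\<^sup>2"
  have P: "profile \<kappa> v x y t = v x * (1 - t / N) + v y * (t / N) - q * (t * (N - t))" for t
    by (simp add: profile_def Let_def N_def q_def)
  have "profile \<kappa> v x y (t - 1) + profile \<kappa> v x y (t + 1) - 2 * profile \<kappa> v x y t = 2 * q"
    unfolding P by (simp add: algebra_simps add_divide_distrib diff_divide_distrib)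
  then show ?thesis by (simp add: q_def N_def)
qed

text \<open>
  The loss of slope at an old vertex. Multiplied by \<open>b x y\<close>, the right-hand side sums to
  \<open>- m x * lap v x\<close> minus \<open>\<kappa>\<close> times the sum that is bounded by \<open>m x\<close> for an intrinsic metric.
\<close>

lemma profile_first_step:
  "(real (n x y) + 1) * (profile \<kappa> v x y 1 - v x) \<ge> (v y - v x) - \<kappa> * (d x y)\<^sup>2" if "0 \<le> \<kappa>"
proof -
  define N where "N = real (n x y) + 1"
  have N: "1 \<le> N" by (simp add: N_def)
  have P: "profile \<kappa> v x y 1 = v x * (1 - 1 / N) + v y * (1 / N) - \<kappa> * (d x y)\<^sup>2 / N\<^sup>2 * (N - 1)"
    by (simp add: profile_def Let_def N_def)
  have "N * (profile \<kappa> v x y 1 - v x) = (v y - v x) - \<kappa> * (d x y)\<^sup>2 * ((N - 1) / N)"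
    unfolding P using N by (simp add: field_simps power2_eq_square)
  moreover have "\<kappa> * (d x y)\<^sup>2 * ((N - 1) / N) \<le> \<kappa> * (d x y)\<^sup>2 * 1"
    using N that by (intro mult_left_mono) auto
  ultimately show ?thesis by (simp add: N_def)
qed

text \<open>
  The positive part of a subsolution is a subsolution: where the interpolant vanishes its Laplacian
  is nonpositive, and where it is positive it can only gain from replacing negative
  values at the neighbours by zero. At old vertices the margin \<open>2 * \<kappa>\<close> pays once for the bending and
  once for the right-hand side \<open>- W z \<ge> - \<kappa>\<close>.
\<close>

lemma interpolant_subsolution:
  assumes \<kappa>: "0 \<le> \<kappa>" and v: "\<And>x. x \<in> X \<Longrightarrow> v x \<le> \<kappa>"
    and lapv: "\<And>x. x \<in> X \<Longrightarrow> 0 < v x \<Longrightarrow> lap v x \<le> - (2 * \<kappa>)"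
    and z: "z \<in> X'"
  defines "W \<equiv> interpolant \<kappa> v"
  shows "0 \<le> W z" "W z \<le> \<kappa>" "ref.lap W z \<le> - W z"
proof -
  have W0: "0 \<le> W z" if "z \<in> X'" for z
    using that by (cases rule: X'_cases) (auto simp: W_def interpolant_old interpolant_new)
  then show "0 \<le> W z" using z by blast
  show Wk: "W z \<le> \<kappa>"
    using z
  proof (cases rule: X'_cases)
    case (old x)
    then show ?thesis using v \<kappa> by (simp add: W_def interpolant_old)
  next
    case (new x y i)
    have "profile \<kappa> v x y (real i) \<le> \<kappa>"
      using new v \<kappa> by (intro profile_le) (auto simp: edge_def)
    then show ?thesis using new \<kappa> by (simp add: W_def interpolant_new)
  qed
  have goal: "ref.lap W z \<le> - W z" if le: "m' z * W z \<le> - (m' z * ref.lap W z)"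
  proof -
    have "0 \<le> m' z * (- ref.lap W z - W z)" using le by (simp add: algebra_simps)
    then have "0 \<le> - ref.lap W z - W z" using m'_pos[OF z] by (simp add: zero_le_mult_iff)
    then show ?thesis by simp
  qed
  show "ref.lap W z \<le> - W z"
    using z
  proof (cases rule: X'_cases)
    case (old x)
    let ?F = "(\<lambda>y. p x y 1) ` nbrs x"
    have e: "edge x y" if "y \<in> nbrs x" for y using that old by (auto simp: nbrs_def edge_def)
    have inj1: "inj_on (\<lambda>y. p x y 1) (nbrs x)"
    proof (rule inj_onI)
      fix y y' assume y: "y \<in> nbrs x" "y' \<in> nbrs x" and eq: "p x y 1 = p x y' 1"
      show "y = y'" using p_interior_unique[OF e[OF y(1)] _ edge_n[OF e[OF y(1)]] e[OF y(2)] _ eq] edge_neq[OF e[OF y(1)]]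
        by auto
    qed
    have F: "finite ?F" "?F \<subseteq> X'" "ref.nbrs z \<subseteq> ?F"
      using nbrs_finite[OF old(1)] p_in_X'[OF e] old_neighbours[OF old(1)] old(2) by (auto simp: ref.nbrs_def)
    have Wz: "W z = max 0 (v x)" using old by (simp add: W_def interpolant_old)
    have "- (m' z * ref.lap W z) = (\<Sum>w\<in>?F. b' z w * (W w - W z))"
      using ref.lap_difference[OF z F, of W] by simp
    also have "\<dots> = (\<Sum>y\<in>nbrs x. b' z (p x y 1) * (W (p x y 1) - W z))"
      by (subst sum.reindex[OF inj1]) (simp add: comp_def)
    also have "\<dots> = (\<Sum>y\<in>nbrs x. b x y * (real (n x y) + 1) * (W (p x y 1) - W z))"
    proof (rule sum.cong)
      fix y assume y: "y \<in> nbrs x"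
      have "b' (p x y 0) (p x y (Suc 0)) = b x y * (real (n x y) + 1)" using b'_step(1)[OF e[OF y], of 0] by simp
      moreover have "p x y 0 = z" using e[OF y] p_0[of x y] old by (simp add: edge_def)
      ultimately show "b' z (p x y 1) * (W (p x y 1) - W z) = b x y * (real (n x y) + 1) * (W (p x y 1) - W z)" by simp
    qed simp
    finally have sum: "- (m' z * ref.lap W z) = (\<Sum>y\<in>nbrs x. b x y * (real (n x y) + 1) * (W (p x y 1) - W z))" .
    show ?thesis
    proof (rule goal, cases "0 < v x")
      case False
      then have "W z = 0" using Wz by simp
      then show "m' z * W z \<le> - (m' z * ref.lap W z)"
        unfolding sum using W0[OF p_in_X'[OF e]] b_nonneg[OF old(1)] nbrs_subset
        by (auto intro!: sum_nonneg mult_nonneg_nonneg simp: subset_iff)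
    next
      case True
      have int: "(\<lambda>y. b x y * (d x y)\<^sup>2) summable_on X" "(\<Sum>\<^sub>\<infinity>y\<in>X. b x y * (d x y)\<^sup>2) \<le> m x"
        using intrinsic old by (auto simp: intrinsic_metric_def)
      have "(\<Sum>y\<in>nbrs x. b x y * (d x y)\<^sup>2) \<le> (\<Sum>\<^sub>\<infinity>y\<in>X. b x y * (d x y)\<^sup>2)"
        using int(1) nbrs_finite[OF old(1)] nbrs_subset b_nonneg[OF old(1)] by (intro finite_sum_le_infsum) auto
      \<comment> \<open>The intrinsic condition bounds the total cost of bending the edges at \<open>x\<close>.\<close>
      then have loss: "(\<Sum>y\<in>nbrs x. b x y * (d x y)\<^sup>2) \<le> m x" using int(2) by simp
      have mx: "0 < m x" "m' z = m x" using m_pos m'_vertex old by auto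
      have "m x * W z \<le> m x * \<kappa>" using Wk mx by (intro mult_left_mono) auto
      also have "\<dots> \<le> m x * (- lap v x) - \<kappa> * m x"
        using mult_left_mono[OF lapv[OF old(1) True], of "m x"] mx by (simp add: algebra_simps)
      also have "\<dots> \<le> m x * (- lap v x) - \<kappa> * (\<Sum>y\<in>nbrs x. b x y * (d x y)\<^sup>2)"
        using mult_left_mono[OF loss \<kappa>] by simp
      also have "m x * (- lap v x) = (\<Sum>y\<in>nbrs x. b x y * (v y - v x))"
        using lap_difference[OF old(1) nbrs_finite[OF old(1)] nbrs_subset order.refl, of v] by simp
      also have "\<dots> - \<kappa> * (\<Sum>y\<in>nbrs x. b x y * (d x y)\<^sup>2) = (\<Sum>y\<in>nbrs x. b x y * ((v y - v x) - \<kappa> * (d x y)\<^sup>2))"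
        unfolding sum_distrib_left sum_subtractf[symmetric] by (simp add: algebra_simps)
      also have "\<dots> \<le> (\<Sum>y\<in>nbrs x. b x y * (real (n x y) + 1) * (W (p x y 1) - W z))"
      proof (rule sum_mono)
        fix y assume y: "y \<in> nbrs x"
        have "W (p x y 1) = max 0 (profile \<kappa> v x y 1)"
          using interpolant_edge[OF e[OF y], of 1 \<kappa> v] by (simp add: W_def)
        then have "profile \<kappa> v x y 1 - v x \<le> W (p x y 1) - W z" using Wz True by simp
        then have "(real (n x y) + 1) * (profile \<kappa> v x y 1 - v x) \<le> (real (n x y) + 1) * (W (p x y 1) - W z)"
          by (intro mult_left_mono) auto
        with profile_first_step[OF \<kappa>, of v y x]
        have "(v y - v x) - \<kappa> * (d x y)\<^sup>2 \<le> (real (n x y) + 1) * (W (p x y 1) - W z)" by linarith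
        then have "b x y * ((v y - v x) - \<kappa> * (d x y)\<^sup>2) \<le> b x y * ((real (n x y) + 1) * (W (p x y 1) - W z))"
          using e[OF y] by (intro mult_left_mono) (auto simp: edge_def)
        then show "b x y * ((v y - v x) - \<kappa> * (d x y)\<^sup>2) \<le> b x y * (real (n x y) + 1) * (W (p x y 1) - W z)"
          by (simp add: mult.assoc)
      qed
      finally show "m' z * W z \<le> - (m' z * ref.lap W z)" by (subst sum) (simp only: mx(2))
    qed
  next
    case (new x y i)
    define B where "B = b x y * (real (n x y) + 1)"
    have B: "0 < B" using new by (auto simp: B_def edge_def)
    let ?F = "{p x y (i - 1), p x y (Suc i)}"
    have ne: "p x y (i - 1) \<noteq> p x y (Suc i)"
    proof
      assume eq: "p x y (i - 1) = p x y (Suc i)"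
      have "i - 1 \<le> n x y + 1" "Suc i \<le> n x y + 1" using new by auto
      from p_inj[OF new(1) this eq] show False by linarith
    qed
    have F: "finite ?F" "?F \<subseteq> X'" "ref.nbrs z \<subseteq> ?F"
      using p_in_X'[OF new(1)] new_neighbours[OF new(1-3)] new by (auto simp: ref.nbrs_def)
    have bs: "b' z (p x y (i - 1)) = B" "b' z (p x y (Suc i)) = B"
      using b'_step(2)[OF new(1), of "i - 1"] b'_step(1)[OF new(1), of i] new by (auto simp: B_def)
    have W: "W (p x y j) = max 0 (profile \<kappa> v x y (real j))" if "j \<le> n x y + 1" for j
      using interpolant_edge[OF new(1) that] by (simp add: W_def)
    have sum: "- (m' z * ref.lap W z) = B * ((W (p x y (i - 1)) - W z) + (W (p x y (Suc i)) - W z))"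
      using ref.lap_difference[OF z F, of W] ne bs by (simp add: algebra_simps)
    show ?thesis
    proof (rule goal, cases "0 < profile \<kappa> v x y (real i)")
      case False
      then have "W z = 0" using W[of i] new by simp
      moreover have "0 \<le> W (p x y (i - 1))" "0 \<le> W (p x y (Suc i))" using W0 F(2) by auto
      ultimately show "m' z * W z \<le> - (m' z * ref.lap W z)" unfolding sum using B by simp
    next
      case True
      let ?g = "profile \<kappa> v x y"
      let ?N = "real (n x y) + 1"
      have "z \<in> S x y" using p_interior[OF new(1-3)] new(4) by simp
      then have mz: "m' z = 2 * b x y * (d x y)\<^sup>2 / ?N" using m'_edge new(1) by (auto simp: edge_def)
      have "m' z * W z \<le> m' z * \<kappa>" using Wk m'_pos[OF z] by (intro mult_left_mono) auto
      also have "\<dots> = B * (2 * \<kappa> * (d x y)\<^sup>2 / ?N\<^sup>2)" unfolding mz B_def by (simp add: power2_eq_square)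
      also have "\<dots> = B * ((?g (real i - 1) - ?g (real i)) + (?g (real i + 1) - ?g (real i)))"
        using profile_second_difference[of \<kappa> v x y "real i"] by simp
      also have "\<dots> \<le> B * ((W (p x y (i - 1)) - W z) + (W (p x y (Suc i)) - W z))"
      proof (intro mult_left_mono add_mono diff_mono)
        show "?g (real i - 1) \<le> W (p x y (i - 1))" using W[of "i - 1"] new by (simp add: of_nat_diff)
        show "?g (real i + 1) \<le> W (p x y (Suc i))" using W[of "Suc i"] new by (simp add: add.commute)
        show "W z \<le> ?g (real i)" "W z \<le> ?g (real i)" using W[of i] new True by auto
      qed (use B in simp)
      finally show "m' z * W z \<le> - (m' z * ref.lap W z)" unfolding sum .
    qed
  qed
qed

text \<open>
  If \<open>b\<close> were not stochastically complete, then the interpolant of the top third of the solution \<open>w\<close>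
  would be a nonzero bounded subsolution on the refined graph.
\<close>

theorem stochastically_complete_descends:
  assumes sc: "stochastically_complete X' m' b'"
  shows "stochastically_complete X m b"
proof (rule ccontr)
  assume "\<not> stochastically_complete X m b"
  then obtain w where w0: "\<And>x. x \<in> X \<Longrightarrow> 0 \<le> w x" and w1: "\<And>x. x \<in> X \<Longrightarrow> w x \<le> 1"
    and lapw: "\<And>x. x \<in> X \<Longrightarrow> lap w x = - w x" and nz: "\<exists>x\<in>X. w x \<noteq> 0"
    using not_stochastically_complete_solution by blast
  define s where "s = (SUP x\<in>X. w x)"
  have bdd: "bdd_above (w ` X)" using w1 by (auto intro!: bdd_aboveI[of _ 1])
  have ne: "w ` X \<noteq> {}" using nz by auto
  have ws: "w x \<le> s" if "x \<in> X" for x unfolding s_def using that bdd by (intro cSUP_upper)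
  have s0: "0 < s" using nz ws w0 by (metis less_eq_real_def order.strict_trans2)
  have s1: "s \<le> 1" unfolding s_def using ne w1 by (intro cSUP_least) auto
  \<comment> \<open>One third of the supremum remains above the cut at \<open>2 * \<kappa>\<close>, and the cut equals the
    margin that \<open>interpolant_subsolution\<close> asks for.\<close>
  define \<kappa> where "\<kappa> = s / 3"
  define v where "v x = w x - 2 * \<kappa>" for x
  have \<kappa>: "0 < \<kappa>" "\<kappa> \<le> 1" using s0 s1 by (auto simp: \<kappa>_def)
  have v: "v x \<le> \<kappa>" if "x \<in> X" for x using ws[OF that] by (simp add: v_def \<kappa>_def)
  have lapv: "lap v x \<le> - (2 * \<kappa>)" if "x \<in> X" "0 < v x" for x
  proof -
    have "m x * lap v x = m x * lap w x"
      unfolding lap_difference[OF that(1) nbrs_finite[OF that(1)] nbrs_subset order.refl] by (simp add: v_def)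
    then have "lap v x = lap w x" using m_pos[OF that(1)] by simp
    then have "lap v x = - w x" using lapw[OF that(1)] by simp
    then show ?thesis using that(2) by (simp add: v_def)
  qed
  have "2 * \<kappa> < s" using s0 by (simp add: \<kappa>_def)
  then obtain x where x: "x \<in> X" "2 * \<kappa> < w x"
    unfolding s_def using less_cSUP_iff[OF _ bdd, of "2 * \<kappa>"] ne by auto
  have x': "\<iota> x \<in> X'" using x by (auto simp: X'_eq)
  note sub = interpolant_subsolution[OF less_imp_le[OF \<kappa>(1)] v lapv]
  have "interpolant \<kappa> v (\<iota> x) = 0"
    by (rule ref.stochastically_complete_no_subsolution[OF sc _ _ _ x'])
       (use sub \<kappa>(2) in \<open>auto intro: order_trans\<close>)
  then show False using x by (simp add: interpolant_old v_def)
qed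

end

theorem theorem1p5:
  fixes X :: "'a set" and m :: "'a \<Rightarrow> real" and b d :: "'a \<Rightarrow> 'a \<Rightarrow> real"
    and n :: "'a \<Rightarrow> 'a \<Rightarrow> nat"
    and X' :: "'w set" and m' :: "'w \<Rightarrow> real" and b' :: "'w \<Rightarrow> 'w \<Rightarrow> real"
  assumes "graph_over X m b"
    and "locally_finite X b"
    and "intrinsic_metric X m b d"
    and "\<And>x y. x \<in> X \<Longrightarrow> y \<in> X \<Longrightarrow> n x y = n y x"
    and "\<And>x y. x \<in> X \<Longrightarrow> y \<in> X \<Longrightarrow> n x y \<ge> 1 \<longleftrightarrow> b x y > 0"
    and "is_refinement X m b d n X' m' b'"
    and "stochastically_complete X' m' b'"
  shows "stochastically_complete X m b"
proof -
  obtain \<iota> S p where r: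
    "inj_on \<iota> X"
    "\<forall>x\<in>X. \<forall>y\<in>X. finite (S x y) \<and> card (S x y) = n x y \<and> S x y = S y x \<and> S x y \<inter> \<iota> ` X = {}"
    "\<forall>x\<in>X. \<forall>y\<in>X. \<forall>u\<in>X. \<forall>v\<in>X. {x, y} \<noteq> {u, v} \<longrightarrow> S x y \<inter> S u v = {}"
    "X' = \<iota> ` X \<union> (\<Union>x\<in>X. \<Union>y\<in>X. S x y)"
    "\<forall>x\<in>X. m' (\<iota> x) = m x"
    "\<forall>x\<in>X. \<forall>y\<in>X. b x y > 0 \<longrightarrow> (\<forall>z\<in>S x y. m' z = 2 * b x y * (d x y)\<^sup>2 / (real (n x y) + 1))"
    "\<forall>z\<in>X'. m' z > 0"
    "\<forall>x\<in>X. \<forall>y\<in>X. b x y > 0 \<longrightarrow> p x y 0 = \<iota> x \<and> p x y (n x y + 1) = \<iota> y \<and>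
        bij_betw (p x y) {1..n x y} (S x y) \<and> (\<forall>i\<le>n x y + 1. p y x i = p x y (n x y + 1 - i))"
    "\<forall>x\<in>X. \<forall>y\<in>X. b x y > 0 \<longrightarrow> (\<forall>i\<in>{1..n x y + 1}.
        b' (p x y (i - 1)) (p x y i) = b x y * (real (n x y) + 1) \<and>
        b' (p x y i) (p x y (i - 1)) = b x y * (real (n x y) + 1))"
    "\<forall>z\<in>X'. \<forall>w\<in>X'. \<not> (\<exists>x\<in>X. \<exists>y\<in>X. b x y > 0 \<and>
        (\<exists>i\<in>{1..n x y + 1}. (z = p x y (i - 1) \<and> w = p x y i) \<or> (z = p x y i \<and> w = p x y (i - 1))))
        \<longrightarrow> b' z w = 0"
    using assms(6) unfolding is_refinement_def by (elim exE conjE) (rule that)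
  interpret refined_graph X m b d n X' m' b' \<iota> S p
  proof (unfold_locales, goal_cases)
    case 1
    then show ?case using assms(1) by simp
  next
    case 2
    then show ?case using assms(2) by simp
  next
    case 3
    then show ?case using assms(3) by simp
  next
    case 4
    then show ?case using assms(4) by simp
  next
    case 5
    then show ?case using assms(5) by simp
  next
    case 6
    then show ?case using r(1) by simp
  next
    case 7
    then show ?case using r(2) by blast
  next
    case 8
    then show ?case using r(2) by blast
  next
    case 9
    then show ?case using r(3) by blast
  next
    case 10
    then show ?case using r(4) by simp
  next
    case 11
    then show ?case using r(5) by simp
  next
    case 12
    then show ?case using r(6) by blast
  next
    case 13
    then show ?case using r(7) by blast
  next
    case 14
    then show ?case using r(8) by blast
  next
    case 15
    then show ?case using r(8) by blast
  next
    case 16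
    then show ?case using r(8) by blast
  next
    case 17
    then show ?case using r(8) by blast
  next
    case 18
    then show ?case using r(9) by blast
  next
    case 19
    then show ?case using r(10) by blast
  qed
  show ?thesis using assms(7) by (rule stochastically_complete_descends)
qed

end
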